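(* Let $T:\mathcal{S}(\mathbb{R}^n)\times\mathcal{S}(\mathbb{R}^n)\to\mathcal{S}'(\mathbb{R}^n)$ be a bilinear continuous operator associated to a complex-valued locally integrable function $\mathcal{K}$ defined on $\mathbb{R}^{3n}\setminus\Delta$ such that, for some $0<\varepsilon<1$, $0<s\le1$ and some constants $c,C>0$, $$|\mathcal{K}(x,y,z)-\mathcal{K}(x',y,z)|\le C\,\frac{|x-x'|^s}{(|x-y|+|x-z|)^{2n+\frac{s}{\varepsilon}}}\quad\text{whenever } |x-x'|^\varepsilon\le c\,(|x-y|+|x-z|).$$ Assume also that $T$ can be extended to a bounded operator from $L^2(\mathbb{R}^n)\times L^2(\mathbb{R}^n)$ into $L^1(\mathbb{R}^n)$ and from $L^2(\mathbb{R}^n)\times L^2(\mathbb{R}^n)$ into $L^{1/\varepsilon}(\mathbb{R}^n)$. Then there is a constant $C'>0$ such that $$\mathcal{M}^{\#}(T(f,g))(x)\le C'\,\mathcal{M}_2(f)(x)\,\mathcal{M}_2(g)(x)\quad\text{for all }x\in\mathbb{R}^n\text{ and all } f,g\in L^\infty_c(\mathbb{R}^n),$$ where $\mathcal{M}_2(h)=\left(\mathcal{M}(|h|^2)\right)^{1/2}$.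
   Context: Notation. $\mathcal{S}(\mathbb{R}^n)$ is the Schwartz class, $\mathcal{S}'(\mathbb{R}^n)$ the tempered distributions, $L_c^\infty(\mathbb{R}^n)$ the space of bounded measurable functions with compact support, and $\Delta=\{(x,x,x):x\in\mathbb{R}^n\}\subset\mathbb{R}^{3n}$. Maximal operators. For $f\in L^1_{\mathrm{loc}}(\mathbb{R}^n)$, $$\mathcal{M}(f)(x)=\sup_{Q\ni x}\frac{1}{|Q|}\int_Q|f(y)|\,dy,\qquad \mathcal{M}^{\#}(f)(x)=\sup_{Q\ni x}\frac{1}{|Q|}\int_Q|f(y)-f_Q|\,dy,\qquad f_Q=\frac{1}{|Q|}\int_Q f(y)\,dy,$$ where the suprema are over all cubes $Q\subset\mathbb{R}^n$ containing $x$. Boundedness and extension. A bilinear operator is bounded from $X\times Y$ into $Z$ if $\|T(f,g)\|_Z\le C\|f\|_X\|g\|_Y$ for some constant $C$ and all $f\in X$, $g\in Y$. "$T$ can be extended to a bounded operator from $X\times Y$ into $Z$" means that there is a bounded bilinear operator from $X\times Y$ into $Z$ that agrees with $T$ on pairs of Schwartz functions. For $f,g\in L_c^\infty(\mathbb{R}^n)$, $T(f,g)$ is understood through the extension of $T$ to $L^2(\mathbb{R}^n)\times L^2(\mathbb{R}^n)$. Associated kernel. A continuous bilinear operator $T:\mathcal{S}(\mathbb{R}^n)\times\mathcal{S}(\mathbb{R}^n)\to\mathcal{S}'(\mathbb{R}^n)$ is associated to a complex-valued locally integrable function $\mathcal{K}$ defined on $\mathbb{R}^{3n}\setminus\Delta$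 if for all $f,g\in C_c^\infty(\mathbb{R}^n)$, $$T(f,g)(x)=\int_{\mathbb{R}^{2n}}\mathcal{K}(x,y,z)f(y)g(z)\,dy\,dz\quad\text{for all }x\notin\operatorname{supp}(f)\cap\operatorname{supp}(g).$$ *)

theory Defs
  imports "HOL-Analysis.Analysis"
begin

text \<open>
  Functions on $n$-space are total functions of type \<open>real ^ 'n \<Rightarrow> complex\<close>, not classes modulo
  null sets, and measurability and integrals refer to Lebesgue measure.
\<close>

definition supp :: "('a::topological_space \<Rightarrow> 'b::zero) \<Rightarrow> 'a set" where
  "supp f = closure {x. f x \<noteq> 0}"

definition partial_deriv :: "'n \<Rightarrow> (real ^ 'n \<Rightarrow> complex) \<Rightarrow> real ^ 'n \<Rightarrow> complex" where
  "partial_deriv i f x = frechet_derivative f (at x) (axis i 1)"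

text \<open>Derivatives of arbitrary order are indexed by the list of the directions of differentiation.\<close>

definition iter_deriv :: "'n list \<Rightarrow> (real ^ 'n \<Rightarrow> complex) \<Rightarrow> real ^ 'n \<Rightarrow> complex" where
  "iter_deriv is f = foldr partial_deriv is f"

definition smooth :: "(real ^ 'n \<Rightarrow> complex) \<Rightarrow> bool" where
  "smooth f \<longleftrightarrow> (\<forall>is. iter_deriv is f differentiable_on UNIV)"

definition test_functions :: "(real ^ 'n \<Rightarrow> complex) set" where
  "test_functions = {f. smooth f \<and> compact (supp f)}"

definition schwartz :: "(real ^ 'n \<Rightarrow> complex) set" where
  "schwartz = {f. smooth f \<and> (\<forall>k is. bounded (range (\<lambda>x. norm x ^ k *\<^sub>R iter_deriv is f x)))}"

definition schwartz_seminorm :: "nat \<Rightarrow> 'n list \<Rightarrow> (real ^ 'n \<Rightarrow> complex) \<Rightarrow> real" where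
  "schwartz_seminorm k is f = (SUP x. norm x ^ k * norm (iter_deriv is f x))"

definition schwartz_topology :: "(real ^ 'n \<Rightarrow> complex) topology" where
  "schwartz_topology = topology_generated_by
     {{g \<in> schwartz. schwartz_seminorm k is (\<lambda>x. g x - f x) < r} | f k is r. f \<in> schwartz \<and> 0 < r}"

text \<open>Only the values of a distribution on \<^const>\<open>schwartz\<close> are meaningful.\<close>

type_synonym 'n distribution = "(real ^ 'n \<Rightarrow> complex) \<Rightarrow> complex"

definition tempered :: "'n::finite distribution set" where
  "tempered = {u. (\<forall>f\<in>schwartz. \<forall>g\<in>schwartz. u (\<lambda>x. f x + g x) = u f + u g)
     \<and> (\<forall>a. \<forall>f\<in>schwartz. u (\<lambda>x. a * f x) = a * u f)
     \<and> continuous_map schwartz_topology euclidean u}"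

text \<open>The weak-star topology.\<close>

definition tempered_topology :: "'n::finite distribution topology" where
  "tempered_topology = topology_generated_by
     {{u \<in> tempered. u \<phi> \<in> V} | \<phi> V. \<phi> \<in> schwartz \<and> open V}"

definition bilinear_on_schwartz ::
    "((real ^ 'n \<Rightarrow> complex) \<Rightarrow> (real ^ 'n \<Rightarrow> complex) \<Rightarrow> 'n::finite distribution) \<Rightarrow> bool" where
  "bilinear_on_schwartz T \<longleftrightarrow>
     (\<forall>f1\<in>schwartz. \<forall>f2\<in>schwartz. \<forall>g\<in>schwartz. \<forall>\<phi>\<in>schwartz.
        T (\<lambda>x. f1 x + f2 x) g \<phi> = T f1 g \<phi> + T f2 g \<phi>) \<and>
     (\<forall>f\<in>schwartz. \<forall>g1\<in>schwartz. \<forall>g2\<in>schwartz. \<forall>\<phi>\<in>schwartz.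
        T f (\<lambda>x. g1 x + g2 x) \<phi> = T f g1 \<phi> + T f g2 \<phi>) \<and>
     (\<forall>a. \<forall>f\<in>schwartz. \<forall>g\<in>schwartz. \<forall>\<phi>\<in>schwartz.
        T (\<lambda>x. a * f x) g \<phi> = a * T f g \<phi> \<and> T f (\<lambda>x. a * g x) \<phi> = a * T f g \<phi>)"

definition continuous_bilinear_operator ::
    "((real ^ 'n \<Rightarrow> complex) \<Rightarrow> (real ^ 'n \<Rightarrow> complex) \<Rightarrow> 'n::finite distribution) \<Rightarrow> bool" where
  "continuous_bilinear_operator T \<longleftrightarrow> bilinear_on_schwartz T \<and>
     continuous_map (prod_topology schwartz_topology schwartz_topology) tempered_topology
       (\<lambda>(f, g). T f g)"

text \<open>
  A kernel is a total function of three variables whose values on the diagonal are irrelevant.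
\<close>

definition diag3 :: "('a \<times> 'a \<times> 'a) set" where
  "diag3 = {(x, x, x) | x. True}"

definition locally_integrable_on ::
    "('a::euclidean_space \<Rightarrow> complex) \<Rightarrow> 'a set \<Rightarrow> bool" where
  "locally_integrable_on F U \<longleftrightarrow> (\<forall>D. compact D \<and> D \<subseteq> U \<longrightarrow> set_integrable lebesgue D F)"

text \<open>
  Since \<open>T f g\<close> is a distribution, its pointwise description off the closed set
  \<open>supp f \<inter> supp g\<close> is the identity of distributions on the open complement, i.e. tested
  against all smooth functions with compact support in that complement.
\<close>

definition associated_kernel ::
    "((real ^ 'n \<Rightarrow> complex) \<Rightarrow> (real ^ 'n \<Rightarrow> complex) \<Rightarrow> 'n::finite distribution) \<Rightarrow>
     (real ^ 'n \<Rightarrow> real ^ 'n \<Rightarrow> real ^ 'n \<Rightarrow> complex) \<Rightarrow> bool" where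
  "associated_kernel T K \<longleftrightarrow>
     locally_integrable_on (\<lambda>(x, y, z). K x y z) (- diag3) \<and>
     (\<forall>f\<in>test_functions. \<forall>g\<in>test_functions. \<forall>\<phi>\<in>test_functions.
        supp \<phi> \<subseteq> - (supp f \<inter> supp g) \<longrightarrow>
        T f g \<phi> = (\<integral>x. (\<integral>(y, z). K x y z * f y * g z \<partial>lebesgue) * \<phi> x \<partial>lebesgue))"

definition Lp :: "real \<Rightarrow> (real ^ 'n \<Rightarrow> complex) set" where
  "Lp p = {f \<in> borel_measurable lebesgue. integrable lebesgue (\<lambda>x. norm (f x) powr p)}"

definition Lp_norm :: "real \<Rightarrow> (real ^ 'n \<Rightarrow> complex) \<Rightarrow> real" where
  "Lp_norm p f = (\<integral>x. norm (f x) powr p \<partial>lebesgue) powr (1 / p)"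

text \<open>
  Values of \<open>U\<close> matter only up to null sets, so the identities hold almost everywhere; together
  with the norm bound they imply that \<open>U\<close> respects almost everywhere equality of its arguments.
\<close>

definition bounded_bilinear_Lp :: "real \<Rightarrow> real \<Rightarrow> real \<Rightarrow>
    ((real ^ 'n \<Rightarrow> complex) \<Rightarrow> (real ^ 'n \<Rightarrow> complex) \<Rightarrow> real ^ 'n \<Rightarrow> complex) \<Rightarrow> bool" where
  "bounded_bilinear_Lp p q r U \<longleftrightarrow>
     (\<forall>f\<in>Lp p. \<forall>g\<in>Lp q. U f g \<in> Lp r) \<and>
     (\<forall>f1\<in>Lp p. \<forall>f2\<in>Lp p. \<forall>g\<in>Lp q.
        AE x in lebesgue. U (\<lambda>x. f1 x + f2 x) g x = U f1 g x + U f2 g x) \<and>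
     (\<forall>f\<in>Lp p. \<forall>g1\<in>Lp q. \<forall>g2\<in>Lp q.
        AE x in lebesgue. U f (\<lambda>x. g1 x + g2 x) x = U f g1 x + U f g2 x) \<and>
     (\<forall>a. \<forall>f\<in>Lp p. \<forall>g\<in>Lp q. AE x in lebesgue.
        U (\<lambda>x. a * f x) g x = a * U f g x \<and> U f (\<lambda>x. a * g x) x = a * U f g x) \<and>
     (\<exists>C. \<forall>f\<in>Lp p. \<forall>g\<in>Lp q. Lp_norm r (U f g) \<le> C * Lp_norm p f * Lp_norm q g)"

text \<open>
  A function in \<open>Lp r\<close> is identified with the distribution given by integration against it.
\<close>

definition bounded_extension :: "real \<Rightarrow> real \<Rightarrow> real \<Rightarrow>
    ((real ^ 'n \<Rightarrow> complex) \<Rightarrow> (real ^ 'n \<Rightarrow> complex) \<Rightarrow> 'n::finite distribution) \<Rightarrow>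
    ((real ^ 'n \<Rightarrow> complex) \<Rightarrow> (real ^ 'n \<Rightarrow> complex) \<Rightarrow> real ^ 'n \<Rightarrow> complex) \<Rightarrow> bool" where
  "bounded_extension p q r T U \<longleftrightarrow> bounded_bilinear_Lp p q r U \<and>
     (\<forall>f\<in>schwartz. \<forall>g\<in>schwartz. \<forall>\<phi>\<in>schwartz.
        T f g \<phi> = (\<integral>x. U f g x * \<phi> x \<partial>lebesgue))"

definition Linf_c :: "(real ^ 'n \<Rightarrow> complex) set" where
  "Linf_c = {f \<in> borel_measurable lebesgue. bounded (range f) \<and> compact (supp f)}"

text \<open>Cubes have sides parallel to the axes and are nondegenerate.\<close>

definition cubes :: "(real ^ 'n) set set" where
  "cubes = {cbox a (a + (\<chi> i. l)) | a l. 0 < l}"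

definition average :: "(real ^ 'n) set \<Rightarrow> (real ^ 'n \<Rightarrow> complex) \<Rightarrow> complex" where
  "average Q f = set_lebesgue_integral lebesgue Q f / of_real (measure lebesgue Q)"

text \<open>The maximal functions take values in the extended nonnegative reals.\<close>

definition maximal :: "(real ^ 'n \<Rightarrow> complex) \<Rightarrow> real ^ 'n \<Rightarrow> ennreal" where
  "maximal f x = (SUP Q\<in>{Q \<in> cubes. x \<in> Q}.
     (\<integral>\<^sup>+y\<in>Q. ennreal (norm (f y)) \<partial>lebesgue) / emeasure lebesgue Q)"

definition sharp_maximal :: "(real ^ 'n \<Rightarrow> complex) \<Rightarrow> real ^ 'n \<Rightarrow> ennreal" where
  "sharp_maximal f x = (SUP Q\<in>{Q \<in> cubes. x \<in> Q}.
     (\<integral>\<^sup>+y\<in>Q. ennreal (norm (f y - average Q f)) \<partial>lebesgue) / emeasure lebesgue Q)"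

definition ennreal_sqrt :: "ennreal \<Rightarrow> ennreal" where
  "ennreal_sqrt t = (if t = \<infinity> then \<infinity> else ennreal (sqrt (enn2real t)))"

definition maximal2 :: "(real ^ 'n \<Rightarrow> complex) \<Rightarrow> real ^ 'n \<Rightarrow> ennreal" where
  "maximal2 h x = ennreal_sqrt (maximal (\<lambda>y. of_real ((norm (h y))\<^sup>2)) x)"

end

(*
  Let Q be a cube of side l, and enlarge it on every side by R = kappa * max l (l powr eps). Split
  f = f0 + f1 and g = g0 + g1 into the parts inside and outside the enlarged cube Q', so that
  U f g = U f0 g0 + U f0 g1 + U f1 g. The first term is controlled by the L^1 bound if l >= 1 and by
  Hoelder's inequality and the L^(1/eps) bound if l < 1: in both cases the operator norm makes up for
  the ratio of the volumes of Q' and Q. In the other two terms one of the arguments vanishes on Q'. If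
  they are test functions with the same separation, the term is given on Q by absolutely convergent
  kernel integrals, whose oscillation the hypothesis on K bounds by l powr s * R powr (- s/eps) <= 1
  times averages of the arguments over dyadically growing cubes. Test functions with supports in a
  given open set are dense among the L^2 functions vanishing outside it, and the averages are only
  affected by an arbitrarily small L^2 error, so the bound passes to all of L^2. Density also shows
  that the two extensions agree almost everywhere, so that each of them satisfies both bounds.
*)

theory Submission
  imports Defs
begin

section \<open>Smooth functions\<close>

text \<open>Three demands fix the choice of R: l <= R, so that the cubes of side comparable to 2 ^ j
  * R contain Q; l powr eps <= R, so that the oscillation factor is at most 1; and (n * l) powr eps
  <= c * R, so that any two points of Q are admissible in the hypothesis on K as soon as y or z lies
  outside Q'. For l < 1 the second demand makes Q' much larger than Q, of volume about |Q| powr eps.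
  This is what the L^(1/eps) bound pays for: Hoelder's inequality on Q yields |Q| powr (1 - eps),
  and the product is |Q|.

  The bound holds at every x because f and g enter only through their L^2 averages over cubes
  containing Q, which M_2 controls at each point of Q. The obstacle is that K describes T only as a
  distribution and only on test functions; the approximants keep the supports exactly, but the
  averages only up to an error, which is measured against |Q| because no cube containing Q has
  smaller volume. Since M_2 may vanish at x, it is first replaced by a larger positive
  number.\<close>

lemma partial_deriv_eq:
  assumes "(f has_derivative D) (at x)"
  shows "partial_deriv i f x = D (axis i 1)"
  using frechet_derivative_at[OF assms] by (simp add: partial_deriv_def)

text \<open>The lists of directions in \<open>smooth\<close> are traded for an order of
  differentiability, so that closure under products and exponentials can be proved by induction on
  k: each partial derivative of such a function is built from functions of order k.\<close>

fun Cn :: "nat \<Rightarrow> (real ^ 'n \<Rightarrow> complex) \<Rightarrow> bool" where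
  "Cn 0 f \<longleftrightarrow> True"
| "Cn (Suc k) f \<longleftrightarrow> (\<forall>x. f differentiable at x) \<and> (\<forall>i. Cn k (partial_deriv i f))"

lemma iter_deriv_simps [simp]:
  "iter_deriv [] f = f"
  "iter_deriv (i # is) f = partial_deriv i (iter_deriv is f)"
  "iter_deriv (is @ js) f = iter_deriv is (iter_deriv js f)"
  by (simp_all add: iter_deriv_def)

text \<open>The list is taken apart at its end because its last direction is applied to f first, and
  \<open>Cn\<close> unfolds from the innermost derivative.\<close>

lemma Cn_iter_deriv: "Cn (Suc (length is)) (f :: real ^ 'n \<Rightarrow> complex) \<Longrightarrow> iter_deriv is f differentiable_on UNIV"
proof (induction "is" arbitrary: f rule: rev_induct)
  case Nil
  then show ?case by (auto simp: differentiable_on_def)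
next
  case (snoc i "is")
  then show ?case by simp
qed

lemma smooth_partial_deriv: "smooth f \<Longrightarrow> smooth (partial_deriv i f)"
  unfolding smooth_def
proof
  fix "is" assume "\<forall>is. iter_deriv is f differentiable_on UNIV"
  then have "iter_deriv (is @ [i]) f differentiable_on UNIV" by blast
  then show "iter_deriv is (partial_deriv i f) differentiable_on UNIV" by simp
qed

lemma smooth_differentiable: "smooth f \<Longrightarrow> f differentiable at x"
  unfolding smooth_def differentiable_on_def using iter_deriv_simps(1)[of f] by (metis UNIV_I)

lemma smooth_Cn: "smooth f \<Longrightarrow> Cn k f"
  by (induction k arbitrary: f) (auto simp: smooth_differentiable smooth_partial_deriv)

lemma smooth_iff_Cn: "smooth f \<longleftrightarrow> (\<forall>k. Cn k f)"
proof
  assume "\<forall>k. Cn k f"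
  then show "smooth f" unfolding smooth_def by (intro allI Cn_iter_deriv) simp
qed (simp add: smooth_Cn)

lemma Cn_Suc_D: "Cn (Suc k) f \<Longrightarrow> Cn k f"
  by (induction k arbitrary: f) auto

lemma Cn_const: "Cn k (\<lambda>x::real ^ 'n. c)"
proof (induction k arbitrary: c)
  case (Suc k)
  have "partial_deriv i (\<lambda>x::real ^ 'n. c) = (\<lambda>x. 0)" for i
    by (intro ext) (use partial_deriv_eq[OF has_derivative_const] in auto)
  then show ?case using Suc by simp
qed simp

lemma Cn_add: "Cn k f \<Longrightarrow> Cn k g \<Longrightarrow> Cn k (\<lambda>x. f x + g x)"
proof (induction k arbitrary: f g)
  case (Suc k)
  have "partial_deriv i (\<lambda>x. f x + g x) = (\<lambda>x. partial_deriv i f x + partial_deriv i g x)" for i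
  proof
    fix x
    have f: "(f has_derivative frechet_derivative f (at x)) (at x)"
      and g: "(g has_derivative frechet_derivative g (at x)) (at x)"
      using Suc.prems by (auto simp: frechet_derivative_works)
    show "partial_deriv i (\<lambda>x. f x + g x) x = partial_deriv i f x + partial_deriv i g x"
      using partial_deriv_eq[OF has_derivative_add[OF f g]] by (simp add: partial_deriv_def)
  qed
  then show ?case using Suc by (auto intro: differentiable_add)
qed simp

lemma Cn_mult: "Cn k f \<Longrightarrow> Cn k g \<Longrightarrow> Cn k (\<lambda>x. f x * g x)"
proof (induction k arbitrary: f g)
  case (Suc k)
  have "partial_deriv i (\<lambda>x. f x * g x) =
      (\<lambda>x. f x * partial_deriv i g x + partial_deriv i f x * g x)" for i
  proof
    fix x
    have f: "(f has_derivative frechet_derivative f (at x)) (at x)"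
      and g: "(g has_derivative frechet_derivative g (at x)) (at x)"
      using Suc.prems by (auto simp: frechet_derivative_works)
    show "partial_deriv i (\<lambda>x. f x * g x) x = f x * partial_deriv i g x + partial_deriv i f x * g x"
      using partial_deriv_eq[OF has_derivative_mult[OF f g]] by (simp add: partial_deriv_def)
  qed
  moreover have "Cn k f" "Cn k g" using Suc.prems Cn_Suc_D by auto
  ultimately show ?case using Suc by (auto intro!: differentiable_mult Cn_add)
qed simp

lemma Cn_exp: "Cn k f \<Longrightarrow> Cn k (\<lambda>x. exp (f x))"
proof (induction k arbitrary: f)
  case (Suc k)
  have d: "((\<lambda>x. exp (f x)) has_derivative (\<lambda>h. frechet_derivative f (at x) h * exp (f x))) (at x)" for x
  proof -
    have f: "(f has_derivative frechet_derivative f (at x)) (at x)"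
      using Suc.prems by (auto simp: frechet_derivative_works)
    have e: "(exp has_derivative (\<lambda>h. h * exp (f x))) (at (f x))"
      using DERIV_exp[of "f x"] by (simp add: has_field_derivative_def mult_commute_abs)
    show ?thesis using diff_chain_at[OF f e] by (simp add: o_def)
  qed
  have "partial_deriv i (\<lambda>x. exp (f x)) = (\<lambda>x. partial_deriv i f x * exp (f x))" for i
    by (intro ext) (simp add: partial_deriv_eq[OF d], simp add: partial_deriv_def)
  moreover have "Cn k f" using Suc.prems Cn_Suc_D by auto
  ultimately show ?case using Suc d by (auto intro!: Cn_mult simp: differentiable_def)
qed simp

text \<open>A family of functions of one variable whose derivatives are linear combinations of its
  members is smooth; the induction on k treats all members at once. Composition with an affine
  function of a coordinate only adds the constant factor
  \<open>\<alpha> * axis i 1 $ j\<close>.\<close>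

lemma Cn_comp_nth:
  fixes \<phi> :: "'m \<Rightarrow> real \<Rightarrow> real"
  assumes "\<And>m. \<exists>ms. \<forall>t. (\<phi> m has_real_derivative (\<Sum>(a,m')\<leftarrow>ms. a * \<phi> m' t)) (at t)"
  shows "Cn k (\<lambda>x::real ^ 'n. of_real (\<phi> m (\<alpha> * x $ j + \<beta>)))"
proof (induction k arbitrary: m)
  case (Suc k)
  obtain ms where ms: "\<And>t. (\<phi> m has_real_derivative (\<Sum>(a,m')\<leftarrow>ms. a * \<phi> m' t)) (at t)"
    using assms by blast
  define d where "d t = (\<Sum>(a,m')\<leftarrow>ms. a * \<phi> m' t)" for t
  have D: "((\<lambda>x::real^'n. of_real (\<phi> m (\<alpha> * x $ j + \<beta>)) :: complex) has_derivative
        (\<lambda>h. of_real (\<alpha> * h $ j * d (\<alpha> * x $ j + \<beta>)))) (at x)" for x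
  proof -
    have 1: "((\<lambda>x::real^'n. \<alpha> * x $ j + \<beta>) has_derivative (\<lambda>h. \<alpha> * h $ j)) (at x)"
      by (auto intro!: derivative_eq_intros bounded_linear_imp_has_derivative bounded_linear_vec_nth)
    have 2: "(\<phi> m has_derivative (\<lambda>h. h * d (\<alpha> * x $ j + \<beta>))) (at (\<alpha> * x $ j + \<beta>))"
      using ms[of "\<alpha> * x $ j + \<beta>"] by (simp add: has_field_derivative_def d_def mult_commute_abs)
    have "((\<lambda>x::real^'n. \<phi> m (\<alpha> * x $ j + \<beta>)) has_derivative
        (\<lambda>h. \<alpha> * h $ j * d (\<alpha> * x $ j + \<beta>))) (at x)"
      using diff_chain_at[OF 1 2] by (simp add: o_def)
    then show ?thesis by (rule has_derivative_of_real)
  qed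
  have P: "partial_deriv i (\<lambda>x::real^'n. of_real (\<phi> m (\<alpha> * x $ j + \<beta>))) =
     (\<lambda>x. of_real (\<alpha> * axis i 1 $ j) * of_real (d (\<alpha> * x $ j + \<beta>)))" for i
    using partial_deriv_eq[OF D] by fastforce
  have "Cn k (\<lambda>x::real^'n. complex_of_real (\<Sum>(a,m')\<leftarrow>ms. a * \<phi> m' (\<alpha> * x $ j + \<beta>)))"
  proof (induction ms)
    case (Cons am ms)
    obtain a m' where "am = (a, m')" by force
    then show ?case
      using Cn_add[OF Cn_mult[OF Cn_const[of k "of_real a"] Suc.IH[of m']] Cons.IH] by simp
  qed (simp add: Cn_const)
  then have "Cn k (\<lambda>x::real^'n. complex_of_real (d (\<alpha> * x $ j + \<beta>)))" by (simp add: d_def)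
  then have "Cn k (partial_deriv i (\<lambda>x::real^'n. of_real (\<phi> m (\<alpha> * x $ j + \<beta>))))" for i
    unfolding P by (intro Cn_mult Cn_const)
  then show ?case using D by (auto simp: differentiable_def)
qed simp

text \<open>The powers of \<open>1 / t\<close> make the family closed under differentiation.\<close>

definition flat :: "nat \<Rightarrow> real \<Rightarrow> real" where
  "flat m t = (if t > 0 then inverse t ^ m * exp (- inverse t) else 0)"

lemma flat_pos_iff: "flat m t > 0 \<longleftrightarrow> t > 0" and flat_nonneg: "flat m t \<ge> 0"
  by (auto simp: flat_def)

lemma flat_tendsto: "(flat m \<longlongrightarrow> 0) (at 0)"
proof -
  have "((\<lambda>t::real. inverse t ^ m * exp (- inverse t)) \<longlongrightarrow> 0) (at_right 0)"
  proof -
    have "((\<lambda>y::real. y ^ m / exp y) \<longlongrightarrow> 0) at_top" by (rule tendsto_power_div_exp_0)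
    from filterlim_compose[OF this filterlim_inverse_at_top_right]
    show ?thesis by (simp add: exp_minus field_simps)
  qed
  then have "(flat m \<longlongrightarrow> 0) (at_right 0)"
    by (rule Lim_transform_eventually) (auto simp: flat_def eventually_at_filter)
  moreover have "(flat m \<longlongrightarrow> 0) (at_left 0)"
    by (rule Lim_transform_eventually[OF tendsto_const]) (auto simp: flat_def eventually_at_filter)
  ultimately show ?thesis using filterlim_split_at by blast
qed

lemma flat_has_derivative:
  "(flat m has_real_derivative (\<Sum>(a,m')\<leftarrow>[(- real m, Suc m), (1, m + 2)]. a * flat m' t)) (at t)"
proof -
  consider "t > 0" | "t < 0" | "t = 0" by linarith
  then show ?thesis
  proof cases
    case 1
    have "((\<lambda>t. inverse t ^ m * exp (- inverse t)) has_real_derivative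
        (- real m * (inverse t ^ Suc m * exp (- inverse t)) + inverse t ^ (m+2) * exp (- inverse t))) (at t)"
      using 1 by (auto intro!: derivative_eq_intros simp: power_Suc divide_simps power2_eq_square)
        (cases m; simp add: field_simps)
    then show ?thesis
      by (rule DERIV_cong_ev[THEN iffD1, OF refl _ _, rotated 2])
        (use 1 in \<open>auto simp: flat_def intro!: eventually_mono[OF eventually_nhds_in_open[of "{0<..}"]]\<close>)
  next
    case 2
    have "((\<lambda>t. 0) has_real_derivative 0) (at t)" by simp
    then show ?thesis
      by (rule DERIV_cong_ev[THEN iffD1, OF refl _ _, rotated 2])
        (use 2 in \<open>auto simp: flat_def intro!: eventually_mono[OF eventually_nhds_in_open[of "{..<0}"]]\<close>)
  next
    case 3
    \<comment> \<open>The difference quotient at 0 is \<open>flat (Suc m)\<close>, which tends to 0;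
      this agrees with the claimed sum, all of whose terms vanish at 0.\<close>
    have "((\<lambda>h. (flat m (0 + h) - flat m 0) / h) \<longlongrightarrow> 0) (at 0)"
      by (rule Lim_transform_eventually[OF flat_tendsto[of "Suc m"]])
        (auto simp: flat_def field_simps)
    then show ?thesis using 3 by (simp add: DERIV_def flat_def)
  qed
qed

section \<open>Bump functions on boxes\<close>

definition bump :: "real ^ 'n \<Rightarrow> real ^ 'n \<Rightarrow> real ^ 'n \<Rightarrow> real" where
  "bump a b x = (\<Prod>j\<in>UNIV. flat 0 (x $ j - a $ j) * flat 0 (b $ j - x $ j))"

lemma bump_nonneg: "bump a b x \<ge> 0"
  by (auto simp: bump_def intro!: prod_nonneg mult_nonneg_nonneg flat_nonneg)

lemma bump_pos_iff: "bump a b x > 0 \<longleftrightarrow> x \<in> box a b"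
proof
  assume "x \<in> box a b"
  then show "bump a b x > 0"
    by (auto simp: bump_def mem_box_cart flat_pos_iff intro!: prod_pos mult_pos_pos)
next
  assume "bump a b x > 0"
  moreover have "bump a b x = 0" if "flat 0 (x $ j - a $ j) * flat 0 (b $ j - x $ j) = 0" for j
    unfolding bump_def by (rule prod_zero) (use that in auto)
  ultimately have "flat 0 (x $ j - a $ j) * flat 0 (b $ j - x $ j) \<noteq> 0" for j
    by fastforce
  then have "flat 0 (x $ j - a $ j) \<noteq> 0" "flat 0 (b $ j - x $ j) \<noteq> 0" for j
    by simp_all
  then show "x \<in> box a b"
    unfolding mem_box_cart flat_def by (metis diff_gt_0_iff_gt)
qed

lemma Cn_flat: "Cn k (\<lambda>x. of_real (flat m (\<alpha> * x $ j + \<beta>)))"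
  by (rule Cn_comp_nth) (use flat_has_derivative in blast)

lemma Cn_prod: "finite J \<Longrightarrow> (\<And>j. j \<in> J \<Longrightarrow> Cn k (f j)) \<Longrightarrow> Cn k (\<lambda>x. \<Prod>j\<in>J. f j x)"
  by (induction J rule: finite_induct) (auto simp: Cn_const Cn_mult)

lemma Cn_sum: "finite J \<Longrightarrow> (\<And>j. j \<in> J \<Longrightarrow> Cn k (f j)) \<Longrightarrow> Cn k (\<lambda>x. \<Sum>j\<in>J. f j x)"
  by (induction J rule: finite_induct) (auto simp: Cn_const Cn_add)

lemma Cn_bump: "Cn k (\<lambda>x. of_real (bump a b x))"
proof -
  have "Cn k (\<lambda>x. of_real (flat 0 (1 * x $ j + (- a $ j))) * of_real (flat 0 ((-1) * x $ j + b $ j)))" for j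
    by (intro Cn_mult Cn_flat)
  then show ?thesis unfolding bump_def of_real_prod of_real_mult
    by (intro Cn_prod) (auto simp: algebra_simps)
qed

section \<open>Test functions and their supports\<close>

lemma supp_subset: "(\<And>x. f x \<noteq> 0 \<Longrightarrow> x \<in> S) \<Longrightarrow> closed S \<Longrightarrow> supp f \<subseteq> S"
  unfolding supp_def by (intro closure_minimal) auto

lemma in_suppI: "f x \<noteq> 0 \<Longrightarrow> x \<in> supp f"
  unfolding supp_def by (simp add: closure_def)

lemma closed_supp [simp]: "closed (supp f)"
  by (simp add: supp_def)

lemma test_functionsI:
  assumes "\<And>k. Cn k f" "compact S" "\<And>x. f x \<noteq> 0 \<Longrightarrow> x \<in> S"
  shows "f \<in> test_functions" "supp f \<subseteq> S"
proof -
  show s: "supp f \<subseteq> S" using assms supp_subset compact_imp_closed by metis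
  have "compact (supp f)" using compact_Int_closed[OF assms(2), of "supp f"] s
    by (simp add: inf.absorb2)
  then show "f \<in> test_functions"
    using assms by (simp add: test_functions_def smooth_iff_Cn)
qed

lemma test_functions_Cn: "f \<in> test_functions \<Longrightarrow> Cn k f"
  by (simp add: test_functions_def smooth_Cn)

lemma test_functions_zero: "(\<lambda>x. 0) \<in> test_functions" "supp (\<lambda>x. 0) = {}"
  using test_functionsI(1)[of "\<lambda>x. 0" "{}"] by (auto simp: Cn_const supp_def)

lemma test_functions_add_cmult:
  assumes "f \<in> test_functions" "g \<in> test_functions"
  shows "(\<lambda>x. f x + a * g x) \<in> test_functions" "supp (\<lambda>x. f x + a * g x) \<subseteq> supp f \<union> supp g"
proof -
  have "f x + a * g x \<noteq> 0 \<Longrightarrow> x \<in> supp f \<union> supp g" for x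
    using in_suppI[of f x] in_suppI[of g x] by (cases "f x = 0"; cases "g x = 0") auto
  moreover have "compact (supp f \<union> supp g)" using assms by (auto simp: test_functions_def)
  moreover have "Cn k (\<lambda>x. f x + a * g x)" for k
    using assms by (intro Cn_add Cn_mult Cn_const test_functions_Cn)
  ultimately show "(\<lambda>x. f x + a * g x) \<in> test_functions" "supp (\<lambda>x. f x + a * g x) \<subseteq> supp f \<union> supp g"
    using test_functionsI[of "\<lambda>x. f x + a * g x" "supp f \<union> supp g"] by blast+
qed

lemma supp_partial_deriv: "supp (partial_deriv i f) \<subseteq> supp f"
proof (rule supp_subset)
  fix x assume nz: "partial_deriv i f x \<noteq> 0"
  show "x \<in> supp f"
  proof (rule ccontr)
    assume x: "x \<notin> supp f"
    have "(f has_derivative (\<lambda>h. 0)) (at x)"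
    proof (rule has_derivative_transform_within_open[of "\<lambda>x. 0"])
      show "open (- supp f)" by (simp add: open_Compl)
      show "0 = f y" if "y \<in> - supp f" for y using that in_suppI[of f y] by auto
    qed (use x in auto)
    from partial_deriv_eq[OF this] nz show False by simp
  qed
qed simp

lemma supp_iter_deriv: "supp (iter_deriv is f) \<subseteq> supp f"
proof (induction "is")
  case (Cons i "is")
  then show ?case using supp_partial_deriv[of i "iter_deriv is f"] by simp
qed simp

lemma smooth_iter_deriv: "smooth f \<Longrightarrow> smooth (iter_deriv is f)"
  by (induction "is") (auto simp: smooth_partial_deriv)

lemma smooth_continuous: "smooth f \<Longrightarrow> continuous_on UNIV f"
  by (simp add: smooth_differentiable differentiable_imp_continuous_within continuous_at_imp_continuous_on)

lemma bounded_compact_support: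
  fixes f :: "'a::metric_space \<Rightarrow> 'b::real_normed_vector"
  assumes "continuous_on UNIV f" "compact S" "\<And>x. x \<notin> S \<Longrightarrow> f x = 0"
  shows "bounded (range f)"
proof -
  have "bounded (f ` S)"
    using assms by (meson compact_continuous_image compact_imp_bounded continuous_on_subset subset_UNIV)
  then have "bounded (insert 0 (f ` S))" by simp
  moreover have "range f \<subseteq> insert 0 (f ` S)" using assms by auto
  ultimately show ?thesis using bounded_subset by blast
qed

lemma test_functions_schwartz: "test_functions \<subseteq> schwartz"
proof
  fix f :: "real ^ 'n \<Rightarrow> complex" assume f: "f \<in> test_functions"
  then have s: "smooth f" "compact (supp f)" by (auto simp: test_functions_def)
  have "bounded (range (\<lambda>x. norm x ^ k *\<^sub>R iter_deriv is f x))" for k "is"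
  proof (rule bounded_compact_support)
    show "continuous_on UNIV (\<lambda>x. norm x ^ k *\<^sub>R iter_deriv is f x)"
      by (intro continuous_intros smooth_continuous smooth_iter_deriv s)
    show "norm x ^ k *\<^sub>R iter_deriv is f x = 0" if "x \<notin> supp f" for x
      using that supp_iter_deriv[of "is" f] in_suppI[of "iter_deriv is f" x] by auto
  qed (rule s)
  then show "f \<in> schwartz" using s by (simp add: schwartz_def)
qed

text \<open>By Lindelof's theorem V is a countable union of open boxes whose closed boxes lie in V.
  Each \<open>u m\<close> lives on finitely many of them, so its support is a compact subset of V
  however large or irregular V is. Bounded pointwise convergence is the form that dominated
  convergence asks for.\<close>

lemma open_indicator_limit_test_functions:
  fixes V :: "(real ^ 'n) set"
  assumes "open V"
  obtains u :: "nat \<Rightarrow> real ^ 'n \<Rightarrow> real" where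
    "\<And>m. (\<lambda>x. of_real (u m x)) \<in> test_functions" "\<And>m. supp (\<lambda>x. complex_of_real (u m x)) \<subseteq> V"
    "\<And>m x. 0 \<le> u m x" "\<And>m x. u m x \<le> indicator V x"
    "\<And>x. (\<lambda>m. u m x) \<longlonglongrightarrow> indicator V x"
proof -
  define F where "F = {box a b | a b. cbox a b \<subseteq> V}"
  obtain D where D: "D \<subseteq> F" "countable D" "\<Union> D = \<Union> F"
    using Lindelof[of F] unfolding F_def by auto
  have "\<exists>X\<in>F. x \<in> X" if x: "x \<in> V" for x
  proof -
    obtain a b where "x \<in> box a b" "cbox a b \<subseteq> V"
      using open_contains_cbox[OF assms x] by metis
    then show ?thesis by (auto simp: F_def)
  qed
  moreover have "X \<subseteq> V" if "X \<in> F" for X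
    using that box_subset_cbox order_trans unfolding F_def by blast
  ultimately have "\<Union> D = V" unfolding D(3) by blast
  \<comment> \<open>The empty set, a box with reversed corners, is added so that the family is
    nonempty and \<open>from_nat_into\<close> enumerates it also when V is empty.\<close>
  define D' where "D' = insert {} D"
  have D': "countable D'" "D' \<noteq> {}" using D by (auto simp: D'_def)
  have "\<exists>a b. X = box a b \<and> cbox a b \<subseteq> V" if X: "X \<in> D'" for X
  proof (cases "X = {}")
    case True
    have "cbox 1 (0::real ^ 'n) = {}" by (auto simp: interval_eq_empty_cart)
    then show ?thesis using True box_subset_cbox[of 1 "0::real^'n"] by fastforce
  next
    case False
    then show ?thesis using X D(1) by (auto simp: D'_def F_def)
  qed
  then have "\<exists>a b. from_nat_into D' k = box a b \<and> cbox a b \<subseteq> V" for k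
    using from_nat_into[OF D'(2)] by blast
  then obtain a b where ab: "\<And>k. from_nat_into D' k = box (a k) (b k)" "\<And>k. cbox (a k) (b k) \<subseteq> V"
    by metis
  have cover: "\<exists>k. x \<in> box (a k) (b k)" if "x \<in> V" for x
  proof -
    obtain X where "X \<in> D" "x \<in> X" using \<open>x \<in> V\<close> \<open>\<Union> D = V\<close> by (metis UnionE)
    then have "X \<in> D'" by (simp add: D'_def)
    then obtain k where "from_nat_into D' k = X" using from_nat_into_surj[OF D'(1)] by blast
    then show ?thesis using ab(1)[of k] \<open>x \<in> X\<close> by auto
  qed
  (* w m is positive exactly on the first m boxes, so 1 - exp (- m * w m) vanishes off them and tends to 1 on V. *)
  define w where "w m x = (\<Sum>k<m. bump (a k) (b k) x)" for m x
  define u where "u m x = 1 - exp (- (real m * w m x))" for m x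
  have w_nonneg: "w m x \<ge> 0" for m x by (auto simp: w_def intro!: sum_nonneg bump_nonneg)
  have u_nz: "x \<in> (\<Union>k<m. cbox (a k) (b k))" if "u m x \<noteq> 0" for m x
  proof -
    have "w m x \<noteq> 0" using that by (auto simp: u_def)
    then obtain k where "k < m" "bump (a k) (b k) x \<noteq> 0"
      unfolding w_def by (auto elim: sum.not_neutral_contains_not_neutral)
    then have "bump (a k) (b k) x > 0" using bump_nonneg[of "a k" "b k" x] by simp
    then have "x \<in> cbox (a k) (b k)" unfolding bump_pos_iff using box_subset_cbox by (rule subsetD[rotated])
    then show ?thesis using \<open>k < m\<close> by auto
  qed
  have CV: "(\<Union>k<m. cbox (a k) (b k)) \<subseteq> V" for m using ab by auto
  have Cn: "Cn j (\<lambda>x. complex_of_real (u m x))" for j m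
  proof -
    have "Cn j (\<lambda>x. complex_of_real (w m x))"
      unfolding w_def of_real_sum by (intro Cn_sum Cn_bump) auto
    then have "Cn j (\<lambda>x. 1 + (-1) * exp ((- of_nat m) * complex_of_real (w m x)))"
      by (intro Cn_add Cn_mult Cn_const Cn_exp)
    then show ?thesis by (simp add: u_def flip: exp_of_real)
  qed
  note t = test_functionsI[of "\<lambda>x. complex_of_real (u m x)" "\<Union>k<m. cbox (a k) (b k)" for m, OF Cn]
  show ?thesis
  proof
    show "(\<lambda>x. of_real (u m x)) \<in> test_functions" "supp (\<lambda>x. complex_of_real (u m x)) \<subseteq> V" for m
    proof -
      have "compact (\<Union>k<m. cbox (a k) (b k))" by (auto simp: compact_UN)
      moreover have "x \<in> (\<Union>k<m. cbox (a k) (b k))" if "complex_of_real (u m x) \<noteq> 0" for x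
        using that u_nz by simp
      ultimately show "(\<lambda>x. of_real (u m x)) \<in> test_functions" "supp (\<lambda>x. complex_of_real (u m x)) \<subseteq> V"
        using t[of m] CV[of m] by (blast intro: order_trans)+
    qed
    show "0 \<le> u m x" for m x using w_nonneg[of m x] by (simp add: u_def)
    then show "u m x \<le> indicator V x" for m x
      using u_nz[of m x] CV[of m] by (cases "u m x = 0") (auto simp: u_def indicator_def)
    show "(\<lambda>m. u m x) \<longlonglongrightarrow> indicator V x" for x
    proof (cases "x \<in> V")
      case False
      then have "u m x = 0" for m using u_nz[of m x] CV by blast
      then show ?thesis using False by simp
    next
      case True
      then obtain k where "x \<in> box (a k) (b k)" using cover by blast
      then have p: "bump (a k) (b k) x > 0" by (simp add: bump_pos_iff)
      have "w m x \<ge> bump (a k) (b k) x" if "m > k" for m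
        unfolding w_def using that by (intro member_le_sum) (auto intro: bump_nonneg)
      then have "1 - exp (- (real m * bump (a k) (b k) x)) \<le> u m x" if "m > k" for m
        using that by (auto simp: u_def intro!: mult_left_mono)
      then have lo: "\<forall>\<^sub>F m in sequentially. 1 - exp (- (real m * bump (a k) (b k) x)) \<le> u m x"
        by (rule eventually_mono[OF eventually_gt_at_top[of k]])
      have "(\<lambda>m. 1 - exp (- (real m * bump (a k) (b k) x))) \<longlonglongrightarrow> 1"
      proof -
        have "\<bar>exp (- bump (a k) (b k) x)\<bar> < 1" using p by simp
        then have "(\<lambda>m. exp (- bump (a k) (b k) x) ^ m) \<longlonglongrightarrow> 0"
          by (intro LIMSEQ_power_zero) (simp only: real_norm_def)
        then have "(\<lambda>m. 1 - exp (- bump (a k) (b k) x) ^ m) \<longlonglongrightarrow> 1 - 0"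
          by (rule tendsto_diff[OF tendsto_const])
        then show ?thesis by (simp flip: exp_of_nat_mult)
      qed
      then show ?thesis using True
        by (intro tendsto_sandwich[OF lo _ _ tendsto_const]) (auto simp: u_def)
    qed
  qed
qed

section \<open>Density of test functions\<close>

text \<open>Working with the squared norm, the pointwise bound \<open>norm_add_square_le\<close> can
  take the place of Minkowski's inequality at the cost of a factor 2.\<close>

definition L2sq :: "(real ^ 'n \<Rightarrow> complex) \<Rightarrow> real" where
  "L2sq f = (\<integral>x. (norm (f x))\<^sup>2 \<partial>lebesgue)"

lemma Lp_2_iff:
  "f \<in> Lp 2 \<longleftrightarrow> f \<in> borel_measurable lebesgue \<and> integrable lebesgue (\<lambda>x. (norm (f x))\<^sup>2)"
  by (simp add: Lp_def)

lemma L2sq_nonneg: "L2sq f \<ge> 0"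
  by (simp add: L2sq_def)

lemma Lp_norm_2: "Lp_norm 2 f = sqrt (L2sq f)"
  by (simp add: Lp_norm_def L2sq_def powr_half_sqrt)

lemma norm_add_square_le:
  fixes a b :: "'a::real_normed_vector"
  shows "(norm (a + b))\<^sup>2 \<le> 2 * (norm a)\<^sup>2 + 2 * (norm b)\<^sup>2"
proof -
  have "(norm (a + b))\<^sup>2 \<le> (norm a + norm b)\<^sup>2" by (intro power_mono norm_triangle_ineq) auto
  also have "\<dots> \<le> 2 * (norm a)\<^sup>2 + 2 * (norm b)\<^sup>2"
    using sum_squares_bound[of "norm a" "norm b"] by (simp add: power2_sum)
  finally show ?thesis .
qed

lemma Lp_2_add:
  assumes "f \<in> Lp 2" "g \<in> Lp 2"
  shows "(\<lambda>x. f x + g x) \<in> Lp 2" "L2sq (\<lambda>x. f x + g x) \<le> 2 * L2sq f + 2 * L2sq g"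
proof -
  have m: "f \<in> borel_measurable lebesgue" "g \<in> borel_measurable lebesgue"
    and i: "integrable lebesgue (\<lambda>x. 2 * (norm (f x))\<^sup>2 + 2 * (norm (g x))\<^sup>2)"
    using assms by (auto simp: Lp_2_iff)
  show 1: "(\<lambda>x. f x + g x) \<in> Lp 2"
    unfolding Lp_2_iff using m
    by (auto intro!: Bochner_Integration.integrable_bound[OF i] AE_I2 simp: norm_add_square_le)
  have "L2sq (\<lambda>x. f x + g x) \<le> (\<integral>x. 2 * (norm (f x))\<^sup>2 + 2 * (norm (g x))\<^sup>2 \<partial>lebesgue)"
    unfolding L2sq_def using 1 i norm_add_square_le by (intro integral_mono) (auto simp: Lp_2_iff)
  also have "\<dots> = 2 * L2sq f + 2 * L2sq g"
    using assms by (simp add: L2sq_def Lp_2_iff)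
  finally show "L2sq (\<lambda>x. f x + g x) \<le> 2 * L2sq f + 2 * L2sq g" .
qed

lemma Lp_2_cmult:
  assumes "f \<in> Lp 2"
  shows "(\<lambda>x. a * f x) \<in> Lp 2" "L2sq (\<lambda>x. a * f x) = (norm a)\<^sup>2 * L2sq f"
  using assms by (auto simp: Lp_2_iff L2sq_def norm_mult power_mult_distrib)

lemma Lp_2_diff:
  assumes "f \<in> Lp 2" "g \<in> Lp 2"
  shows "(\<lambda>x. f x - g x) \<in> Lp 2"
  using Lp_2_add(1)[OF assms(1) Lp_2_cmult(1)[OF assms(2), of "-1"]] by simp

lemma test_functions_continuous: "f \<in> test_functions \<Longrightarrow> continuous_on UNIV f"
  by (simp add: test_functions_def smooth_continuous)

lemma test_functions_integrable:
  fixes g :: "real ^ 'n \<Rightarrow> 'b::{banach, second_countable_topology}"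
  assumes "f \<in> test_functions" "continuous_on UNIV g" "\<And>x. x \<notin> supp f \<Longrightarrow> g x = 0"
  shows "integrable lborel g"
proof -
  have "integrable lborel (\<lambda>x. indicator (supp f) x *\<^sub>R g x)"
    using assms by (intro borel_integrable_compact)
      (auto simp: test_functions_def intro: continuous_on_subset)
  moreover have "(\<lambda>x. indicator (supp f) x *\<^sub>R g x) = g" using assms(3) by (auto simp: indicator_def)
  ultimately show ?thesis by simp
qed

lemma test_functions_borel: "f \<in> test_functions \<Longrightarrow> f \<in> borel_measurable borel"
  by (intro borel_measurable_continuous_onI test_functions_continuous)

lemma lebesgue_measurable_of_borel [measurable_dest]:
  "f \<in> borel_measurable borel \<Longrightarrow> f \<in> borel_measurable lebesgue"
  by (intro measurable_completion) simp

lemma test_functions_Lp_2: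
  assumes "f \<in> test_functions"
  shows "f \<in> Lp 2"
proof -
  have "integrable lborel (\<lambda>x. (norm (f x))\<^sup>2)"
    using assms test_functions_continuous in_suppI[of f]
    by (intro test_functions_integrable[OF assms]) (auto intro!: continuous_intros)
  then have "integrable lebesgue (\<lambda>x. (norm (f x))\<^sup>2)"
    by (subst integrable_completion) auto
  then show ?thesis using test_functions_borel[OF assms] lebesgue_measurable_of_borel Lp_2_iff by blast
qed

section \<open>Vanishing of functions orthogonal to all test functions\<close>

lemma sigma_finite_lebesgue: "sigma_finite_measure (lebesgue :: 'a::euclidean_space measure)"
proof
  obtain A :: "'a set set" where "countable A" "A \<subseteq> sets lborel" "\<Union> A = space lborel"
      "\<forall>a\<in>A. emeasure lborel a \<noteq> \<infinity>"
    using lborel.sigma_finite_countable by blast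
  then show "\<exists>A::'a set set. countable A \<and> A \<subseteq> sets lebesgue \<and> \<Union> A = space lebesgue \<and>
      (\<forall>a\<in>A. emeasure lebesgue a \<noteq> \<infinity>)"
    by (intro exI[of _ A]) (auto simp: subset_iff)
qed

text \<open>By outer regularity every measurable set is, up to a null set, the intersection of a
  decreasing sequence of open sets, over each of which h has integral 0. Dominated convergence then
  gives integral 0 over every measurable set.\<close>

lemma integral_zero_of_open:
  fixes h :: "real ^ 'n \<Rightarrow> complex"
  assumes h: "integrable lebesgue h"
    and zero: "\<And>V. open V \<Longrightarrow> (\<integral>x. indicator V x *\<^sub>R h x \<partial>lebesgue) = 0"
  shows "AE x in lebesgue. h x = 0"
proof (rule sigma_finite_measure.density_zero[OF sigma_finite_lebesgue h])
  fix A :: "(real ^ 'n) set" assume A: "A \<in> sets lebesgue"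
  have "\<exists>T. open T \<and> A \<subseteq> T \<and> emeasure lebesgue (T - A) < ennreal (1 / Suc k)" for k
    using sets_lebesgue_outer_open[OF A, of "1 / Suc k"] by (metis of_nat_0_less_iff zero_less_Suc zero_less_divide_1_iff)
  then obtain T where T: "\<And>k. open (T k)" "\<And>k. A \<subseteq> T k" "\<And>k. emeasure lebesgue (T k - A) < ennreal (1 / Suc k)"
    by metis
  define S where "S m = (\<Inter>k\<le>m. T k)" for m
  define G where "G = (\<Inter>k. T k)"
  have S: "open (S m)" for m using T by (auto simp: S_def)
  have Tm: "T k \<in> sets lebesgue" for k using T(1) by simp
  have Gm: "G \<in> sets lebesgue" using Tm by (auto simp: G_def)
  have "emeasure lebesgue (G - A) = 0"
  proof (rule ccontr)
    assume nz: "emeasure lebesgue (G - A) \<noteq> 0"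
    have le: "emeasure lebesgue (G - A) \<le> ennreal (1 / Suc k)" for k
    proof -
      have "emeasure lebesgue (G - A) \<le> emeasure lebesgue (T k - A)"
        using A Tm by (intro emeasure_mono) (auto simp: G_def)
      then show ?thesis using T(3)[of k] by simp
    qed
    have "(\<lambda>k. ennreal (1 / Suc k)) \<longlonglongrightarrow> ennreal 0"
      by (intro tendsto_ennrealI) (use LIMSEQ_inverse_real_of_nat in \<open>simp add: inverse_eq_divide\<close>)
    then have "emeasure lebesgue (G - A) \<le> ennreal 0"
      by (rule LIMSEQ_le_const) (use le in auto)
    then show False using nz by simp
  qed
  then have "G - A \<in> null_sets lebesgue" using A Gm by auto
  then have ae: "AE x in lebesgue. indicator G x *\<^sub>R h x = indicator A x *\<^sub>R h x"
    by (rule AE_I') (use T(2) in \<open>auto simp: G_def indicator_def split: if_splits\<close>)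
  have "(\<lambda>m. \<integral>x. indicator (S m) x *\<^sub>R h x \<partial>lebesgue) \<longlonglongrightarrow> (\<integral>x. indicator G x *\<^sub>R h x \<partial>lebesgue)"
  proof (rule integral_dominated_convergence)
    show "integrable lebesgue (\<lambda>x. norm (h x))" using h by simp
    show "(\<lambda>x. indicator G x *\<^sub>R h x) \<in> borel_measurable lebesgue" using h Gm by measurable
    show "(\<lambda>x. indicator (S m) x *\<^sub>R h x) \<in> borel_measurable lebesgue" for m
      using h S[of m] by (intro borel_measurable_scaleR borel_measurable_indicator) auto
    show "AE x in lebesgue. norm (indicator (S m) x *\<^sub>R h x) \<le> norm (h x)" for m
      by (auto simp: indicator_def)
    show "AE x in lebesgue. (\<lambda>m. indicator (S m) x *\<^sub>R h x) \<longlonglongrightarrow> indicator G x *\<^sub>R h x"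
    proof (intro AE_I2 tendsto_scaleR tendsto_const)
      fix x
      show "(\<lambda>m. indicator (S m) x :: real) \<longlonglongrightarrow> indicator G x"
      proof (cases "x \<in> G")
        case True
        then show ?thesis by (auto simp: S_def G_def)
      next
        case False
        then obtain k where "x \<notin> T k" by (auto simp: G_def)
        then have "\<forall>\<^sub>F m in sequentially. indicator (S m) x = (0::real)"
          by (intro eventually_sequentiallyI[of k]) (auto simp: S_def indicator_def)
        then show ?thesis using False by (simp add: tendsto_eventually)
      qed
    qed
  qed
  then have "(\<integral>x. indicator G x *\<^sub>R h x \<partial>lebesgue) = 0"
    unfolding zero[OF S] by (simp add: LIMSEQ_const_iff)
  moreover have "(\<integral>x. indicator G x *\<^sub>R h x \<partial>lebesgue) = (\<integral>x. indicator A x *\<^sub>R h x \<partial>lebesgue)"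
    using ae h A Gm by (intro integral_cong_AE) auto
  ultimately show "set_lebesgue_integral lebesgue A h = 0"
    by (simp add: set_lebesgue_integral_def)
qed

text \<open>The fundamental lemma of the calculus of variations, localised to W: test functions
  converge boundedly to the indicator of any open subset of W. It turns identities of distributions
  into identities almost everywhere.\<close>

lemma AE_zero_of_test_functions:
  fixes h :: "real ^ 'n \<Rightarrow> complex"
  assumes W: "open W" and h: "set_integrable lebesgue W h"
    and zero: "\<And>\<phi>. \<phi> \<in> test_functions \<Longrightarrow> supp \<phi> \<subseteq> W \<Longrightarrow> (\<integral>x. h x * \<phi> x \<partial>lebesgue) = 0"
  shows "AE x in lebesgue. x \<in> W \<longrightarrow> h x = 0"
proof -
  define g where "g x = indicator W x *\<^sub>R h x" for x
  have g: "integrable lebesgue g" using h unfolding g_def set_integrable_def .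
  have "AE x in lebesgue. g x = 0"
  proof (rule integral_zero_of_open[OF g])
    fix V :: "(real ^ 'n) set" assume V: "open V"
    then have "open (V \<inter> W)" using W by auto
    from open_indicator_limit_test_functions[OF this] obtain u where
      u: "\<And>m. (\<lambda>x. of_real (u m x)) \<in> test_functions" "\<And>m. supp (\<lambda>x. complex_of_real (u m x)) \<subseteq> V \<inter> W"
        "\<And>m x. 0 \<le> u m x" "\<And>m x. u m x \<le> indicator (V \<inter> W) x"
        "\<And>x. (\<lambda>m. u m x) \<longlonglongrightarrow> indicator (V \<inter> W) x" by blast
    have "(\<integral>x. h x * of_real (u m x) \<partial>lebesgue) = 0" for m
      using zero[OF u(1)[of m]] u(2)[of m] by auto
    moreover have "h x * of_real (u m x) = of_real (u m x) * g x" for m x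
      using u(3,4)[of m x] by (cases "x \<in> V \<inter> W") (auto simp: g_def)
    ultimately have 0: "(\<integral>x. of_real (u m x) * g x \<partial>lebesgue) = 0" for m by simp
    have "(\<lambda>m. \<integral>x. of_real (u m x) * g x \<partial>lebesgue) \<longlonglongrightarrow> (\<integral>x. indicator V x *\<^sub>R g x \<partial>lebesgue)"
    proof (rule integral_dominated_convergence)
      show "integrable lebesgue (\<lambda>x. norm (g x))" using g by simp
      show "(\<lambda>x. indicator V x *\<^sub>R g x) \<in> borel_measurable lebesgue"
        using g V by (intro borel_measurable_scaleR borel_measurable_indicator) auto
      show "(\<lambda>x. of_real (u m x) * g x) \<in> borel_measurable lebesgue" for m
        using g lebesgue_measurable_of_borel[OF test_functions_borel[OF u(1)[of m]]]
        by (intro borel_measurable_times) auto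
      have "norm (of_real (u m x) * g x) \<le> norm (g x)" for m x
      proof -
        have "u m x \<le> 1" using order_trans[OF u(4)[of m x] indicator_le_1] .
        then show ?thesis using u(3)[of m x] by (simp add: norm_mult mult_left_le_one_le)
      qed
      then show "AE x in lebesgue. norm (of_real (u m x) * g x) \<le> norm (g x)" for m by simp
      have "(\<lambda>m. of_real (u m x) * g x) \<longlonglongrightarrow> of_real (indicator (V \<inter> W) x) * g x" for x
        by (intro tendsto_intros u)
      moreover have "of_real (indicator (V \<inter> W) x) * g x = indicator V x *\<^sub>R g x" for x
        by (auto simp: g_def indicator_def)
      ultimately show "AE x in lebesgue. (\<lambda>m. of_real (u m x) * g x) \<longlonglongrightarrow> indicator V x *\<^sub>R g x"
        by simp
    qed
    then show "(\<integral>x. indicator V x *\<^sub>R g x \<partial>lebesgue) = 0"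
      unfolding 0 by (simp add: LIMSEQ_const_iff)
  qed
  then show ?thesis by (rule AE_mp) (auto simp: g_def)
qed

text \<open>The approximants are confined to S because the separation of the arguments from the
  enlarged cube has to survive the approximation.\<close>

definition L2_approx :: "(real ^ 'n) set \<Rightarrow> (real ^ 'n \<Rightarrow> complex) \<Rightarrow> bool" where
  "L2_approx S f \<longleftrightarrow> f \<in> Lp 2 \<and>
     (\<forall>e>0. \<exists>\<phi>\<in>test_functions. supp \<phi> \<subseteq> S \<and> L2sq (\<lambda>x. f x - \<phi> x) < e)"

lemma L2_approx_limit:
  assumes f: "f \<in> Lp 2" and g: "\<And>e. e > 0 \<Longrightarrow> \<exists>g. L2_approx S g \<and> L2sq (\<lambda>x. f x - g x) < e"
  shows "L2_approx S f"
  unfolding L2_approx_def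
proof (intro conjI f allI impI)
  fix e :: real assume "e > 0"
  \<comment> \<open>Quarters instead of halves, because \<open>Lp_2_add\<close> doubles both
    errors.\<close>
  then have "e / 4 > 0" by simp
  then obtain g \<phi> where *: "L2_approx S g" "L2sq (\<lambda>x. f x - g x) < e / 4" "\<phi> \<in> test_functions"
      "supp \<phi> \<subseteq> S" "L2sq (\<lambda>x. g x - \<phi> x) < e / 4"
    using g[of "e / 4"] unfolding L2_approx_def by blast
  then have "g \<in> Lp 2" by (simp add: L2_approx_def)
  then have "L2sq (\<lambda>x. (f x - g x) + (g x - \<phi> x)) \<le> 2 * L2sq (\<lambda>x. f x - g x) + 2 * L2sq (\<lambda>x. g x - \<phi> x)"
    using f test_functions_Lp_2[OF *(3)] by (intro Lp_2_add Lp_2_diff)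
  then show "\<exists>\<phi>\<in>test_functions. supp \<phi> \<subseteq> S \<and> L2sq (\<lambda>x. f x - \<phi> x) < e"
    using * by (intro bexI[of _ \<phi>]) auto
qed

lemma L2_approx_add_cmult:
  assumes "L2_approx S f" "L2_approx S g"
  shows "L2_approx S (\<lambda>x. f x + a * g x)"
  unfolding L2_approx_def
proof (intro conjI allI impI)
  have fg: "f \<in> Lp 2" "g \<in> Lp 2" using assms by (auto simp: L2_approx_def)
  then show "(\<lambda>x. f x + a * g x) \<in> Lp 2" by (intro Lp_2_add Lp_2_cmult)
  fix e :: real assume e: "e > 0"
  \<comment> \<open>Chosen so that the total error 2 * d + 2 * |a|^2 * d equals e / 2; the summand 1
    also keeps the denominator positive for a = 0.\<close>
  define d where "d = e / (4 * (1 + (norm a)\<^sup>2))"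
  have a: "1 + (norm a)\<^sup>2 > 0" by (simp add: add_pos_nonneg)
  have d: "d > 0" using e a by (simp add: d_def)
  obtain \<phi> \<psi> where *: "\<phi> \<in> test_functions" "supp \<phi> \<subseteq> S" "L2sq (\<lambda>x. f x - \<phi> x) < d"
     "\<psi> \<in> test_functions" "supp \<psi> \<subseteq> S" "L2sq (\<lambda>x. g x - \<psi> x) < d"
    using assms d unfolding L2_approx_def by blast
  have "L2sq (\<lambda>x. (f x - \<phi> x) + a * (g x - \<psi> x)) \<le>
      2 * L2sq (\<lambda>x. f x - \<phi> x) + 2 * L2sq (\<lambda>x. a * (g x - \<psi> x))"
    using fg *(1,4)[THEN test_functions_Lp_2] by (intro Lp_2_add Lp_2_diff Lp_2_cmult)
  also have "L2sq (\<lambda>x. a * (g x - \<psi> x)) = (norm a)\<^sup>2 * L2sq (\<lambda>x. g x - \<psi> x)"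
    using fg *(1,4)[THEN test_functions_Lp_2] by (intro Lp_2_cmult Lp_2_diff)
  also have "2 * L2sq (\<lambda>x. f x - \<phi> x) + 2 * ((norm a)\<^sup>2 * L2sq (\<lambda>x. g x - \<psi> x)) \<le>
      2 * d + 2 * ((norm a)\<^sup>2 * d)"
    using * by (intro add_mono mult_left_mono) auto
  also have "\<dots> = 2 * (1 + (norm a)\<^sup>2) * d" by (simp add: algebra_simps)
  also have "\<dots> = e / 2"
  proof -
    have "2 * q * (e / (4 * q)) = e / 2" if "q > 0" for q :: real using that by simp
    from this[OF a] show ?thesis unfolding d_def .
  qed
  also have "\<dots> < e" using e by simp
  finally have "L2sq (\<lambda>x. (f x + a * g x) - (\<phi> x + a * \<psi> x)) < e" by (simp add: algebra_simps)
  then show "\<exists>\<phi>\<in>test_functions. supp \<phi> \<subseteq> S \<and> L2sq (\<lambda>x. f x + a * g x - \<phi> x) < e"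
    using test_functions_add_cmult[OF *(1,4), of a] *(2,5)
    by (intro bexI[of _ "\<lambda>x. \<phi> x + a * \<psi> x"]) auto
qed

lemma L2_approx_zero: "L2_approx S (\<lambda>x. 0)"
  using test_functions_zero test_functions_Lp_2[OF test_functions_zero(1)]
  by (auto simp: L2_approx_def L2sq_def)

lemma L2_approx_sum:
  "finite J \<Longrightarrow> (\<And>j. j \<in> J \<Longrightarrow> L2_approx S (f j)) \<Longrightarrow> L2_approx S (\<lambda>x. \<Sum>j\<in>J. a j * f j x)"
proof (induction J rule: finite_induct)
  case (insert j J)
  then show ?case using L2_approx_add_cmult[of S "\<lambda>x. \<Sum>j\<in>J. a j * f j x" "f j" "a j"]
    by (simp add: add.commute)
qed (simp add: L2_approx_zero)

lemma L2_dominated_convergence: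
  fixes f :: "real ^ 'n \<Rightarrow> complex"
  assumes m: "f \<in> borel_measurable lebesgue" "\<And>k. F k \<in> borel_measurable lebesgue"
    and w: "integrable lebesgue w"
    and lim: "\<And>x. (\<lambda>k::nat. F k x) \<longlonglongrightarrow> f x" and le: "\<And>k x. (norm (f x - F k x))\<^sup>2 \<le> w x" and e: "e > 0"
  shows "\<exists>k. L2sq (\<lambda>x. f x - F k x) < e"
proof -
  have "(\<lambda>k. \<integral>x. (norm (f x - F k x))\<^sup>2 \<partial>lebesgue) \<longlonglongrightarrow> (\<integral>x. 0 \<partial>(lebesgue :: (real ^ 'n) measure))"
  proof (rule integral_dominated_convergence[where w = w])
    show "integrable lebesgue w" by (rule w)
    have "(\<lambda>k. (norm (f x - F k x))\<^sup>2) \<longlonglongrightarrow> (norm (f x - f x))\<^sup>2" for x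
      by (intro tendsto_intros lim)
    then show "AE x in lebesgue. (\<lambda>k. (norm (f x - F k x))\<^sup>2) \<longlonglongrightarrow> 0" by simp
  qed (use m le in auto)
  then have "(\<lambda>k. L2sq (\<lambda>x. f x - F k x)) \<longlonglongrightarrow> 0" by (simp add: L2sq_def)
  then have "\<forall>\<^sub>F k in sequentially. L2sq (\<lambda>x. f x - F k x) < e" using e by (rule order_tendstoD)
  then show ?thesis by (auto simp: eventually_sequentially)
qed

lemma indicator_Lp_2:
  assumes "A \<in> sets lebesgue" "emeasure lebesgue A < \<infinity>"
  shows "(\<lambda>x. indicator A x :: complex) \<in> Lp 2" "L2sq (\<lambda>x. indicator A x :: complex) = measure lebesgue A"
proof -
  have "(norm (indicator A x :: complex))\<^sup>2 = indicator A x" for x by (simp add: indicator_def)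
  then show "(\<lambda>x. indicator A x :: complex) \<in> Lp 2"
    "L2sq (\<lambda>x. indicator A x :: complex) = measure lebesgue A"
    using assms by (auto simp: Lp_2_iff L2sq_def)
qed

lemma L2_approx_indicator_open:
  assumes "open V" "V \<subseteq> S" "emeasure lebesgue V < \<infinity>"
  shows "L2_approx S (\<lambda>x. indicator V x)"
  unfolding L2_approx_def
proof (intro conjI allI impI)
  show V: "(\<lambda>x. indicator V x :: complex) \<in> Lp 2" using assms by (intro indicator_Lp_2) auto
  fix e :: real assume e: "e > 0"
  obtain u where
    u: "\<And>m. (\<lambda>x. of_real (u m x)) \<in> test_functions" "\<And>m. supp (\<lambda>x. complex_of_real (u m x)) \<subseteq> V"
      "\<And>m x. 0 \<le> u m x" "\<And>m x. u m x \<le> indicator V x"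
      "\<And>x. (\<lambda>m. u m x) \<longlonglongrightarrow> indicator V x"
    using open_indicator_limit_test_functions[OF assms(1)] by blast
  have "\<exists>k. L2sq (\<lambda>x. indicator V x - complex_of_real (u k x)) < e"
  proof (rule L2_dominated_convergence[where w = "indicator V"])
    show "integrable lebesgue (indicator V :: real ^ 'a \<Rightarrow> real)" using assms by auto
    have eq: "complex_of_real (indicator V x) = indicator V x" for x by (simp add: indicator_def)
    show "(\<lambda>k. complex_of_real (u k x)) \<longlonglongrightarrow> indicator V x" for x
      using tendsto_of_real[OF u(5)[of x], where 'a = complex] unfolding eq .
    show "(norm (indicator V x - complex_of_real (u k x)))\<^sup>2 \<le> indicator V x" for k x
    proof (cases "x \<in> V")
      case True
      then have "indicator V x - complex_of_real (u k x) = of_real (1 - u k x)" by simp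
      then have "norm (indicator V x - complex_of_real (u k x)) = \<bar>1 - u k x\<bar>"
        by (metis norm_of_real)
      then show ?thesis using True u(3,4)[of k x] by (simp add: power_le_one)
    qed (use u(3,4)[of k x] in auto)
  qed (use V e test_functions_Lp_2[OF u(1)] in \<open>auto simp: Lp_2_iff\<close>)
  then obtain k where "L2sq (\<lambda>x. indicator V x - complex_of_real (u k x)) < e" by blast
  then show "\<exists>\<phi>\<in>test_functions. supp \<phi> \<subseteq> S \<and> L2sq (\<lambda>x. indicator V x - \<phi> x) < e"
    using u(1)[of k] order_trans[OF u(2)[of k] assms(2)]
    by (intro bexI[of _ "\<lambda>x. complex_of_real (u k x)"] conjI)
qed

lemma L2_approx_indicator:
  assumes S: "open S" and A: "A \<in> sets lebesgue" "A \<subseteq> S" "emeasure lebesgue A < \<infinity>"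
  shows "L2_approx S (\<lambda>x. indicator A x)"
proof (rule L2_approx_limit)
  show "(\<lambda>x. indicator A x :: complex) \<in> Lp 2" using A by (intro indicator_Lp_2) auto
  fix e :: real assume "e > 0"
  then obtain T where T: "open T" "A \<subseteq> T" "emeasure lebesgue (T - A) < ennreal e"
    using sets_lebesgue_outer_open[OF A(1), of e] by metis
  \<comment> \<open>Intersecting with S keeps the approximant inside S, and A is not cut since it
    lies in S.\<close>
  define V where "V = T \<inter> S"
  have V: "open V" "V \<subseteq> S" "A \<subseteq> V" using T S A by (auto simp: V_def)
  have Vm: "V \<in> sets lebesgue" using V by simp
  have "emeasure lebesgue (V - A) \<le> emeasure lebesgue (T - A)"
    using A T by (intro emeasure_mono) (auto simp: V_def)
  then have VA: "emeasure lebesgue (V - A) < ennreal e" using T by simp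
  have "V = (V - A) \<union> A" using V by auto
  then have "emeasure lebesgue V \<le> emeasure lebesgue (V - A) + emeasure lebesgue A"
    using A Vm by (metis emeasure_subadditive sets.Diff)
  also have "\<dots> < \<infinity>" using VA A(3) by (auto simp: less_top[symmetric] top_unique)
  finally have fin: "emeasure lebesgue V < \<infinity>" .
  have "L2sq (\<lambda>x. indicator A x - indicator V x) = L2sq (\<lambda>x. indicator (V - A) x)"
    unfolding L2sq_def using V(3) by (intro Bochner_Integration.integral_cong) (auto simp: indicator_def)
  also have "\<dots> = measure lebesgue (V - A)"
    using A Vm VA by (intro indicator_Lp_2) (auto simp: less_top[symmetric] top_unique)
  also have "\<dots> < e" using VA \<open>e > 0\<close> 
    unfolding measure_def by (metis enn2real_less_iff ennreal_enn2real_if ennreal_less_iff enn2real_nonneg ennreal_less_top less_trans less_top)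
  finally show "\<exists>g. L2_approx S g \<and> L2sq (\<lambda>x. indicator A x - g x) < e"
    using L2_approx_indicator_open[OF V(1,2) fin] by blast
qed

text \<open>The approximating simple functions are dominated by 2 * |f|. Hence they vanish where f
  does, so their nonzero level sets lie in S, and these sets have finite measure as in Chebyshev's
  inequality.\<close>

lemma test_functions_dense_L2:
  assumes S: "open S" and f: "f \<in> Lp 2" "\<And>x. x \<notin> S \<Longrightarrow> f x = 0"
  shows "L2_approx S f"
proof (rule L2_approx_limit[OF f(1)])
  fix e :: real assume e: "e > 0"
  have fm: "f \<in> borel_measurable lebesgue" and f2: "integrable lebesgue (\<lambda>x. (norm (f x))\<^sup>2)"
    using f by (auto simp: Lp_2_iff)
  obtain F where F: "\<And>k. simple_function lebesgue (F k)" "\<And>x. (\<lambda>k. F k x) \<longlonglongrightarrow> f x"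
      "\<And>k x. norm (F k x) \<le> 2 * norm (f x)"
    using borel_measurable_implies_sequence_metric[OF fm, of 0] by (auto simp: dist_norm)
  have Fm: "F k \<in> borel_measurable lebesgue" for k using F(1) by (rule borel_measurable_simple_function)
  have "\<exists>k. L2sq (\<lambda>x. f x - F k x) < e"
  proof (rule L2_dominated_convergence[where w = "\<lambda>x. 9 * (norm (f x))\<^sup>2"])
    show "(norm (f x - F k x))\<^sup>2 \<le> 9 * (norm (f x))\<^sup>2" for k x
    proof -
      have "norm (f x - F k x) \<le> 3 * norm (f x)"
        using F(3)[of k x] norm_triangle_ineq4[of "f x" "F k x"] by linarith
      then have "(norm (f x - F k x))\<^sup>2 \<le> (3 * norm (f x))\<^sup>2" by (intro power_mono) auto
      then show ?thesis by (simp add: power_mult_distrib)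
    qed
  qed (use F Fm fm f2 e in auto)
  then obtain k where k: "L2sq (\<lambda>x. f x - F k x) < e" by blast
  define A where "A y = F k -` {y}" for y
  \<comment> \<open>The value 0 is left out: its level set may have infinite measure and need not
    lie in S.\<close>
  define Y where "Y = range (F k) - {0}"
  have Y: "finite Y" using simple_functionD(1)[OF F(1)[of k]] by (simp add: Y_def)
  have "L2_approx S (\<lambda>x. \<Sum>y\<in>Y. y * indicator (A y) x)"
  proof (rule L2_approx_sum[OF Y], rule L2_approx_indicator[OF S])
    fix y assume "y \<in> Y"
    then have y: "y \<noteq> 0" by (simp add: Y_def)
    show m: "A y \<in> sets lebesgue" using simple_functionD(2)[OF F(1)[of k], of "{y}"] by (simp add: A_def)
    have nz: "norm y \<le> 2 * norm (f x)" if "x \<in> A y" for x using that F(3)[of k x] by (simp add: A_def)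
    show "A y \<subseteq> S"
    proof
      fix x assume "x \<in> A y"
      then have "f x \<noteq> 0" using nz y by fastforce
      then show "x \<in> S" using f(2) by blast
    qed
    have "integrable lebesgue (\<lambda>x. indicator (A y) x :: real)"
    proof (rule Bochner_Integration.integrable_bound)
      show "integrable lebesgue (\<lambda>x. 4 / (norm y)\<^sup>2 * (norm (f x))\<^sup>2)" using f2 by simp
      have "(norm y)\<^sup>2 \<le> 4 * (norm (f x))\<^sup>2" if "x \<in> A y" for x
        using power_mono[OF nz[OF that], of 2] by (simp add: power_mult_distrib)
      then show "AE x in lebesgue. norm (indicator (A y) x :: real) \<le> norm (4 / (norm y)\<^sup>2 * (norm (f x))\<^sup>2)"
        using y by (auto simp: indicator_def divide_simps)
    qed (use m in auto)
    then show "emeasure lebesgue (A y) < \<infinity>" using m by (auto simp: integrable_indicator_iff)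
  qed
  moreover have "(\<Sum>y\<in>Y. y * indicator (A y) x) = F k x" for x
  proof (cases "F k x = 0")
    case True
    then have "(\<Sum>y\<in>Y. y * indicator (A y) x) = 0"
      by (intro sum.neutral) (auto simp: A_def Y_def indicator_def)
    then show ?thesis using True by simp
  next
    case False
    have "(\<Sum>y\<in>Y. y * indicator (A y) x) = (\<Sum>y\<in>{F k x}. y * indicator (A y) x)"
      using Y False by (intro sum.mono_neutral_right) (auto simp: Y_def A_def indicator_def)
    then show ?thesis by (simp add: A_def)
  qed
  ultimately show "\<exists>g. L2_approx S g \<and> L2sq (\<lambda>x. f x - g x) < e" using k by auto
qed

section \<open>Operators on cubes\<close>

definition cube :: "real ^ 'n \<Rightarrow> real \<Rightarrow> (real ^ 'n) set" where
  "cube a l = cbox a (a + (\<chi> i. l))"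

lemma mem_cube: "x \<in> cube a l \<longleftrightarrow> (\<forall>i. a $ i \<le> x $ i \<and> x $ i \<le> a $ i + l)"
  by (simp add: cube_def mem_box_cart)

lemma cube_sets [simp, measurable]: "cube a l \<in> sets lebesgue"
  by (simp add: cube_def)

lemma cube_sets_borel [simp, measurable]: "cube a l \<in> sets borel"
  by (simp add: cube_def)

lemma compact_cube: "compact (cube a l)"
  by (simp add: cube_def)

lemma measure_cube:
  assumes "0 \<le> l"
  shows "measure lebesgue (cube (a :: real ^ 'n) l) = l ^ CARD('n)"
proof -
  have "cbox a (a + (\<chi> i. l)) \<noteq> {}" using assms by (auto simp: interval_ne_empty_cart)
  from content_cbox_cart[OF this] show ?thesis by (simp add: cube_def)
qed

lemma emeasure_cube_finite: "emeasure lebesgue (cube a l) < \<infinity>"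
  by (simp add: cube_def emeasure_lborel_cbox_eq)

lemma emeasure_cube:
  assumes "0 \<le> l"
  shows "emeasure lebesgue (cube (a :: real ^ 'n) l) = ennreal (l ^ CARD('n))"
  using measure_cube[OF assms, of a] emeasure_cube_finite[of a l]
  by (metis emeasure_eq_ennreal_measure infinity_ennreal_def less_irrefl)

lemma cubes_eq: "cubes = {cube a l | a l. 0 < l}"
  by (simp add: cubes_def cube_def)

lemma set_integral_norm_le_Lp_norm:
  fixes h :: "real ^ 'n \<Rightarrow> complex"
  assumes h: "h \<in> Lp p" and p: "1 \<le> p" and l: "0 < l" and M: "0 < M" "Lp_norm p h \<le> M"
  shows "set_integrable lebesgue (cube a l) h"
    and "(LINT x:cube a l|lebesgue. norm (h x)) \<le> 2 * M * (l ^ CARD('n)) powr (1 - 1 / p)"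
proof -
  define Q where "Q = cube a l"
  define m where "m = l ^ CARD('n)"
  have m: "m > 0" using l by (simp add: m_def)
  have mQ: "measure lebesgue Q = m" using l measure_cube[of l a] by (simp add: m_def Q_def)
  (* Hoelder up to the factor 2: integrate t <= tau + tau powr (1 - p) * t powr p with the tau balancing both terms. *)
  define \<tau> where "\<tau> = M * m powr (- 1 / p)"
  have \<tau>: "\<tau> > 0" using m M by (simp add: \<tau>_def)
  have hm: "h \<in> borel_measurable lebesgue" and hi: "integrable lebesgue (\<lambda>x. norm (h x) powr p)"
    using h by (auto simp: Lp_def)
  have pt: "t \<le> \<tau> + \<tau> powr (1 - p) * t powr p" if t: "0 \<le> t" for t
  proof (cases "t \<le> \<tau>")
    case True
    moreover have "0 \<le> \<tau> powr (1 - p) * t powr p" by simp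
    ultimately show ?thesis by linarith
  next
    case False
    then have "t > 0" using \<tau> by simp
    then have "t = t powr (1 - p) * t powr p" by (simp flip: powr_add)
    also have "\<dots> \<le> \<tau> powr (1 - p) * t powr p"
      using False \<tau> p by (intro mult_right_mono powr_mono2') auto
    finally show ?thesis using \<tau> by simp
  qed
  have Qi: "integrable lebesgue (indicator Q :: real ^ 'n \<Rightarrow> real)"
    using emeasure_cube_finite[of a l] by (simp add: Q_def)
  have R: "integrable lebesgue (\<lambda>x. \<tau> * indicator Q x + \<tau> powr (1 - p) * norm (h x) powr p)"
    using Qi hi by simp
  have le: "norm (indicator Q x *\<^sub>R h x) \<le> \<tau> * indicator Q x + \<tau> powr (1 - p) * norm (h x) powr p" for x
    using pt[of "norm (h x)"] by (auto simp: indicator_def)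
  show 1: "set_integrable lebesgue (cube a l) h"
    unfolding set_integrable_def Q_def[symmetric]
    by (rule Bochner_Integration.integrable_bound[OF R])
      (use hm le in \<open>auto simp: Q_def intro!: AE_I2 order_trans[OF _ abs_ge_self]\<close>)
  have "(LINT x:Q|lebesgue. norm (h x)) \<le>
      (\<integral>x. \<tau> * indicator Q x + \<tau> powr (1 - p) * norm (h x) powr p \<partial>lebesgue)"
    unfolding set_lebesgue_integral_def
  proof (rule integral_mono[OF _ R])
    show "integrable lebesgue (\<lambda>x. indicator Q x *\<^sub>R norm (h x))"
      using integrable_norm[OF 1[unfolded set_integrable_def]] by (simp add: Q_def)
    show "indicator Q x *\<^sub>R norm (h x) \<le> \<tau> * indicator Q x + \<tau> powr (1 - p) * norm (h x) powr p" for x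
      using le[of x] by simp
  qed
  also have "\<dots> = \<tau> * m + \<tau> powr (1 - p) * (\<integral>x. norm (h x) powr p \<partial>lebesgue)"
    using Qi hi mQ by simp
  also have "\<dots> \<le> \<tau> * m + \<tau> powr (1 - p) * M powr p"
  proof -
    have nn: "(\<integral>x. norm (h x) powr p \<partial>lebesgue) \<ge> 0" by simp
    then have "(\<integral>x. norm (h x) powr p \<partial>lebesgue) = Lp_norm p h powr p"
      using p by (simp add: Lp_norm_def powr_powr)
    also have "\<dots> \<le> M powr p" using M p by (intro powr_mono2) (auto simp: Lp_norm_def)
    finally show ?thesis by (intro add_left_mono mult_left_mono) auto
  qed
  also have "\<tau> * m = M * m powr (1 - 1 / p)"
    using m by (simp add: \<tau>_def powr_diff powr_minus field_simps)
  also have "\<tau> powr (1 - p) * M powr p = M * m powr (1 - 1 / p)"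
  proof -
    have "\<tau> powr (1 - p) * M powr p = (M powr (1 - p) * M powr p) * m powr ((- 1 / p) * (1 - p))"
      using M m by (simp add: \<tau>_def powr_mult powr_powr)
    also have "(- 1 / p) * (1 - p) = 1 - 1 / p" using p by (simp add: field_simps)
    also have "M powr (1 - p) * M powr p = M" using M by (simp flip: powr_add)
    finally show ?thesis .
  qed
  finally show "(LINT x:cube a l|lebesgue. norm (h x)) \<le> 2 * M * (l ^ CARD('n)) powr (1 - 1 / p)"
    by (simp add: Q_def m_def)
qed

definition biadditive :: "((real ^ 'n \<Rightarrow> complex) \<Rightarrow> (real ^ 'n \<Rightarrow> complex) \<Rightarrow> real ^ 'n \<Rightarrow> complex) \<Rightarrow> bool" where
  "biadditive U \<longleftrightarrow>
     (\<forall>f1\<in>Lp 2. \<forall>f2\<in>Lp 2. \<forall>g\<in>Lp 2. AE x in lebesgue. U (\<lambda>x. f1 x + f2 x) g x = U f1 g x + U f2 g x) \<and>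
     (\<forall>f\<in>Lp 2. \<forall>g1\<in>Lp 2. \<forall>g2\<in>Lp 2. AE x in lebesgue. U f (\<lambda>x. g1 x + g2 x) x = U f g1 x + U f g2 x)"

text \<open>Boundedness from L^2 x L^2 into L^1(Q), the common form in which both extension
  hypotheses enter the estimates. The exponent of the target space survives only in the way B
  depends on the side of Q.\<close>

definition cube_bound ::
    "((real ^ 'n \<Rightarrow> complex) \<Rightarrow> (real ^ 'n \<Rightarrow> complex) \<Rightarrow> real ^ 'n \<Rightarrow> complex) \<Rightarrow> (real ^ 'n) set \<Rightarrow> real \<Rightarrow> bool" where
  "cube_bound U Q B \<longleftrightarrow> 0 \<le> B \<and> (\<forall>f\<in>Lp 2. \<forall>g\<in>Lp 2. set_integrable lebesgue Q (U f g) \<and>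
     (LINT x:Q|lebesgue. norm (U f g x)) \<le> B * sqrt (L2sq f) * sqrt (L2sq g))"

lemma biadditiveD:
  assumes "biadditive U"
  shows "f1 \<in> Lp 2 \<Longrightarrow> f2 \<in> Lp 2 \<Longrightarrow> g \<in> Lp 2 \<Longrightarrow>
      AE x in lebesgue. U (\<lambda>x. f1 x + f2 x) g x = U f1 g x + U f2 g x"
    and "f \<in> Lp 2 \<Longrightarrow> g1 \<in> Lp 2 \<Longrightarrow> g2 \<in> Lp 2 \<Longrightarrow>
      AE x in lebesgue. U f (\<lambda>x. g1 x + g2 x) x = U f g1 x + U f g2 x"
  using assms by (simp_all add: biadditive_def)

lemma bounded_bilinear_Lp_biadditive: "bounded_bilinear_Lp 2 2 r U \<Longrightarrow> biadditive U"
  by (simp add: bounded_bilinear_Lp_def biadditive_def)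

text \<open>Hoelder's inequality on the cube. The power of the volume is constant for r = 1 and has
  exponent 1 - \<epsilon> for r = 1 / \<epsilon>.\<close>

lemma bounded_bilinear_Lp_cube_bound:
  fixes U :: "(real ^ 'n \<Rightarrow> complex) \<Rightarrow> (real ^ 'n \<Rightarrow> complex) \<Rightarrow> real ^ 'n \<Rightarrow> complex"
  assumes U: "bounded_bilinear_Lp 2 2 r U" and r: "1 \<le> r"
  obtains A where "0 \<le> A"
    "\<And>a l. 0 < l \<Longrightarrow> cube_bound U (cube a l) (A * (l ^ CARD('n)) powr (1 - 1 / r))"
proof -
  note U' = U[unfolded bounded_bilinear_Lp_def]
  obtain C where C: "\<And>f g. f \<in> Lp 2 \<Longrightarrow> g \<in> Lp 2 \<Longrightarrow> Lp_norm r (U f g) \<le> C * Lp_norm 2 f * Lp_norm 2 g"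
    and Ur: "\<And>f g. f \<in> Lp 2 \<Longrightarrow> g \<in> Lp 2 \<Longrightarrow> U f g \<in> Lp r"
    using U'[THEN conjunct1] U'[THEN conjunct2, THEN conjunct2, THEN conjunct2, THEN conjunct2] by blast
  show ?thesis
  proof (rule that[of "2 * \<bar>C\<bar>"])
    fix a :: "real ^ 'n" and l :: real assume l: "0 < l"
    define q where "q = (l ^ CARD('n)) powr (1 - 1 / r)"
    have q: "q > 0" using l by (simp add: q_def)
    show "cube_bound U (cube a l) (2 * \<bar>C\<bar> * (l ^ CARD('n)) powr (1 - 1 / r))"
      unfolding cube_bound_def q_def[symmetric]
    proof (intro conjI ballI)
      fix f g :: "real ^ 'n \<Rightarrow> complex" assume f: "f \<in> Lp 2" and g: "g \<in> Lp 2"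
      define N where "N = \<bar>C\<bar> * sqrt (L2sq f) * sqrt (L2sq g)"
      have N: "N \<ge> 0" by (simp add: N_def L2sq_nonneg)
      have "C * (sqrt (L2sq f) * sqrt (L2sq g)) \<le> \<bar>C\<bar> * (sqrt (L2sq f) * sqrt (L2sq g))"
        by (intro mult_right_mono) (auto simp: L2sq_nonneg)
      then have CN: "Lp_norm r (U f g) \<le> N" using C[OF f g] by (simp add: N_def Lp_norm_2 mult.assoc)
      \<comment> \<open>The margin d keeps the bound positive when N = 0; it is removed below by
        letting it become arbitrarily small.\<close>
      have *: "set_integrable lebesgue (cube a l) (U f g)"
        "(LINT x:cube a l|lebesgue. norm (U f g x)) \<le> 2 * (N + d) * q" if "d > 0" for d
        using set_integral_norm_le_Lp_norm[OF Ur[OF f g] r l, of "N + d" a] CN N that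
        by (auto simp: q_def)
      show "set_integrable lebesgue (cube a l) (U f g)" using *(1)[of 1] by simp
      have "(LINT x:cube a l|lebesgue. norm (U f g x)) \<le> 2 * N * q"
      proof (rule field_le_epsilon)
        fix e :: real assume "e > 0"
        then have "e / (2 * q) > 0" using q by simp
        moreover have "2 * (N + e / (2 * q)) * q = 2 * N * q + e" using q by (simp add: field_simps)
        ultimately show "(LINT x:cube a l|lebesgue. norm (U f g x)) \<le> 2 * N * q + e"
          using *(2)[of "e / (2 * q)"] by simp
      qed
      then show "(LINT x:cube a l|lebesgue. norm (U f g x)) \<le>
          2 * \<bar>C\<bar> * q * sqrt (L2sq f) * sqrt (L2sq g)"
        by (simp add: N_def mult_ac)
    qed (use q in auto)
  qed auto
qed

lemma set_integral_norm_triangle: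
  fixes h h1 h2 :: "real ^ 'n \<Rightarrow> complex"
  assumes Q: "Q \<in> sets lebesgue" and i: "set_integrable lebesgue Q h1" "set_integrable lebesgue Q h2"
    and h: "set_integrable lebesgue Q h" and ae: "AE x in lebesgue. norm (h x) \<le> norm (h1 x) + norm (h2 x)"
  shows "(LINT x:Q|lebesgue. norm (h x)) \<le> (LINT x:Q|lebesgue. norm (h1 x)) + (LINT x:Q|lebesgue. norm (h2 x))"
proof -
  have "(LINT x:Q|lebesgue. norm (h x)) \<le> (LINT x:Q|lebesgue. norm (h1 x) + norm (h2 x))"
    using i h ae by (intro set_integral_mono_AE set_integral_add set_integrable_norm) auto
  also have "\<dots> = (LINT x:Q|lebesgue. norm (h1 x)) + (LINT x:Q|lebesgue. norm (h2 x))"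
    using i by (intro set_integral_add set_integrable_norm) auto
  finally show ?thesis .
qed

lemma cube_bound_continuous:
  assumes U: "biadditive U" "cube_bound U Q B" and Q: "Q \<in> sets lebesgue"
    and u: "u \<in> Lp 2" and v: "v \<in> Lp 2" and e: "0 < e"
  obtains d where "0 < d" "\<And>u' v'. u' \<in> Lp 2 \<Longrightarrow> v' \<in> Lp 2 \<Longrightarrow> L2sq (\<lambda>x. u x - u' x) < d \<Longrightarrow>
    L2sq (\<lambda>x. v x - v' x) < d \<Longrightarrow> (LINT x:Q|lebesgue. norm (U u v x - U u' v' x)) < e"
proof -
  \<comment> \<open>\<open>\<omega>\<close> bounds the integral of |U (u - u') v| + |U u' (v - v')|.
    The second term involves u', whose squared norm is at most 2 * L2sq u + 2 * d. Since
    \<open>\<omega>\<close> tends to 0 with d, a suitable d exists.\<close>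
  define \<omega> where "\<omega> d = B * sqrt d * sqrt (L2sq v) + B * sqrt (2 * L2sq u + 2 * d) * sqrt d" for d
  have B: "B \<ge> 0" using U by (simp add: cube_bound_def)
  have "(\<omega> \<longlongrightarrow> B * sqrt 0 * sqrt (L2sq v) + B * sqrt (2 * L2sq u + 2 * 0) * sqrt 0) (at_right 0)"
    unfolding \<omega>_def by (intro tendsto_intros)
  then have "\<forall>\<^sub>F d in at_right 0. \<omega> d < e" using e by (intro order_tendstoD) auto
  then obtain b where b: "b > 0" "\<And>d. 0 < d \<Longrightarrow> d < b \<Longrightarrow> \<omega> d < e"
    by (auto simp: eventually_at_right_field)
  define d where "d = b / 2"
  have d: "d > 0" "\<omega> d < e" using b by (auto simp: d_def)
  have "(LINT x:Q|lebesgue. norm (U u v x - U u' v' x)) < e"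
    if u': "u' \<in> Lp 2" and v': "v' \<in> Lp 2" and du: "L2sq (\<lambda>x. u x - u' x) < d"
      and dv: "L2sq (\<lambda>x. v x - v' x) < d" for u' v'
  proof -
    have m: "(\<lambda>x. u x - u' x) \<in> Lp 2" "(\<lambda>x. v x - v' x) \<in> Lp 2"
      using u v u' v' by (auto intro: Lp_2_diff)
    have "AE x in lebesgue. U (\<lambda>x. (u x - u' x) + u' x) v x = U (\<lambda>x. u x - u' x) v x + U u' v x"
      using m u' v by (intro biadditiveD(1)[OF U(1)])
    moreover have "AE x in lebesgue. U u' (\<lambda>x. (v x - v' x) + v' x) x = U u' (\<lambda>x. v x - v' x) x + U u' v' x"
      using m u' v' by (intro biadditiveD(2)[OF U(1)])
    ultimately have ae: "AE x in lebesgue. norm (U u v x - U u' v' x) \<le>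
        norm (U (\<lambda>x. u x - u' x) v x) + norm (U u' (\<lambda>x. v x - v' x) x)"
      by eventually_elim (simp add: norm_triangle_ineq)
    have I: "set_integrable lebesgue Q (U f g)"
      "(LINT x:Q|lebesgue. norm (U f g x)) \<le> B * sqrt (L2sq f) * sqrt (L2sq g)"
      if "f \<in> Lp 2" "g \<in> Lp 2" for f g
      using U(2) that by (auto simp: cube_bound_def)
    have "(LINT x:Q|lebesgue. norm (U u v x - U u' v' x)) \<le>
        (LINT x:Q|lebesgue. norm (U (\<lambda>x. u x - u' x) v x)) + (LINT x:Q|lebesgue. norm (U u' (\<lambda>x. v x - v' x) x))"
      using m u v u' v' ae Q by (intro set_integral_norm_triangle I set_integral_diff(1)) auto
    also have "\<dots> \<le> B * sqrt (L2sq (\<lambda>x. u x - u' x)) * sqrt (L2sq v) +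
        B * sqrt (L2sq u') * sqrt (L2sq (\<lambda>x. v x - v' x))"
      using m u v u' v' by (intro add_mono I)
    also have "\<dots> \<le> \<omega> d"
    proof -
      have "L2sq (\<lambda>x. u x + (-1) * (u x - u' x)) \<le> 2 * L2sq u + 2 * L2sq (\<lambda>x. (-1) * (u x - u' x))"
        using u m by (intro Lp_2_add Lp_2_cmult)
      also have "L2sq (\<lambda>x. (-1) * (u x - u' x)) = (norm (-1::complex))\<^sup>2 * L2sq (\<lambda>x. u x - u' x)"
        using m by (intro Lp_2_cmult)
      finally have "L2sq u' \<le> 2 * L2sq u + 2 * d" using du by simp
      then show ?thesis unfolding \<omega>_def using du dv B d(1) L2sq_nonneg[of u]
        by (intro add_mono mult_mono mult_left_mono mult_nonneg_nonneg) (auto simp: L2sq_nonneg)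
    qed
    also note d(2)
    finally show ?thesis .
  qed
  with d(1) that show ?thesis by blast
qed

lemma set_integrable_mult_test_function:
  fixes h :: "real ^ 'n \<Rightarrow> complex"
  assumes h: "set_integrable lebesgue Q h" and \<phi>: "\<phi> \<in> test_functions" "supp \<phi> \<subseteq> Q"
  shows "integrable lebesgue (\<lambda>x. h x * \<phi> x)"
proof -
  have "bounded (range \<phi>)"
    using \<phi> in_suppI[of \<phi>] by (intro bounded_compact_support[of _ "supp \<phi>"] test_functions_continuous)
      (auto simp: test_functions_def)
  then obtain b where b: "\<And>x. norm (\<phi> x) \<le> b" by (auto simp: bounded_iff)
  have i: "integrable lebesgue (\<lambda>x. indicator Q x *\<^sub>R h x)" using h unfolding set_integrable_def .
  have eq: "h x * \<phi> x = \<phi> x * (indicator Q x *\<^sub>R h x)" for x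
    using \<phi>(2) in_suppI[of \<phi> x] by (cases "\<phi> x = 0") auto
  show ?thesis
    unfolding eq
  proof (rule Bochner_Integration.integrable_bound)
    show "integrable lebesgue (\<lambda>x. b * norm (indicator Q x *\<^sub>R h x))"
      using integrable_norm[OF i] by (intro integrable_mult_right)
    show "(\<lambda>x. \<phi> x * (indicator Q x *\<^sub>R h x)) \<in> borel_measurable lebesgue"
      using i lebesgue_measurable_of_borel[OF test_functions_borel[OF \<phi>(1)]]
      by (intro borel_measurable_times) auto
    show "AE x in lebesgue. norm (\<phi> x * (indicator Q x *\<^sub>R h x)) \<le> norm (b * norm (indicator Q x *\<^sub>R h x))"
    proof (rule AE_I2)
      fix x
      have "norm (\<phi> x * (indicator Q x *\<^sub>R h x)) \<le> b * norm (indicator Q x *\<^sub>R h x)"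
        unfolding norm_mult by (intro mult_right_mono b) auto
      then show "norm (\<phi> x * (indicator Q x *\<^sub>R h x)) \<le> norm (b * norm (indicator Q x *\<^sub>R h x))"
        by (metis abs_ge_self order_trans real_norm_def)
    qed
  qed
qed

text \<open>Countably many centred cubes exhaust the space; \<open>Suc k\<close> keeps their sides
  positive. Interiors appear because test functions determine a function only on an open
  set.\<close>

lemma AE_cubesI:
  assumes "\<And>a l. 0 < l \<Longrightarrow> AE x in lebesgue. x \<in> interior (cube (a :: real ^ 'n) l) \<longrightarrow> P x"
  shows "AE x in lebesgue. P x"
proof -
  have "AE x in lebesgue. \<forall>k. x \<in> interior (cube (- (\<chi> i. real (Suc k)) :: real ^ 'n) (2 * real (Suc k))) \<longrightarrow> P x"
    unfolding AE_all_countable by (intro allI assms) simp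
  moreover have "\<exists>k. x \<in> interior (cube (- (\<chi> i. real (Suc k)) :: real ^ 'n) (2 * real (Suc k)))" for x :: "real ^ 'n"
  proof -
    obtain k where k: "norm x < real k" using reals_Archimedean2 by blast
    have "- 1 < real k + x $ i" "x $ i < 1 + real k" for i
      using component_le_norm_cart[of x i] k by linarith+
    then show ?thesis
      by (intro exI[of _ k]) (auto simp: cube_def interior_cbox mem_box_cart algebra_simps)
  qed
  ultimately show ?thesis by (auto elim!: eventually_mono)
qed

lemma AE_zero_of_set_integral_norm:
  fixes h :: "real ^ 'n \<Rightarrow> complex"
  assumes "set_integrable lebesgue Q h" "(LINT x:Q|lebesgue. norm (h x)) \<le> 0"
  shows "AE x in lebesgue. x \<in> Q \<longrightarrow> h x = 0"
proof -
  have i: "integrable lebesgue (\<lambda>x. indicator Q x *\<^sub>R norm (h x))"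
    using set_integrable_norm[OF assms(1)] unfolding set_integrable_def .
  have "(\<integral>x. indicator Q x *\<^sub>R norm (h x) \<partial>lebesgue) \<ge> 0"
    by (intro integral_nonneg_AE) auto
  then have "(\<integral>x. indicator Q x *\<^sub>R norm (h x) \<partial>lebesgue) = 0"
    using assms(2) unfolding set_lebesgue_integral_def by linarith
  then have "AE x in lebesgue. indicator Q x *\<^sub>R norm (h x) = 0"
    using integral_nonneg_eq_0_iff_AE[OF i] by auto
  then show ?thesis by (rule eventually_mono) auto
qed

text \<open>On test functions both operators represent T, so they agree almost everywhere there. The
  exponents r1 and r2 may differ, and the comparison for general f and g takes place in L^1 of a
  cube, where both operators are continuous.\<close>

lemma bounded_extension_unique:
  fixes U1 U2 :: "(real ^ 'n::finite \<Rightarrow> complex) \<Rightarrow> (real ^ 'n \<Rightarrow> complex) \<Rightarrow> real ^ 'n \<Rightarrow> complex"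
  assumes U1: "bounded_extension 2 2 r1 T U1" "1 \<le> r1" and U2: "bounded_extension 2 2 r2 T U2" "1 \<le> r2"
    and f: "f \<in> Lp 2" and g: "g \<in> Lp 2"
  shows "AE x in lebesgue. U1 f g x = U2 f g x"
proof (rule AE_cubesI)
  fix a :: "real ^ 'n" and l :: real assume l: "0 < l"
  define Q where "Q = cube a l"
  have Qm: "Q \<in> sets lebesgue" by (simp add: Q_def)
  have bi: "biadditive U1" "biadditive U2"
    using U1 U2 bounded_bilinear_Lp_biadditive by (auto simp: bounded_extension_def)
  have cb1: "\<exists>B. cube_bound U1 (cube a l) B" if "0 < l" for a l
    using bounded_bilinear_Lp_cube_bound[of r1 U1] U1 that by (metis bounded_extension_def)
  have cb2: "\<exists>B. cube_bound U2 (cube a l) B" if "0 < l" for a l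
    using bounded_bilinear_Lp_cube_bound[of r2 U2] U2 that by (metis bounded_extension_def)
  have I1: "set_integrable lebesgue (cube a l) (U1 u v)" if "0 < l" "u \<in> Lp 2" "v \<in> Lp 2" for a l u v
    using cb1[OF that(1)] that by (metis cube_bound_def)
  have I2: "set_integrable lebesgue (cube a l) (U2 u v)" if "0 < l" "u \<in> Lp 2" "v \<in> Lp 2" for a l u v
    using cb2[OF that(1)] that by (metis cube_bound_def)
  have test: "AE x in lebesgue. U1 u v x = U2 u v x" if u: "u \<in> test_functions" and v: "v \<in> test_functions" for u v
  proof (rule AE_cubesI)
    fix a :: "real ^ 'n" and l :: real assume l: "0 < l"
    note i1 = I1[OF l test_functions_Lp_2[OF u] test_functions_Lp_2[OF v], of a]
    note i2 = I2[OF l test_functions_Lp_2[OF u] test_functions_Lp_2[OF v], of a]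
    have "AE x in lebesgue. x \<in> interior (cube a l) \<longrightarrow> U1 u v x - U2 u v x = 0"
    proof (rule AE_zero_of_test_functions)
      show "set_integrable lebesgue (interior (cube a l)) (\<lambda>x. U1 u v x - U2 u v x)"
        using set_integral_diff(1)[OF i1 i2] by (rule set_integrable_subset) (auto simp: interior_subset)
      fix \<phi> :: "real ^ 'n \<Rightarrow> complex" assume \<phi>: "\<phi> \<in> test_functions" "supp \<phi> \<subseteq> interior (cube a l)"
      have s: "supp \<phi> \<subseteq> cube a l" using \<phi>(2) interior_subset by blast
      have "(\<integral>x. U1 u v x * \<phi> x \<partial>lebesgue) = T u v \<phi>" "(\<integral>x. U2 u v x * \<phi> x \<partial>lebesgue) = T u v \<phi>"
        using U1 U2 u v \<phi> test_functions_schwartz unfolding bounded_extension_def by (metis subsetD)+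
      then show "(\<integral>x. (U1 u v x - U2 u v x) * \<phi> x \<partial>lebesgue) = 0"
        using set_integrable_mult_test_function[OF i1 \<phi>(1) s] set_integrable_mult_test_function[OF i2 \<phi>(1) s]
        by (simp add: left_diff_distrib)
    qed simp
    then show "AE x in lebesgue. x \<in> interior (cube a l) \<longrightarrow> U1 u v x = U2 u v x"
      by simp
  qed
  obtain B1 B2 where B: "cube_bound U1 Q B1" "cube_bound U2 Q B2" using cb1[OF l, of a] cb2[OF l, of a] unfolding Q_def by blast
  have D: "set_integrable lebesgue Q (\<lambda>x. U1 f g x - U2 f g x)"
    unfolding Q_def by (intro set_integral_diff(1) I1 I2 l f g)
  have "(LINT x:Q|lebesgue. norm (U1 f g x - U2 f g x)) \<le> 0"
  proof (rule field_le_epsilon)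
    fix e :: real assume "e > 0"
    then have e: "e / 2 > 0" by simp
    obtain d1 where d1: "d1 > 0" "\<And>u' v'. u' \<in> Lp 2 \<Longrightarrow> v' \<in> Lp 2 \<Longrightarrow> L2sq (\<lambda>x. f x - u' x) < d1 \<Longrightarrow>
       L2sq (\<lambda>x. g x - v' x) < d1 \<Longrightarrow> (LINT x:Q|lebesgue. norm (U1 f g x - U1 u' v' x)) < e / 2"
      using cube_bound_continuous[OF bi(1) B(1) Qm f g e] by blast
    obtain d2 where d2: "d2 > 0" "\<And>u' v'. u' \<in> Lp 2 \<Longrightarrow> v' \<in> Lp 2 \<Longrightarrow> L2sq (\<lambda>x. f x - u' x) < d2 \<Longrightarrow>
       L2sq (\<lambda>x. g x - v' x) < d2 \<Longrightarrow> (LINT x:Q|lebesgue. norm (U2 f g x - U2 u' v' x)) < e / 2"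
      using cube_bound_continuous[OF bi(2) B(2) Qm f g e] by blast
    have "min d1 d2 > 0" using d1 d2 by simp
    then obtain u where u: "u \<in> test_functions" "L2sq (\<lambda>x. f x - u x) < min d1 d2"
      using test_functions_dense_L2[of UNIV f] f unfolding L2_approx_def by blast
    obtain v where v: "v \<in> test_functions" "L2sq (\<lambda>x. g x - v x) < min d1 d2"
      using test_functions_dense_L2[of UNIV g] g \<open>min d1 d2 > 0\<close> unfolding L2_approx_def by blast
    note uv = test_functions_Lp_2[OF u(1)] test_functions_Lp_2[OF v(1)]
    have "(LINT x:Q|lebesgue. norm (U1 f g x - U2 f g x)) \<le>
        (LINT x:Q|lebesgue. norm (U1 f g x - U1 u v x)) + (LINT x:Q|lebesgue. norm (U2 f g x - U2 u v x))"
    proof (rule set_integral_norm_triangle[OF Qm _ _ D])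
      show "set_integrable lebesgue Q (\<lambda>x. U1 f g x - U1 u v x)" "set_integrable lebesgue Q (\<lambda>x. U2 f g x - U2 u v x)"
        unfolding Q_def by (intro set_integral_diff(1) I1 I2 l f g uv)+
      show "AE x in lebesgue. norm (U1 f g x - U2 f g x) \<le> norm (U1 f g x - U1 u v x) + norm (U2 f g x - U2 u v x)"
        using test[OF u(1) v(1)]
      proof eventually_elim
        case (elim x)
        then have "U1 f g x - U2 f g x = (U1 f g x - U1 u v x) - (U2 f g x - U2 u v x)" by simp
        then show ?case by (metis norm_triangle_ineq4)
      qed
    qed
    also have "\<dots> \<le> 0 + e"
      using d1(2)[OF uv] d2(2)[OF uv] u v by simp
    finally show "(LINT x:Q|lebesgue. norm (U1 f g x - U2 f g x)) \<le> 0 + e" .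
  qed
  from AE_zero_of_set_integral_norm[OF D this]
  show "AE x in lebesgue. x \<in> interior (cube a l) \<longrightarrow> U1 f g x = U2 f g x"
    by (rule eventually_mono) (use interior_subset[of "cube a l"] in \<open>auto simp: Q_def\<close>)
qed

section \<open>Integrals against the kernel\<close>

lemma lebesgue_measurable_cong_AE:
  fixes f g :: "'a::euclidean_space \<Rightarrow> 'b::topological_space"
  assumes g: "g \<in> borel_measurable lebesgue" and ae: "AE x in lebesgue. f x = g x"
  shows "f \<in> borel_measurable lebesgue"
proof (rule measurableI)
  fix S :: "'b set" assume "S \<in> sets borel"
  then have "g -` S \<inter> space lebesgue \<in> sets lebesgue" using g by (rule measurable_sets[rotated])
  moreover have "AE x in lebesgue. x \<in> g -` S \<inter> space lebesgue \<longleftrightarrow> x \<in> f -` S \<inter> space lebesgue"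
    using ae by eventually_elim auto
  ultimately show "f -` S \<inter> space lebesgue \<in> sets lebesgue"
    using completion.in_sets_AE[of "g -` S \<inter> space lebesgue" "f -` S \<inter> space lebesgue"] by auto
qed auto

lemma lebesgue_integrable_cong_lborel:
  fixes f g :: "'a::euclidean_space \<Rightarrow> complex"
  assumes g: "integrable lborel g" and ae: "AE x in lborel. f x = g x"
  shows "integrable lebesgue f" "(\<integral>x. f x \<partial>lebesgue) = (\<integral>x. g x \<partial>lborel)"
proof -
  have gm: "g \<in> borel_measurable lborel" using g by auto
  have gi: "integrable lebesgue g" using g integrable_completion[OF gm] by simp
  then have gl: "g \<in> borel_measurable lebesgue" by auto
  have ae': "AE x in lebesgue. f x = g x" using ae by (rule AE_completion)
  have fl: "f \<in> borel_measurable lebesgue" using gl ae' by (rule lebesgue_measurable_cong_AE)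
  show "integrable lebesgue f" using integrable_cong_AE[OF fl gl ae'] gi by simp
  show "(\<integral>x. f x \<partial>lebesgue) = (\<integral>x. g x \<partial>lborel)"
    using integral_cong_AE[OF fl gl ae'] integral_completion[OF gm] by simp
qed

text \<open>Lebesgue measure on a product space is the completion of a product measure and not
  itself the product of Lebesgue measures. Fubini's theorem is therefore applied to a Borel
  representative, and the result is carried back to f across null sets.\<close>

lemma lebesgue_integrable_imp_lborel:
  fixes f :: "'a::euclidean_space \<Rightarrow> complex"
  assumes f: "integrable lebesgue f"
  obtains g where "integrable lborel g" "AE x in lborel. f x = g x"
proof -
  have "(\<lambda>x. Re (f x)) \<in> borel_measurable lebesgue" "(\<lambda>x. Im (f x)) \<in> borel_measurable lebesgue"
    using f by auto
  from this[THEN completion_ex_borel_measurable_real] obtain p q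
    where p: "p \<in> borel_measurable lborel" "AE x in lborel. Re (f x) = p x"
      and q: "q \<in> borel_measurable lborel" "AE x in lborel. Im (f x) = q x" by blast
  define g where "g x = Complex (p x) (q x)" for x
  have "g = (\<lambda>x. of_real (p x) + \<i> * of_real (q x))" by (simp add: g_def fun_eq_iff complex_eq_iff)
  then have gm: "g \<in> borel_measurable lborel" using p q by simp
  have ae: "AE x in lborel. f x = g x"
    using p(2) q(2) by eventually_elim (simp add: g_def complex_eq_iff)
  have "integrable lebesgue g"
  proof -
    have "g \<in> borel_measurable lebesgue" using gm measurable_completion by blast
    moreover have "f \<in> borel_measurable lebesgue" using f by auto
    ultimately show ?thesis using integrable_cong_AE[OF _ _ AE_completion[OF ae]] f by simp
  qed
  then have "integrable lborel g" using integrable_completion[OF gm] by simp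
  with ae that show ?thesis by blast
qed

text \<open>The product of Q, \<open>supp u\<close> and \<open>supp v\<close> is compact and misses
  the diagonal, so K is integrable on it. Fubini's theorem then yields the inner integral for almost
  every x in Q and its integrability over Q.\<close>

lemma kernel_integrable:
  fixes K :: "real ^ 'n \<Rightarrow> real ^ 'n \<Rightarrow> real ^ 'n \<Rightarrow> complex"
  assumes K: "locally_integrable_on (\<lambda>(x, y, z). K x y z) (- diag3)"
    and Q: "compact Q" and u: "u \<in> test_functions" and v: "v \<in> test_functions"
    and disj: "Q \<inter> supp u \<inter> supp v = {}"
  shows "AE x in lebesgue. x \<in> Q \<longrightarrow> integrable lebesgue (\<lambda>(y, z). K x y z * u y * v z)"
    and "set_integrable lebesgue Q (\<lambda>x. \<integral>(y, z). K x y z * u y * v z \<partial>lebesgue)"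
proof -
  define D where "D = Q \<times> supp u \<times> supp v"
  have cs: "compact (supp u)" "compact (supp v)" using u v by (auto simp: test_functions_def)
  then have "compact D" unfolding D_def using Q by (intro compact_Times)
  moreover have "D \<subseteq> - diag3" using disj by (auto simp: D_def diag3_def)
  ultimately have KD: "integrable lebesgue (\<lambda>p. indicator D p *\<^sub>R (\<lambda>(x, y, z). K x y z) p)"
    using K unfolding locally_integrable_on_def set_integrable_def by blast
  define w where "w = (\<lambda>(x :: real ^ 'n, y, z). u y * v z)"
  \<comment> \<open>Truncating K to D turns local integrability into integrability on the whole
    space. For x in Q nothing is lost, because w vanishes when y or z is outside the
    supports.\<close>
  define G where "G p = w p * (indicator D p *\<^sub>R (\<lambda>(x, y, z). K x y z) p)" for p
  have cu: "continuous_on UNIV u" and cv: "continuous_on UNIV v"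
    using u v test_functions_continuous by auto
  have "bounded (range u)" "bounded (range v)"
    using bounded_compact_support[OF cu cs(1)] bounded_compact_support[OF cv cs(2)]
      in_suppI[of u] in_suppI[of v] by auto
  then obtain bu bv where b: "\<And>x. norm (u x) \<le> bu" "\<And>x. norm (v x) \<le> bv"
    unfolding bounded_iff by auto
  have wb: "norm (w p) \<le> bu * bv" for p
    unfolding w_def using b order_trans[OF norm_ge_zero b(1)]
    by (auto simp: norm_mult split: prod.split intro!: mult_mono)
  have "continuous_on UNIV (\<lambda>p. u (fst (snd p)) * v (snd (snd p)))"
    by (intro continuous_intros continuous_on_compose2[OF cu] continuous_on_compose2[OF cv]) auto
  then have "w \<in> borel_measurable borel"
    unfolding w_def by (intro borel_measurable_continuous_onI) (simp add: case_prod_unfold)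
  then have wm: "w \<in> borel_measurable lebesgue" by (intro measurable_completion) simp
  have G: "integrable lebesgue G"
  proof (rule Bochner_Integration.integrable_bound)
    show "integrable lebesgue (\<lambda>p. bu * bv * norm (indicator D p *\<^sub>R (\<lambda>(x, y, z). K x y z) p))"
      using integrable_norm[OF KD] by (intro integrable_mult_right)
    show "G \<in> borel_measurable lebesgue"
      unfolding G_def using wm KD by (intro borel_measurable_times) auto
    have "norm (G p) \<le> bu * bv * norm (indicator D p *\<^sub>R (\<lambda>(x, y, z). K x y z) p)" for p
      unfolding G_def norm_mult by (intro mult_right_mono wb) auto
    then show "AE p in lebesgue. norm (G p) \<le> norm (bu * bv * norm (indicator D p *\<^sub>R (\<lambda>(x, y, z). K x y z) p))"
      unfolding real_norm_def by (intro AE_I2 order_trans[OF _ abs_ge_self])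
  qed
  have GK: "(\<lambda>w. G (x, w)) = (\<lambda>(y, z). K x y z * u y * v z)" if x: "x \<in> Q" for x
  proof
    fix p :: "(real ^ 'n) \<times> (real ^ 'n)"
    obtain y z where p: "p = (y, z)" by force
    show "G (x, p) = (\<lambda>(y, z). K x y z * u y * v z) p"
    proof (cases "u y = 0 \<or> v z = 0")
      case True
      then show ?thesis by (auto simp: G_def w_def p)
    next
      case False
      then have "(x, y, z) \<in> D" using x in_suppI[of u y] in_suppI[of v z] by (auto simp: D_def)
      then show ?thesis by (simp add: G_def w_def p)
    qed
  qed
  obtain H where H: "integrable lborel H" "AE p in lborel. G p = H p"
    using lebesgue_integrable_imp_lborel[OF G] by blast
  have H': "integrable (lborel \<Otimes>\<^sub>M lborel) H" using H(1) by (simp add: lborel_prod)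
  have "AE p in lborel \<Otimes>\<^sub>M lborel. G p = H p"
    unfolding lborel_prod by (rule H(2))
  then have ae1: "AE x in lborel. AE q in lborel. G (x, q) = H (x, q)"
    by (rule lborel_pair.AE_pair)
  have ae2: "AE x in lborel. integrable lborel (\<lambda>q. H (x, q))"
    using H' by (rule lborel_pair.AE_integrable_fst')
  have i3: "integrable lborel (\<lambda>x. \<integral>q. H (x, q) \<partial>lborel)"
    using H' by (rule lborel_pair.integrable_fst')
  have ae: "AE x in lborel. x \<in> Q \<longrightarrow> integrable lebesgue (\<lambda>(y, z). K x y z * u y * v z) \<and>
     (\<integral>(y, z). K x y z * u y * v z \<partial>lebesgue) = (\<integral>q. H (x, q) \<partial>lborel)"
    using ae1 ae2
  proof eventually_elim
    case (elim x)
    show ?case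
    proof (intro impI)
      assume x: "x \<in> Q"
      show "integrable lebesgue (\<lambda>(y, z). K x y z * u y * v z) \<and>
          (\<integral>(y, z). K x y z * u y * v z \<partial>lebesgue) = (\<integral>q. H (x, q) \<partial>lborel)"
        unfolding GK[OF x, symmetric] using lebesgue_integrable_cong_lborel[OF elim(2,1)] by (rule conjI)
    qed
  qed
  show "AE x in lebesgue. x \<in> Q \<longrightarrow> integrable lebesgue (\<lambda>(y, z). K x y z * u y * v z)"
    using AE_completion[OF ae] by (rule eventually_mono) blast
  have Qb: "Q \<in> sets borel" using Q by (simp add: compact_imp_closed)
  have "integrable lborel (\<lambda>x. indicator Q x *\<^sub>R (\<integral>q. H (x, q) \<partial>lborel))"
    using i3 Qb by (intro integrable_mult_indicator) auto
  then show "set_integrable lebesgue Q (\<lambda>x. \<integral>(y, z). K x y z * u y * v z \<partial>lebesgue)"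
    unfolding set_integrable_def
    by (rule lebesgue_integrable_cong_lborel(1), use ae in eventually_elim) (auto simp: indicator_def)
qed

section \<open>Weighted integrals by dyadic decomposition\<close>

lemma dyadic_scale:
  fixes t R :: real
  assumes "0 < R" "R \<le> t"
  obtains j :: nat where "2 ^ j * R \<le> t" "t < 2 ^ Suc j * R"
proof -
  obtain k where "t / R < 2 ^ k" using real_arch_pow[of 2 "t / R"] by auto
  then have k: "t < 2 ^ k * R" using assms by (simp add: divide_simps)
  define m where "m = (LEAST k. t < 2 ^ k * R)"
  have m: "t < 2 ^ m * R" unfolding m_def using k by (rule LeastI)
  have "m \<noteq> 0" using m assms by (cases m) auto
  then obtain j where j: "m = Suc j" by (cases m) auto
  have "\<not> t < 2 ^ j * R" using not_less_Least[of j "\<lambda>k. t < 2 ^ k * R"] j by (simp add: m_def)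
  then show ?thesis using that[of j] m j by simp
qed

text \<open>The sum of the geometric series of ratio 2 powr (- \<beta>), one term for each dyadic
  scale.\<close>

definition geom_const :: "real \<Rightarrow> real" where
  "geom_const \<beta> = 1 / (1 - 2 powr (- \<beta>))"

lemma geom_const_pos: "\<beta> > 0 \<Longrightarrow> geom_const \<beta> > 0"
  by (auto simp: geom_const_def powr_less_one)

text \<open>The space is cut according to the dyadic size 2 ^ j * R of
  \<open>max R (norm (x - y))\<close>. The part of index j lies in a cube of side 5 * 2 ^ j * R
  containing the given one, where \<open>avg\<close> applies. The weight contributes the power - (n
  + \<beta>) of 2 ^ j * R and the volume the power n, which leaves a geometric series.\<close>

lemma weighted_integral_le:
  fixes u :: "real ^ 'n \<Rightarrow> complex" and a x :: "real ^ 'n"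
  assumes u: "u \<in> borel_measurable borel" and l: "0 < l" "l \<le> R" and \<beta>: "0 < \<beta>" and M: "0 \<le> M"
    and x: "x \<in> cube a l"
    and avg: "\<And>b m. cube a l \<subseteq> cube b m \<Longrightarrow> 0 < m \<Longrightarrow>
      (\<integral>\<^sup>+y. ennreal (norm (u y)) * indicator (cube b m) y \<partial>lborel) \<le> ennreal (M * m ^ CARD('n))"
  shows "(\<integral>\<^sup>+y. ennreal (norm (u y) * max R (norm (x - y)) powr (- (real CARD('n) + \<beta>))) \<partial>lborel)
     \<le> ennreal (M * 5 ^ CARD('n) * R powr (- \<beta>) * geom_const \<beta>)"
proof -
  define n where "n = CARD('n)"
  \<comment> \<open>In units of 2 ^ j * R: in each coordinate y is within 2 of x, and x lies between
    a and a + l, where l is at most 1. Hence 2 units below a and 3 above it, a side of 5 in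
    all.\<close>
  define P where "P j = cube (a - (\<chi> i. 2 * (2 ^ j * R))) (5 * (2 ^ j * R))" for j :: nat
  define k where "k j = (2 ^ j * R) powr (- (real n + \<beta>))" for j :: nat
  have R: "R > 0" using l by simp
  have jR: "R \<le> 2 ^ j * R" for j :: nat using R by simp
  have sub: "cube a l \<subseteq> P j" for j
  proof
    fix y assume "y \<in> cube a l"
    then have "a $ i \<le> y $ i" "y $ i \<le> a $ i + l" for i by (auto simp: mem_cube)
    moreover have "l \<le> 2 ^ j * R" by (rule order_trans[OF l(2) jR])
    moreover have "0 \<le> 2 ^ j * R" using R by simp
    ultimately have "a $ i - 2 * (2 ^ j * R) \<le> y $ i" "y $ i \<le> a $ i + 3 * (2 ^ j * R)" for i
      by (smt (verit))+
    then show "y \<in> P j" unfolding P_def mem_cube by (simp add: algebra_simps)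
  qed
  have pt: "ennreal (norm (u y) * max R (norm (x - y)) powr (- (real n + \<beta>)))
      \<le> (\<Sum>j. ennreal (k j) * (ennreal (norm (u y)) * indicator (P j) y))" for y
  proof -
    obtain j where j: "2 ^ j * R \<le> max R (norm (x - y))" "max R (norm (x - y)) < 2 ^ Suc j * R"
      using dyadic_scale[of R "max R (norm (x - y))"] R by auto
    have "y \<in> P j"
    proof -
      have "\<bar>x $ i - y $ i\<bar> \<le> 2 * (2 ^ j * R)" for i
        using component_le_norm_cart[of "x - y" i] j(2) by simp
      moreover have "a $ i \<le> x $ i" "x $ i \<le> a $ i + l" for i using x by (auto simp: mem_cube)
      moreover have "l \<le> 2 ^ j * R" by (rule order_trans[OF l(2) jR])
      ultimately have "a $ i - 2 * (2 ^ j * R) \<le> y $ i" "y $ i \<le> a $ i + 3 * (2 ^ j * R)" for i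
        by (smt (verit))+
      then show ?thesis unfolding P_def mem_cube by (simp add: algebra_simps)
    qed
    have "max R (norm (x - y)) powr (- (real n + \<beta>)) \<le> k j"
      unfolding k_def using j(1) R \<beta> by (intro powr_mono2') auto
    then have "ennreal (norm (u y) * max R (norm (x - y)) powr (- (real n + \<beta>))) \<le>
        ennreal (k j) * (ennreal (norm (u y)) * indicator (P j) y)"
      using \<open>y \<in> P j\<close> by (simp flip: ennreal_mult' add: k_def mult.commute ennreal_leI mult_left_mono)
    also have "\<dots> \<le> (\<Sum>j. ennreal (k j) * (ennreal (norm (u y)) * indicator (P j) y))"
      using sum_le_suminf[of "\<lambda>j. ennreal (k j) * (ennreal (norm (u y)) * indicator (P j) y)" "{j}"] by simp
    finally show ?thesis .
  qed
  have "(\<integral>\<^sup>+y. ennreal (norm (u y) * max R (norm (x - y)) powr (- (real n + \<beta>))) \<partial>lborel)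
      \<le> (\<integral>\<^sup>+y. (\<Sum>j. ennreal (k j) * (ennreal (norm (u y)) * indicator (P j) y)) \<partial>lborel)"
    by (intro nn_integral_mono pt)
  also have "\<dots> = (\<Sum>j. \<integral>\<^sup>+y. ennreal (k j) * (ennreal (norm (u y)) * indicator (P j) y) \<partial>lborel)"
    using u by (intro nn_integral_suminf) (auto simp: P_def)
  also have "\<dots> = (\<Sum>j. ennreal (k j) * (\<integral>\<^sup>+y. ennreal (norm (u y)) * indicator (P j) y \<partial>lborel))"
    using u by (intro suminf_cong nn_integral_cmult) (auto simp: P_def)
  also have "\<dots> \<le> (\<Sum>j. ennreal (M * 5 ^ n * R powr (- \<beta>) * (2 powr (- \<beta>)) ^ j))"
  proof (intro suminf_le)
    fix j
    have "(\<integral>\<^sup>+y. ennreal (norm (u y)) * indicator (P j) y \<partial>lborel) \<le> ennreal (M * (5 * (2 ^ j * R)) ^ n)"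
      unfolding n_def P_def using R sub[of j] by (intro avg) (auto simp: P_def)
    then have "ennreal (k j) * (\<integral>\<^sup>+y. ennreal (norm (u y)) * indicator (P j) y \<partial>lborel)
        \<le> ennreal (k j) * ennreal (M * (5 * (2 ^ j * R)) ^ n)" by (rule mult_left_mono) simp
    also have "\<dots> = ennreal (k j * (M * (5 * (2 ^ j * R)) ^ n))"
      using M R by (intro ennreal_mult[symmetric]) (auto simp: k_def)
    also have "k j * (M * (5 * (2 ^ j * R)) ^ n) = M * 5 ^ n * R powr (- \<beta>) * (2 powr (- \<beta>)) ^ j"
    proof -
      have p: "2 ^ j * R > 0" using R by simp
      have "k j * (2 ^ j * R) ^ n = (2 ^ j * R) powr (- \<beta>)"
        using p unfolding k_def by (subst powr_realpow[symmetric]) (simp_all flip: powr_add)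
      also have "\<dots> = (2 ^ j) powr (- \<beta>) * R powr (- \<beta>)" using R by (simp add: powr_mult)
      also have "((2::real) ^ j) powr (- \<beta>) = (2 powr (- \<beta>)) ^ j"
        by (simp add: powr_powr powr_power flip: powr_realpow) (simp add: mult.commute)
      finally have "k j * (2 ^ j * R) ^ n = (2 powr (- \<beta>)) ^ j * R powr (- \<beta>)" .
      moreover have "k j * (M * (5 * (2 ^ j * R)) ^ n) = M * 5 ^ n * (k j * (2 ^ j * R) ^ n)"
        unfolding power_mult_distrib[of 5 "2 ^ j * R"] by simp
      ultimately show ?thesis by simp
    qed
    finally show "ennreal (k j) * (\<integral>\<^sup>+y. ennreal (norm (u y)) * indicator (P j) y \<partial>lborel)
      \<le> ennreal (M * 5 ^ n * R powr (- \<beta>) * (2 powr (- \<beta>)) ^ j)" .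
  qed auto
  also have "\<dots> = ennreal (M * 5 ^ n * R powr (- \<beta>) * geom_const \<beta>)"
  proof (rule suminf_ennreal_eq)
    have "\<bar>2 powr (- \<beta>)\<bar> < 1" using \<beta> by (simp add: powr_less_one)
    then show "(\<lambda>j. M * 5 ^ n * R powr (- \<beta>) * (2 powr (- \<beta>)) ^ j) sums (M * 5 ^ n * R powr (- \<beta>) * geom_const \<beta>)"
      unfolding geom_const_def by (intro sums_mult geometric_sums) simp
  qed (use M in auto)
  finally show ?thesis by (simp add: n_def)
qed

section \<open>Distances in cubes and the oscillation of kernel integrals\<close>

lemma norm_diff_le_of_mem_cube:
  fixes x :: "real ^ 'n"
  assumes "x \<in> cube a l" "y \<in> cube a l"
  shows "norm (x - y) \<le> real CARD('n) * l"
proof -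
  have "norm (x - y) \<le> (\<Sum>i\<in>UNIV. \<bar>(x - y) $ i\<bar>)" by (rule norm_le_l1_cart)
  also have "\<dots> \<le> (\<Sum>i\<in>(UNIV::'n set). l)"
  proof (rule sum_mono)
    fix i
    have "a $ i \<le> x $ i" "x $ i \<le> a $ i + l" "a $ i \<le> y $ i" "y $ i \<le> a $ i + l"
      using assms by (auto simp: mem_cube)
    then show "\<bar>(x - y) $ i\<bar> \<le> l" by (simp add: abs_le_iff)
  qed
  finally show ?thesis by simp
qed

lemma norm_ge_outside_enlarged_cube:
  fixes x y :: "real ^ 'n"
  assumes x: "x \<in> cube a l" and y: "y \<notin> cube (a - (\<chi> i. R)) (l + 2 * R)"
  shows "R \<le> norm (x - y)"
proof -
  obtain i where i: "\<not> (a $ i - R \<le> y $ i \<and> y $ i \<le> a $ i - R + (l + 2 * R))"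
    using y by (auto simp: mem_cube)
  have "a $ i \<le> x $ i" "x $ i \<le> a $ i + l" using x by (auto simp: mem_cube)
  then have "R \<le> \<bar>(x - y) $ i\<bar>" using i by (auto simp: abs_if)
  then show ?thesis using component_le_norm_cart[of "x - y" i] by linarith
qed

lemma cube_subset_enlarged: "0 \<le> R \<Longrightarrow> cube a l \<subseteq> cube (a - (\<chi> i. R)) (l + 2 * R)"
  by (auto simp: mem_cube) (smt (verit))+

text \<open>Where the integrand does not vanish, y or z lies outside the enlarged cube, so R is at
  most the sum of the two distances. This brings x and x' under the hypothesis on K and allows both
  distances to be truncated from below at R. The truncation matters for the argument that is not
  separated, whose variable may come arbitrarily close to x. Half of \<sigma> goes to each variable,
  so that both weights are integrable at infinity.\<close>

lemma kernel_oscillation: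
  fixes K :: "real ^ 'n \<Rightarrow> real ^ 'n \<Rightarrow> real ^ 'n \<Rightarrow> complex"
  assumes C: "0 < C" and \<sigma>: "0 < \<sigma>"
    and K: "\<And>x x' y z. (x, y, z) \<notin> diag3 \<Longrightarrow> (x', y, z) \<notin> diag3 \<Longrightarrow>
           norm (x - x') powr \<epsilon> \<le> c * (norm (x - y) + norm (x - z)) \<Longrightarrow>
           norm (K x y z - K x' y z) \<le>
             C * (norm (x - x') powr s / (norm (x - y) + norm (x - z)) powr (2 * real CARD('n) + \<sigma>))"
    and c: "0 < c" and l: "0 < l" "l \<le> R"
    and u: "u \<in> test_functions" and v: "v \<in> test_functions"
    and off: "supp u \<inter> cube (a - (\<chi> i. R)) (l + 2 * R) = {} \<or> supp v \<inter> cube (a - (\<chi> i. R)) (l + 2 * R) = {}"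
    and M: "0 \<le> M" "0 \<le> N"
    and uM: "\<And>b m. cube a l \<subseteq> cube b m \<Longrightarrow> 0 < m \<Longrightarrow>
      (\<integral>\<^sup>+y. ennreal (norm (u y)) * indicator (cube b m) y \<partial>lborel) \<le> ennreal (M * m ^ CARD('n))"
    and vN: "\<And>b m. cube a l \<subseteq> cube b m \<Longrightarrow> 0 < m \<Longrightarrow>
      (\<integral>\<^sup>+y. ennreal (norm (v y)) * indicator (cube b m) y \<partial>lborel) \<le> ennreal (N * m ^ CARD('n))"
    and x: "x \<in> cube a l" "x' \<in> cube a l" and xx': "norm (x - x') powr \<epsilon> \<le> c * R"
    and int: "integrable lebesgue (\<lambda>(y, z). K x y z * u y * v z)"
      "integrable lebesgue (\<lambda>(y, z). K x' y z * u y * v z)"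
  shows "norm ((\<integral>(y, z). K x y z * u y * v z \<partial>lebesgue) - (\<integral>(y, z). K x' y z * u y * v z \<partial>lebesgue))
    \<le> C * norm (x - x') powr s * (M * 5 ^ CARD('n) * R powr (- (\<sigma> / 2)) * geom_const (\<sigma> / 2))
        * (N * 5 ^ CARD('n) * R powr (- (\<sigma> / 2)) * geom_const (\<sigma> / 2))"
proof -
  define \<beta> where "\<beta> = \<sigma> / 2"
  define Q' where "Q' = cube (a - (\<chi> i. R)) (l + 2 * R)"
  (* t powr - (2n + sigma) <= w y * w z separates the two variables of integration. *)
  define w where "w y = max R (norm (x - y)) powr (- (real CARD('n) + \<beta>))" for y
  define k where "k = C * norm (x - x') powr s"
  define IM where "IM = M * 5 ^ CARD('n) * R powr (- \<beta>) * geom_const \<beta>"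
  define IN where "IN = N * 5 ^ CARD('n) * R powr (- \<beta>) * geom_const \<beta>"
  have \<beta>: "\<beta> > 0" using \<sigma> by (simp add: \<beta>_def)
  have R: "R > 0" using l by simp
  have k: "k \<ge> 0" using C by (simp add: k_def)
  have w: "w y \<ge> 0" for y by (simp add: w_def)
  have QQ': "cube a l \<subseteq> Q'" unfolding Q'_def using R by (intro cube_subset_enlarged) simp
  have pt: "norm (K x y z * u y * v z - K x' y z * u y * v z) \<le> k * (norm (u y) * w y) * (norm (v z) * w z)" for y z
  proof (cases "u y = 0 \<or> v z = 0")
    case True
    then show ?thesis by auto
  next
    case False
    then have yz: "y \<in> supp u" "z \<in> supp v" using in_suppI[of u y] in_suppI[of v z] by auto
    then have out: "y \<notin> Q' \<or> z \<notin> Q'" using off by (auto simp: Q'_def)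
    then have nd: "(x, y, z) \<notin> diag3" "(x', y, z) \<notin> diag3" using x QQ' by (auto simp: diag3_def)
    define t where "t = norm (x - y) + norm (x - z)"
    have tR: "R \<le> t"
    proof -
      have "R \<le> norm (x - y) \<or> R \<le> norm (x - z)"
        using out norm_ge_outside_enlarged_cube[OF x(1)] unfolding Q'_def by blast
      then show ?thesis
        using norm_ge_zero[of "x - y"] norm_ge_zero[of "x - z"] unfolding t_def by linarith
    qed
    then have "c * R \<le> c * t" using c by simp
    then have "norm (x - x') powr \<epsilon> \<le> c * t" using xx' by linarith
    then have Kle: "norm (K x y z - K x' y z) \<le> C * (norm (x - x') powr s / t powr (2 * real CARD('n) + \<sigma>))"
      using K[OF nd] by (simp add: t_def)
    have my: "max R (norm (x - y)) \<le> t" and mz: "max R (norm (x - z)) \<le> t"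
      using tR unfolding t_def by auto
    have "1 / t powr (2 * real CARD('n) + \<sigma>) = t powr (- (2 * real CARD('n) + \<sigma>))"
      by (rule powr_minus_divide[symmetric])
    also have "\<dots> = t powr (- (real CARD('n) + \<beta>)) * t powr (- (real CARD('n) + \<beta>))"
      by (simp add: \<beta>_def flip: powr_add)
    also have "\<dots> \<le> w y * w z"
      unfolding w_def using my mz R \<beta> by (intro mult_mono powr_mono2') auto
    finally have "k * (1 / t powr (2 * real CARD('n) + \<sigma>)) \<le> k * (w y * w z)"
      using k by (rule mult_left_mono)
    then have "C * (norm (x - x') powr s / t powr (2 * real CARD('n) + \<sigma>)) \<le> k * (w y * w z)"
      by (simp add: k_def)
    with Kle have Kw: "norm (K x y z - K x' y z) \<le> k * (w y * w z)" by linarith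
    have "norm (K x y z * u y * v z - K x' y z * u y * v z) = norm (K x y z - K x' y z) * (norm (u y) * norm (v z))"
      by (simp add: norm_mult flip: left_diff_distrib)
    also have "\<dots> \<le> k * (w y * w z) * (norm (u y) * norm (v z))"
      by (rule mult_right_mono[OF Kw]) simp
    finally show ?thesis by (simp add: mult_ac)
  qed
  have um: "u \<in> borel_measurable borel" and vm: "v \<in> borel_measurable borel"
    using u v test_functions_borel by auto
  have [measurable]: "(\<lambda>y. norm (u y) * w y) \<in> borel_measurable borel" "(\<lambda>y. norm (v y) * w y) \<in> borel_measurable borel"
    unfolding w_def using um vm by measurable
  have Iu: "(\<integral>\<^sup>+y. ennreal (norm (u y) * w y) \<partial>lborel) \<le> ennreal IM"
    unfolding w_def IM_def by (rule weighted_integral_le[OF um l \<beta> M(1) x(1) uM])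
  have Iv: "(\<integral>\<^sup>+y. ennreal (norm (v y) * w y) \<partial>lborel) \<le> ennreal IN"
    unfolding w_def IN_def by (rule weighted_integral_le[OF vm l \<beta> M(2) x(1) vN])
  have IMN: "IM \<ge> 0" "IN \<ge> 0" using M geom_const_pos[OF \<beta>] by (auto simp: IM_def IN_def)
  define g where "g p = (\<lambda>(y, z). K x y z * u y * v z) p - (\<lambda>(y, z). K x' y z * u y * v z) p" for p
  \<comment> \<open>Tonelli's theorem is applied only to the Borel majorant \<open>h\<close>, which
    factors into functions of y and z; \<open>g\<close> is compared with it under Lebesgue
    measure.\<close>
  define h where "h p = ennreal (k * (norm (u (fst p)) * w (fst p)) * (norm (v (snd p)) * w (snd p)))" for p
  have [measurable]: "h \<in> borel_measurable (lborel \<Otimes>\<^sub>M lborel)" unfolding h_def by measurable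
  have "ennreal (norm (\<integral>p. g p \<partial>lebesgue)) \<le> (\<integral>\<^sup>+p. ennreal (norm (g p)) \<partial>lebesgue)"
    unfolding g_def by (intro integral_norm_bound_ennreal Bochner_Integration.integrable_diff int)
  also have "\<dots> \<le> (\<integral>\<^sup>+p. h p \<partial>lebesgue)"
    unfolding h_def g_def using pt by (intro nn_integral_mono ennreal_leI) (simp add: case_prod_unfold)
  also have "\<dots> = (\<integral>\<^sup>+p. h p \<partial>(lborel \<Otimes>\<^sub>M lborel))"
    unfolding nn_integral_completion lborel_prod ..
  also have "\<dots> = (\<integral>\<^sup>+y. (\<integral>\<^sup>+z. h (y, z) \<partial>lborel) \<partial>lborel)"
    by (rule lborel.nn_integral_fst[symmetric]) measurable
  also have "\<dots> = (\<integral>\<^sup>+y. ennreal k * ennreal (norm (u y) * w y) * (\<integral>\<^sup>+z. ennreal (norm (v z) * w z) \<partial>lborel) \<partial>lborel)"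
  proof (intro nn_integral_cong)
    fix y
    have "h (y, z) = (ennreal k * ennreal (norm (u y) * w y)) * ennreal (norm (v z) * w z)" for z
      unfolding h_def using k w by (simp add: ennreal_mult'' ennreal_mult)
    then show "(\<integral>\<^sup>+z. h (y, z) \<partial>lborel) = ennreal k * ennreal (norm (u y) * w y) * (\<integral>\<^sup>+z. ennreal (norm (v z) * w z) \<partial>lborel)"
      by (simp add: nn_integral_cmult)
  qed
  also have "\<dots> = ennreal k * (\<integral>\<^sup>+y. ennreal (norm (u y) * w y) \<partial>lborel) * (\<integral>\<^sup>+z. ennreal (norm (v z) * w z) \<partial>lborel)"
    by (simp add: nn_integral_multc nn_integral_cmult)
  also have "\<dots> \<le> ennreal k * ennreal IM * ennreal IN"
    by (intro mult_mono Iu Iv) auto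
  also have "\<dots> = ennreal (k * IM * IN)" using k IMN by (simp add: ennreal_mult)
  finally have "norm (\<integral>p. g p \<partial>lebesgue) \<le> k * IM * IN" using k IMN by simp
  moreover have "(\<integral>p. g p \<partial>lebesgue) =
      (\<integral>(y, z). K x y z * u y * v z \<partial>lebesgue) - (\<integral>(y, z). K x' y z * u y * v z \<partial>lebesgue)"
    unfolding g_def using int by (rule Bochner_Integration.integral_diff)
  ultimately show ?thesis by (simp add: k_def IM_def IN_def \<beta>_def)
qed

section \<open>Separated supports\<close>

text \<open>The boundary of a cube is a null set, so what distributions give in the interior holds
  on the whole cube.\<close>

lemma AE_interior_cube:
  assumes "AE x in lebesgue. x \<in> interior (cube a l) \<longrightarrow> P x"
  shows "AE x in lebesgue. x \<in> cube a l \<longrightarrow> P x"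
proof -
  have "cube a l - interior (cube a l) \<in> null_sets lebesgue"
    unfolding cube_def interior_cbox by (intro negligible_iff_null_sets[THEN iffD1] negligible_frontier_interval)
  from AE_not_in[OF this] assms show ?thesis
    by eventually_elim auto
qed

text \<open>Carries the control of averages from u over to its approximant w. The error is allowed
  to be as large as the main term: the integral of |w|^2 over the cube is then at most 4 *
  \<alpha>^2 times the volume, which corresponds to an L^1 average of at most 2 * \<alpha>.\<close>

lemma nn_integral_norm_le_of_L2:
  fixes u w :: "real ^ 'n \<Rightarrow> complex"
  assumes u: "u \<in> Lp 2" and w: "w \<in> Lp 2" and wb: "w \<in> borel_measurable borel"
    and \<alpha>: "0 < \<alpha>" and m: "0 < m"
    and U: "(LINT x:cube b m|lebesgue. (norm (u x))\<^sup>2) \<le> \<alpha>\<^sup>2 * m ^ CARD('n)"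
    and d: "L2sq (\<lambda>x. u x - w x) \<le> \<alpha>\<^sup>2 * m ^ CARD('n)"
  shows "(\<integral>\<^sup>+y. ennreal (norm (w y)) * indicator (cube b m) y \<partial>lborel) \<le> ennreal (2 * \<alpha> * m ^ CARD('n))"
proof -
  define P where "P = cube b m"
  define V where "V = m ^ CARD('n)"
  have V: "measure lebesgue P = V" "V > 0" using m measure_cube[of m b] by (auto simp: P_def V_def)
  have fin: "emeasure lebesgue P < \<infinity>" unfolding P_def by (rule emeasure_cube_finite)
  have Pm: "P \<in> sets lebesgue" by (simp add: P_def)
  have uw: "(\<lambda>x. u x - w x) \<in> Lp 2" using u w by (rule Lp_2_diff)
  have iu: "integrable lebesgue (\<lambda>x. indicator P x *\<^sub>R (norm (u x))\<^sup>2)"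
    using u Pm by (intro integrable_mult_indicator) (auto simp: Lp_2_iff)
  have iw: "integrable lebesgue (\<lambda>x. indicator P x *\<^sub>R (norm (w x))\<^sup>2)"
    using w Pm by (intro integrable_mult_indicator) (auto simp: Lp_2_iff)
  have id: "integrable lebesgue (\<lambda>x. (norm (u x - w x))\<^sup>2)" using uw by (simp add: Lp_2_iff)
  have i1: "integrable lebesgue (\<lambda>x. indicator P x *\<^sub>R \<alpha>)" using fin Pm by simp
  have "(\<integral>x. indicator P x *\<^sub>R (norm (w x))\<^sup>2 \<partial>lebesgue)
      \<le> (\<integral>x. 2 * (indicator P x *\<^sub>R (norm (u x))\<^sup>2) + 2 * (norm (u x - w x))\<^sup>2 \<partial>lebesgue)"
  proof (rule integral_mono[OF iw])
    show "integrable lebesgue (\<lambda>x. 2 * (indicator P x *\<^sub>R (norm (u x))\<^sup>2) + 2 * (norm (u x - w x))\<^sup>2)"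
      using iu id by (intro Bochner_Integration.integrable_add integrable_mult_right)
    show "indicator P x *\<^sub>R (norm (w x))\<^sup>2 \<le> 2 * (indicator P x *\<^sub>R (norm (u x))\<^sup>2) + 2 * (norm (u x - w x))\<^sup>2" for x
      using norm_add_square_le[of "u x" "w x - u x"] by (auto simp: indicator_def norm_minus_commute)
  qed
  also have "\<dots> = 2 * (\<integral>x. indicator P x *\<^sub>R (norm (u x))\<^sup>2 \<partial>lebesgue) + 2 * L2sq (\<lambda>x. u x - w x)"
    unfolding L2sq_def using iu id by (subst Bochner_Integration.integral_add) auto
  also have "\<dots> \<le> 4 * \<alpha>\<^sup>2 * V"
    using U d unfolding set_lebesgue_integral_def P_def V_def by simp
  finally have W: "(\<integral>x. indicator P x *\<^sub>R (norm (w x))\<^sup>2 \<partial>lebesgue) \<le> 4 * \<alpha>\<^sup>2 * V" .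
  (* AM-GM instead of Cauchy-Schwarz: it turns the L^2 average into the L^1 average at the level alpha. *)
  have amgm: "t \<le> t\<^sup>2 / (4 * \<alpha>) + \<alpha>" for t
  proof -
    have "4 * \<alpha> * t \<le> t\<^sup>2 + 4 * \<alpha>\<^sup>2"
      using sum_squares_bound[of t "2 * \<alpha>"] by (simp add: power2_eq_square algebra_simps)
    then show ?thesis using \<alpha> by (simp add: field_simps power2_eq_square)
  qed
  define F where "F x = (1 / (4 * \<alpha>)) * (indicator P x *\<^sub>R (norm (w x))\<^sup>2) + indicator P x *\<^sub>R \<alpha>" for x
  have F: "integrable lebesgue F" "F x \<ge> 0" for x
    unfolding F_def using iw i1 \<alpha> by (auto intro!: Bochner_Integration.integrable_add integrable_mult_right)
  have "(\<integral>\<^sup>+y. ennreal (norm (w y)) * indicator P y \<partial>lborel) = (\<integral>\<^sup>+y. ennreal (norm (w y)) * indicator P y \<partial>lebesgue)"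
    unfolding nn_integral_completion ..
  also have "\<dots> \<le> (\<integral>\<^sup>+y. ennreal (F y) \<partial>lebesgue)"
    using amgm by (intro nn_integral_mono) (auto simp: F_def indicator_def intro!: ennreal_leI)
  also have "\<dots> = ennreal (\<integral>y. F y \<partial>lebesgue)"
    using F by (intro nn_integral_eq_integral) auto
  also have "(\<integral>y. F y \<partial>lebesgue) = (1 / (4 * \<alpha>)) * (\<integral>x. indicator P x *\<^sub>R (norm (w x))\<^sup>2 \<partial>lebesgue) + V * \<alpha>"
  proof -
    have "(\<integral>x. indicator P x *\<^sub>R \<alpha> \<partial>lebesgue) = V * \<alpha>" using V by simp
    moreover have "(\<integral>y. F y \<partial>lebesgue) =
        (\<integral>x. (1 / (4 * \<alpha>)) * (indicator P x *\<^sub>R (norm (w x))\<^sup>2) \<partial>lebesgue) + (\<integral>x. indicator P x *\<^sub>R \<alpha> \<partial>lebesgue)"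
      unfolding F_def using iw i1 by (intro Bochner_Integration.integral_add integrable_mult_right)
    ultimately show ?thesis by (simp only: integral_mult_right_zero)
  qed
  also have "ennreal \<dots> \<le> ennreal (2 * \<alpha> * V)"
  proof (rule ennreal_leI)
    have "(1 / (4 * \<alpha>)) * (\<integral>x. indicator P x *\<^sub>R (norm (w x))\<^sup>2 \<partial>lebesgue) \<le> (1 / (4 * \<alpha>)) * (4 * \<alpha>\<^sup>2 * V)"
      using \<alpha> by (intro mult_left_mono W) auto
    also have "\<dots> = V * \<alpha>" using \<alpha> by (simp add: power2_eq_square)
    finally show "(1 / (4 * \<alpha>)) * (\<integral>x. indicator P x *\<^sub>R (norm (w x))\<^sup>2 \<partial>lebesgue) + V * \<alpha> \<le> 2 * \<alpha> * V"
      by (simp add: mult.commute)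
  qed
  finally show ?thesis by (simp add: P_def V_def)
qed

lemma measure_cube_mono:
  fixes a b :: "real ^ 'n"
  assumes "cube a l \<subseteq> cube b m" "0 < l" "0 < m"
  shows "l ^ CARD('n) \<le> m ^ CARD('n)"
proof -
  have "measure lebesgue (cube a l) \<le> measure lebesgue (cube b m)"
    using assms emeasure_cube_finite[of b m] by (intro measure_mono_fmeasurable) (auto simp: fmeasurable_def)
  then show ?thesis
    unfolding measure_cube[OF less_imp_le[OF assms(2)]] measure_cube[OF less_imp_le[OF assms(3)]] .
qed

text \<open>The factor n powr s comes from the bound n * l for distances in the cube. Each of the
  two arguments contributes one factor under the square: 2 from its approximation by a test
  function, 5 ^ n from the cubes of side 5 * 2 ^ j * R, and the sum of the geometric series.\<close>

definition osc_const :: "real \<Rightarrow> real \<Rightarrow> real \<Rightarrow> nat \<Rightarrow> real" where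
  "osc_const C s \<sigma> n = C * real n powr s * (2 * 5 ^ n * geom_const (\<sigma> / 2))\<^sup>2"

text \<open>The separation is recorded by open sets S and S' outside which f and g vanish, because
  inside open sets the approximating test functions can be given the same separation. The pair of
  test functions then has a kernel representation on the cube.\<close>

lemma disjoint_pair_oscillation:
  fixes T :: "(real ^ 'n::finite \<Rightarrow> complex) \<Rightarrow> (real ^ 'n \<Rightarrow> complex) \<Rightarrow> 'n distribution"
    and K :: "real ^ 'n \<Rightarrow> real ^ 'n \<Rightarrow> real ^ 'n \<Rightarrow> complex"
  assumes T: "associated_kernel T K"
    and TU: "\<And>f g \<phi>. f \<in> schwartz \<Longrightarrow> g \<in> schwartz \<Longrightarrow> \<phi> \<in> schwartz \<Longrightarrow> T f g \<phi> = (\<integral>x. U f g x * \<phi> x \<partial>lebesgue)"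
    and U: "biadditive U" "cube_bound U (cube a l) B"
    and pos: "0 < C" "0 < \<epsilon>" "0 < s" "0 < c"
    and K: "\<And>x x' y z. (x, y, z) \<notin> diag3 \<Longrightarrow> (x', y, z) \<notin> diag3 \<Longrightarrow>
           norm (x - x') powr \<epsilon> \<le> c * (norm (x - y) + norm (x - z)) \<Longrightarrow>
           norm (K x y z - K x' y z) \<le>
             C * (norm (x - x') powr s / (norm (x - y) + norm (x - z)) powr (2 * real CARD('n) + s / \<epsilon>))"
    and l: "0 < l" "l \<le> R" and R: "l powr \<epsilon> \<le> R" "(real CARD('n) * l) powr \<epsilon> \<le> c * R"
    and S: "open S" "open S'" "S \<inter> cube (a - (\<chi> i. R)) (l + 2 * R) = {} \<or> S' \<inter> cube (a - (\<chi> i. R)) (l + 2 * R) = {}"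
    and f: "f \<in> Lp 2" "\<And>x. x \<notin> S \<Longrightarrow> f x = 0" and g: "g \<in> Lp 2" "\<And>x. x \<notin> S' \<Longrightarrow> g x = 0"
    and \<alpha>: "0 < \<alpha>" "\<And>b m. cube a l \<subseteq> cube b m \<Longrightarrow> 0 < m \<Longrightarrow>
        (LINT x:cube b m|lebesgue. (norm (f x))\<^sup>2) \<le> \<alpha>\<^sup>2 * m ^ CARD('n)"
    and \<gamma>: "0 < \<gamma>" "\<And>b m. cube a l \<subseteq> cube b m \<Longrightarrow> 0 < m \<Longrightarrow>
        (LINT x:cube b m|lebesgue. (norm (g x))\<^sup>2) \<le> \<gamma>\<^sup>2 * m ^ CARD('n)"
  obtains b where "(LINT x:cube a l|lebesgue. norm (U f g x - b)) \<le>
      l ^ CARD('n) * ((osc_const C s (s / \<epsilon>) CARD('n) + 1) * \<alpha> * \<gamma>)"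
proof -
  define Q where "Q = cube a l"
  define V where "V = l ^ CARD('n)"
  \<comment> \<open>The approximation may cost this much; it becomes the \<open>+ 1\<close> beside
    \<open>osc_const\<close> in the conclusion.\<close>
  define E where "E = V * (\<alpha> * \<gamma>)"
  have V: "V > 0" "measure lebesgue Q = V" using l measure_cube[of l a] by (auto simp: V_def Q_def)
  have E: "E > 0" using V \<alpha> \<gamma> by (simp add: E_def)
  have Qm: "Q \<in> sets lebesgue" by (simp add: Q_def)
  have fin: "emeasure lebesgue Q < \<infinity>" unfolding Q_def by (rule emeasure_cube_finite)
  obtain d where d: "d > 0" "\<And>u' v'. u' \<in> Lp 2 \<Longrightarrow> v' \<in> Lp 2 \<Longrightarrow> L2sq (\<lambda>x. f x - u' x) < d \<Longrightarrow>
    L2sq (\<lambda>x. g x - v' x) < d \<Longrightarrow> (LINT x:Q|lebesgue. norm (U f g x - U u' v' x)) < E"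
    using cube_bound_continuous[OF U(1) U(2)[folded Q_def] Qm f(1) g(1) E] by blast
  \<comment> \<open>\<open>d\<close> serves the continuity of U. The other two bounds make the
    errors admissible in \<open>nn_integral_norm_le_of_L2\<close> for every cube containing Q, since
    its volume is at least V.\<close>
  define d' where "d' = min d (min (\<alpha>\<^sup>2 * V) (\<gamma>\<^sup>2 * V))"
  have d': "d' > 0" using d V \<alpha>(1) \<gamma>(1) by (simp add: d'_def)
  obtain u where u: "u \<in> test_functions" "supp u \<subseteq> S" "L2sq (\<lambda>x. f x - u x) < d'"
    using test_functions_dense_L2[OF S(1) f] d' unfolding L2_approx_def by blast
  obtain v where v: "v \<in> test_functions" "supp v \<subseteq> S'" "L2sq (\<lambda>x. g x - v x) < d'"
    using test_functions_dense_L2[OF S(2) g] d' unfolding L2_approx_def by blast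
  note uL = test_functions_Lp_2[OF u(1)] and vL = test_functions_Lp_2[OF v(1)]
  have close: "(LINT x:Q|lebesgue. norm (U f g x - U u v x)) < E"
    using d(2)[OF uL vL] u(3) v(3) by (simp add: d'_def)
  have off: "supp u \<inter> cube (a - (\<chi> i. R)) (l + 2 * R) = {} \<or> supp v \<inter> cube (a - (\<chi> i. R)) (l + 2 * R) = {}"
    using S(3) u(2) v(2) by blast
  have QQ': "Q \<subseteq> cube (a - (\<chi> i. R)) (l + 2 * R)"
    unfolding Q_def using l by (intro cube_subset_enlarged) simp
  then have disj: "Q \<inter> supp u \<inter> supp v = {}" using off by blast
  define F where "F x = (\<integral>(y, z). K x y z * u y * v z \<partial>lebesgue)" for x
  have Kl: "locally_integrable_on (\<lambda>(x, y, z). K x y z) (- diag3)"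
    using T by (simp add: associated_kernel_def)
  have cQ: "compact Q" by (simp add: Q_def compact_cube)
  have Fint: "AE x in lebesgue. x \<in> Q \<longrightarrow> integrable lebesgue (\<lambda>(y, z). K x y z * u y * v z)"
    by (rule kernel_integrable(1)[OF Kl cQ u(1) v(1) disj])
  have FQ: "set_integrable lebesgue Q F"
    unfolding F_def by (rule kernel_integrable(2)[OF Kl cQ u(1) v(1) disj])
  have UQ: "set_integrable lebesgue Q (U p q)" if "p \<in> Lp 2" "q \<in> Lp 2" for p q
    using U(2) that by (auto simp: cube_bound_def Q_def)
  note UuvQ = UQ[OF uL vL]
  \<comment> \<open>Q misses \<open>supp u \<inter> supp v\<close>, so against test functions
    supported in Q the distribution \<open>T u v\<close> is given both by \<open>U u v\<close> and
    by the kernel integral \<open>F\<close>.\<close>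
  have "AE x in lebesgue. x \<in> interior Q \<longrightarrow> U u v x - F x = 0"
  proof (rule AE_zero_of_test_functions)
    show "set_integrable lebesgue (interior Q) (\<lambda>x. U u v x - F x)"
      using set_integral_diff(1)[OF UuvQ FQ] by (rule set_integrable_subset) (auto simp: interior_subset)
    fix \<phi> :: "real ^ 'n \<Rightarrow> complex" assume \<phi>: "\<phi> \<in> test_functions" "supp \<phi> \<subseteq> interior Q"
    have s: "supp \<phi> \<subseteq> Q" using \<phi>(2) interior_subset by blast
    then have "supp \<phi> \<subseteq> - (supp u \<inter> supp v)" using disj by blast
    then have "T u v \<phi> = (\<integral>x. F x * \<phi> x \<partial>lebesgue)"
      using T u(1) v(1) \<phi>(1) unfolding associated_kernel_def F_def by blast
    moreover have "T u v \<phi> = (\<integral>x. U u v x * \<phi> x \<partial>lebesgue)"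
      using u(1) v(1) \<phi>(1) test_functions_schwartz by (intro TU) auto
    ultimately show "(\<integral>x. (U u v x - F x) * \<phi> x \<partial>lebesgue) = 0"
      using set_integrable_mult_test_function[OF UuvQ \<phi>(1) s] set_integrable_mult_test_function[OF FQ \<phi>(1) s]
      by (simp add: left_diff_distrib)
  qed simp
  then have UF: "AE x in lebesgue. x \<in> Q \<longrightarrow> U u v x - F x = 0"
    unfolding Q_def by (rule AE_interior_cube)
  \<comment> \<open>The constant b will be \<open>F x0\<close>. Any point of Q where the kernel
    integrand is integrable will do; one exists because almost every point of Q qualifies and Q has
    positive measure.\<close>
  have "\<exists>x0\<in>Q. integrable lebesgue (\<lambda>(y, z). K x0 y z * u y * v z)"
  proof (rule ccontr)
    assume "\<not> ?thesis"
    then have "AE x in lebesgue. x \<notin> Q" using Fint by (auto elim: eventually_mono)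
    then have "Q \<in> null_sets lebesgue" using Qm AE_iff_null_sets by blast
    then have "measure lebesgue Q = 0" unfolding measure_def by (metis null_setsD1 enn2real_0)
    then show False using V by linarith
  qed
  then obtain x0 where x0: "x0 \<in> Q" "integrable lebesgue (\<lambda>(y, z). K x0 y z * u y * v z)" by blast
  define \<sigma> where "\<sigma> = s / \<epsilon>"
  define G where "G = 5 ^ CARD('n) * R powr (- (\<sigma> / 2)) * geom_const (\<sigma> / 2)"
  have \<sigma>: "\<sigma> > 0" using pos by (simp add: \<sigma>_def)
  have R0: "R > 0" using l by simp
  have G: "G > 0" using geom_const_pos[of "\<sigma> / 2"] \<sigma> R0 by (simp add: G_def)
  have mono: "\<alpha>\<^sup>2 * V \<le> \<alpha>\<^sup>2 * m ^ CARD('n)" "\<gamma>\<^sup>2 * V \<le> \<gamma>\<^sup>2 * m ^ CARD('n)"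
    if "cube a l \<subseteq> cube b m" "0 < m" for b :: "real ^ 'n" and m
    using measure_cube_mono[OF that(1) l(1) that(2)] by (auto simp: V_def intro: mult_left_mono)
  have osc: "norm (F x - F x0) \<le> osc_const C s \<sigma> CARD('n) * (\<alpha> * \<gamma>)"
    if x: "x \<in> Q" "integrable lebesgue (\<lambda>(y, z). K x y z * u y * v z)" for x
  proof -
    have dist: "norm (x - x0) \<le> real CARD('n) * l"
      using norm_diff_le_of_mem_cube[of x a l x0] x x0 by (simp add: Q_def)
    have "norm (x - x0) powr \<epsilon> \<le> (real CARD('n) * l) powr \<epsilon>"
      using dist pos by (intro powr_mono2) auto
    then have xx0: "norm (x - x0) powr \<epsilon> \<le> c * R" using R(2) by linarith
    have "norm (F x - F x0) \<le> C * norm (x - x0) powr s * (2 * \<alpha> * 5 ^ CARD('n) * R powr (- (\<sigma> / 2)) * geom_const (\<sigma> / 2))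
        * (2 * \<gamma> * 5 ^ CARD('n) * R powr (- (\<sigma> / 2)) * geom_const (\<sigma> / 2))"
      unfolding F_def
    proof (rule kernel_oscillation[OF pos(1) \<sigma> K[folded \<sigma>_def] pos(4) l u(1) v(1) off])
      show "(\<integral>\<^sup>+y. ennreal (norm (u y)) * indicator (cube b m) y \<partial>lborel) \<le> ennreal (2 * \<alpha> * m ^ CARD('n))"
        if "cube a l \<subseteq> cube b m" "0 < m" for b m
        using nn_integral_norm_le_of_L2[OF f(1) uL test_functions_borel[OF u(1)] \<alpha>(1) that(2) \<alpha>(2)[OF that]]
          mono(1)[OF that] u(3) by (simp add: d'_def)
      show "(\<integral>\<^sup>+y. ennreal (norm (v y)) * indicator (cube b m) y \<partial>lborel) \<le> ennreal (2 * \<gamma> * m ^ CARD('n))"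
        if "cube a l \<subseteq> cube b m" "0 < m" for b m
        using nn_integral_norm_le_of_L2[OF g(1) vL test_functions_borel[OF v(1)] \<gamma>(1) that(2) \<gamma>(2)[OF that]]
          mono(2)[OF that] v(3) by (simp add: d'_def)
    qed (use \<alpha>(1) \<gamma>(1) x x0 xx0 in \<open>simp_all add: Q_def\<close>)
    also have "\<dots> = C * norm (x - x0) powr s * R powr (- \<sigma>) * (2 * 5 ^ CARD('n) * geom_const (\<sigma> / 2))\<^sup>2 * (\<alpha> * \<gamma>)"
    proof -
      have "R powr (- \<sigma>) = R powr (- (\<sigma> / 2)) * R powr (- (\<sigma> / 2))" by (simp flip: powr_add)
      then show ?thesis by (simp add: power2_eq_square mult_ac)
    qed
    also have "\<dots> \<le> C * real CARD('n) powr s * (2 * 5 ^ CARD('n) * geom_const (\<sigma> / 2))\<^sup>2 * (\<alpha> * \<gamma>)"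
    proof -
      \<comment> \<open>Here l powr \<epsilon> \<le> R enters: as \<sigma> = s / \<epsilon>, the
        power R powr (- \<sigma>) is at most l powr (- s), which cancels l powr s and makes the
        bound independent of the scale.\<close>
      have "norm (x - x0) powr s * R powr (- \<sigma>) \<le> (real CARD('n) * l) powr s * (l powr \<epsilon>) powr (- \<sigma>)"
        using dist R(1) l pos \<sigma> by (intro mult_mono powr_mono2 powr_mono2') auto
      also have "\<dots> = real CARD('n) powr s * (l powr s * l powr (- s))"
        using pos l by (simp add: powr_mult powr_powr \<sigma>_def)
      also have "l powr s * l powr (- s) = 1" using l by (simp flip: powr_add)
      finally have le: "norm (x - x0) powr s * R powr (- \<sigma>) \<le> real CARD('n) powr s" by simp
      have "C * (norm (x - x0) powr s * R powr (- \<sigma>)) * (2 * 5 ^ CARD('n) * geom_const (\<sigma> / 2))\<^sup>2 * (\<alpha> * \<gamma>)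
        \<le> C * real CARD('n) powr s * (2 * 5 ^ CARD('n) * geom_const (\<sigma> / 2))\<^sup>2 * (\<alpha> * \<gamma>)"
        using le pos(1) \<alpha>(1) \<gamma>(1) by (intro mult_right_mono mult_left_mono) auto
      then show ?thesis by (simp add: mult_ac)
    qed
    finally show ?thesis by (simp add: osc_const_def)
  qed
  define D where "D = osc_const C s \<sigma> CARD('n) * (\<alpha> * \<gamma>)"
  have const: "set_integrable lebesgue Q (\<lambda>x. k)" for k :: "'b::{banach, second_countable_topology}"
    unfolding set_integrable_def using Qm fin by simp
  have near: "(LINT x:Q|lebesgue. norm (U u v x - F x0)) \<le> V * D"
  proof -
    have "(LINT x:Q|lebesgue. norm (U u v x - F x0)) \<le> (LINT x:Q|lebesgue. D)"
    proof (rule set_integral_mono_AE)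
      show "AE x\<in>Q in lebesgue. norm (U u v x - F x0) \<le> D"
        using UF Fint
      proof eventually_elim
        case (elim x)
        show ?case
        proof
          assume "x \<in> Q"
          then have "U u v x = F x" "norm (F x - F x0) \<le> D" using elim osc by (auto simp: D_def)
          then show "norm (U u v x - F x0) \<le> D" by simp
        qed
      qed
    qed (intro const set_integrable_norm set_integral_diff(1) UuvQ)+
    also have "\<dots> = V * D" using V Qm fin by (simp add: set_lebesgue_integral_def)
    finally show ?thesis .
  qed
  have "(LINT x:Q|lebesgue. norm (U f g x - F x0)) \<le>
      (LINT x:Q|lebesgue. norm (U f g x - U u v x)) + (LINT x:Q|lebesgue. norm (U u v x - F x0))"
  proof (rule set_integral_norm_triangle[OF Qm])
    show "AE x in lebesgue. norm (U f g x - F x0) \<le> norm (U f g x - U u v x) + norm (U u v x - F x0)"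
      by (intro AE_I2 norm_diff_triangle_le[of _ "U u v x" for x]) auto
  qed (intro const set_integral_diff(1) UQ uL vL f g)+
  also have "\<dots> \<le> E + V * D" using close near by simp
  also have "\<dots> = V * ((osc_const C s (s / \<epsilon>) CARD('n) + 1) * \<alpha> * \<gamma>)"
    by (simp add: E_def D_def \<sigma>_def algebra_simps)
  finally show ?thesis using that by (simp add: Q_def V_def)
qed

section \<open>The sharp maximal function\<close>

lemma Linf_c_Lp_2:
  fixes f :: "real ^ 'n \<Rightarrow> complex"
  assumes f: "f \<in> Linf_c"
  obtains B where "f \<in> Lp 2" "0 \<le> B" "\<And>x. norm (f x) \<le> B"
proof -
  obtain B where B: "\<And>x. norm (f x) \<le> B" using f unfolding Linf_c_def bounded_iff by auto
  then have B0: "0 \<le> B" using norm_ge_zero order_trans by blast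
  have fm: "f \<in> borel_measurable lebesgue" and c: "compact (supp f)" using f by (auto simp: Linf_c_def)
  have "emeasure lborel (supp f) < \<infinity>" using c by (intro emeasure_bounded_finite compact_imp_bounded)
  then have "emeasure lebesgue (supp f) < \<infinity>" by simp
  then have i: "integrable lebesgue (\<lambda>x. B\<^sup>2 * indicator (supp f) x)" by simp
  have "integrable lebesgue (\<lambda>x. (norm (f x))\<^sup>2)"
  proof (rule Bochner_Integration.integrable_bound[OF i])
    show "AE x in lebesgue. norm ((norm (f x))\<^sup>2) \<le> norm (B\<^sup>2 * indicator (supp f) x)"
    proof (rule AE_I2)
      fix x
      show "norm ((norm (f x))\<^sup>2) \<le> norm (B\<^sup>2 * indicator (supp f) x)"
      proof (cases "f x = 0")
        case False
        then have "x \<in> supp f" by (rule in_suppI)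
        then show ?thesis using power_mono[OF B[of x], of 2] by simp
      qed simp
    qed
  qed (use fm in auto)
  then have "f \<in> Lp 2" using fm by (simp add: Lp_2_iff)
  with B B0 that show ?thesis by blast
qed

lemma Lp_2_restrict:
  assumes f: "f \<in> Lp 2" and S: "S \<in> sets lebesgue"
  shows "(\<lambda>x. indicator S x * f x) \<in> Lp 2"
proof -
  have fm: "f \<in> borel_measurable lebesgue" and i: "integrable lebesgue (\<lambda>x. (norm (f x))\<^sup>2)"
    using f by (auto simp: Lp_2_iff)
  have "integrable lebesgue (\<lambda>x. indicator S x *\<^sub>R (norm (f x))\<^sup>2)"
    using i S by (intro integrable_mult_indicator)
  moreover have "indicator S x *\<^sub>R (norm (f x))\<^sup>2 = (norm (indicator S x * f x))\<^sup>2" for x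
    by (simp add: indicator_def)
  ultimately show ?thesis using fm S by (simp add: Lp_2_iff borel_measurable_times borel_measurable_indicator)
qed

text \<open>Boundedness of f makes the maximal function finite at x, so that the estimates can be
  carried out in the reals. They use it in the form of the third property, which covers all cubes
  containing x at once.\<close>

lemma maximal2_real:
  fixes f :: "real ^ 'n \<Rightarrow> complex"
  assumes f: "f \<in> Linf_c"
  obtains r where "0 \<le> r" "maximal2 f x = ennreal r"
    "\<And>b m. x \<in> cube b m \<Longrightarrow> 0 < m \<Longrightarrow> (LINT y:cube b m|lebesgue. (norm (f y))\<^sup>2) \<le> r\<^sup>2 * m ^ CARD('n)"
proof -
  obtain B where fL: "f \<in> Lp 2" and B: "0 \<le> B" "\<And>x. norm (f x) \<le> B" using Linf_c_Lp_2[OF f] by blast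
  define M where "M = maximal (\<lambda>y. complex_of_real ((norm (f y))\<^sup>2)) x"
  define J where "J Q = (\<integral>\<^sup>+y\<in>Q. ennreal ((norm (f y))\<^sup>2) \<partial>lebesgue)" for Q
  have M: "M = (SUP Q\<in>{Q \<in> cubes. x \<in> Q}. J Q / emeasure lebesgue Q)"
    by (simp add: M_def maximal_def J_def norm_power)
  have "J Q / emeasure lebesgue Q \<le> ennreal (B\<^sup>2)" if Qc: "Q \<in> cubes" for Q
  proof -
    obtain b m where Q: "Q = cube b m" "0 < m" using Qc unfolding cubes_eq by blast
    have "J Q \<le> (\<integral>\<^sup>+y. ennreal (B\<^sup>2) * indicator Q y \<partial>lebesgue)"
      unfolding J_def using B by (intro nn_integral_mono mult_right_mono ennreal_leI power_mono) auto
    also have "\<dots> = ennreal (B\<^sup>2) * emeasure lebesgue Q"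
      using Q by (intro nn_integral_cmult_indicator) auto
    finally have "J Q / emeasure lebesgue Q \<le> ennreal (B\<^sup>2) * emeasure lebesgue Q / emeasure lebesgue Q"
      by (rule divide_right_mono_ennreal)
    also have "\<dots> = ennreal (B\<^sup>2)"
      using Q emeasure_cube[of m b] by (simp add: ennreal_mult_divide_eq)
    finally show ?thesis .
  qed
  then have "M \<le> ennreal (B\<^sup>2)" unfolding M by (intro SUP_least) auto
  then have Mfin: "M \<noteq> \<infinity>" by (auto simp: top_unique)
  define r where "r = sqrt (enn2real M)"
  have r: "r \<ge> 0" "ennreal (r\<^sup>2) = M" using Mfin by (auto simp: r_def less_top)
  show ?thesis
  proof (rule that[OF r(1)])
    show "maximal2 f x = ennreal r"
      using Mfin by (simp add: maximal2_def ennreal_sqrt_def r_def M_def)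
    fix b :: "real ^ 'n" and m :: real assume b: "x \<in> cube b m" "0 < m"
    define Q where "Q = cube b m"
    have Q: "emeasure lebesgue Q = ennreal (m ^ CARD('n))" "Q \<in> sets lebesgue"
      using emeasure_cube[of m b] b by (auto simp: Q_def)
    have "J Q / emeasure lebesgue Q \<le> M"
      unfolding M using b by (intro SUP_upper) (auto simp: Q_def cubes_eq)
    then have "J Q / emeasure lebesgue Q * emeasure lebesgue Q \<le> M * emeasure lebesgue Q"
      by (rule mult_right_mono) simp
    moreover have "J Q / emeasure lebesgue Q * emeasure lebesgue Q = J Q"
      using Q b by (simp add: ennreal_divide_times ennreal_mult_divide_eq)
    ultimately have J: "J Q \<le> ennreal (r\<^sup>2 * m ^ CARD('n))"
      using r Q b by (simp add: ennreal_mult)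
    have i: "integrable lebesgue (\<lambda>y. indicator Q y *\<^sub>R (norm (f y))\<^sup>2)"
      using fL Q by (intro integrable_mult_indicator) (auto simp: Lp_2_iff)
    have "ennreal (LINT y:Q|lebesgue. (norm (f y))\<^sup>2) = (\<integral>\<^sup>+y. ennreal (indicator Q y *\<^sub>R (norm (f y))\<^sup>2) \<partial>lebesgue)"
      unfolding set_lebesgue_integral_def using i by (intro nn_integral_eq_integral[symmetric]) auto
    also have "\<dots> = J Q" unfolding J_def by (intro nn_integral_cong) (auto simp: indicator_def)
    finally have "ennreal (LINT y:Q|lebesgue. (norm (f y))\<^sup>2) \<le> ennreal (r\<^sup>2 * m ^ CARD('n))" using J by simp
    then show "(LINT y:cube b m|lebesgue. (norm (f y))\<^sup>2) \<le> r\<^sup>2 * m ^ CARD('n)"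
      using b by (simp add: Q_def)
  qed
qed

lemma set_integral_restrict_le:
  assumes f: "f \<in> Lp 2" and S: "S \<in> sets lebesgue" and P: "P \<in> sets lebesgue"
  shows "(LINT x:P|lebesgue. (norm (indicator S x * f x))\<^sup>2) \<le> (LINT x:P|lebesgue. (norm (f x))\<^sup>2)"
  unfolding set_lebesgue_integral_def
  using f Lp_2_restrict[OF f S] P
  by (intro integral_mono integrable_mult_indicator) (auto simp: Lp_2_iff indicator_def)

text \<open>The distance from b to the average of h is at most the mean of |h - b|. An arbitrary
  constant may therefore replace the average at the cost of a factor 2.\<close>

lemma mean_oscillation_le:
  fixes h :: "real ^ 'n \<Rightarrow> complex"
  assumes h: "set_integrable lebesgue (cube a l) h" and l: "0 < l"
    and X: "(LINT x:cube a l|lebesgue. norm (h x - b)) \<le> l ^ CARD('n) * X"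
  shows "(\<integral>\<^sup>+y\<in>cube a l. ennreal (norm (h y - average (cube a l) h)) \<partial>lebesgue) / emeasure lebesgue (cube a l)
    \<le> ennreal (2 * X)"
proof -
  define Q where "Q = cube a l"
  define V where "V = l ^ CARD('n)"
  define k where "k = average Q h"
  have V: "V > 0" "measure lebesgue Q = V" "emeasure lebesgue Q = ennreal V"
    using l measure_cube[of l a] emeasure_cube[of l a] by (auto simp: V_def Q_def)
  have Qm: "Q \<in> sets lebesgue" by (simp add: Q_def)
  have fin: "emeasure lebesgue Q < \<infinity>" unfolding Q_def by (rule emeasure_cube_finite)
  have const: "set_integrable lebesgue Q (\<lambda>x. z)" for z :: complex
    unfolding set_integrable_def using Qm fin by simp
  have constr: "set_integrable lebesgue Q (\<lambda>x. z)" for z :: real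
    unfolding set_integrable_def using Qm fin by simp
  have ih: "set_integrable lebesgue Q h" using h by (simp add: Q_def)
  have ib: "set_integrable lebesgue Q (\<lambda>x. h x - b)" by (intro set_integral_diff(1) ih const)
  have ik: "set_integrable lebesgue Q (\<lambda>x. h x - k)" by (intro set_integral_diff(1) ih const)
  have cint: "(LINT x:Q|lebesgue. z) = V *\<^sub>R z" for z :: complex
    using V Qm fin by (simp add: set_lebesgue_integral_def)
  have cintr: "(LINT x:Q|lebesgue. z) = V * z" for z :: real
    using V Qm fin by (simp add: set_lebesgue_integral_def)
  have "(LINT x:Q|lebesgue. h x - b) = V *\<^sub>R (k - b)"
  proof -
    have "(LINT x:Q|lebesgue. h x - b) = (LINT x:Q|lebesgue. h x) - V *\<^sub>R b"
      using set_integral_diff(2)[OF ih const[of b]] cint by simp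
    moreover have "(LINT x:Q|lebesgue. h x) = V *\<^sub>R k"
      using V by (simp add: k_def average_def scaleR_conv_of_real)
    ultimately show ?thesis by (simp add: scaleR_diff_right)
  qed
  then have "V * norm (k - b) = norm (LINT x:Q|lebesgue. h x - b)" using V by simp
  also have "\<dots> \<le> (LINT x:Q|lebesgue. norm (h x - b))"
    using ib unfolding set_lebesgue_integral_def set_integrable_def
    by (intro order_trans[OF integral_norm_bound]) simp
  finally have kb: "V * norm (b - k) \<le> V * X" using X by (simp add: Q_def V_def norm_minus_commute)
  have "(LINT x:Q|lebesgue. norm (h x - k)) \<le> (LINT x:Q|lebesgue. norm (h x - b)) + (LINT x:Q|lebesgue. norm (b - k))"
    by (rule set_integral_norm_triangle[OF Qm ib const ik])
      (intro AE_I2 norm_diff_triangle_le[of _ b], auto)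
  also have "\<dots> \<le> V * X + V * X"
    using X[folded Q_def V_def] kb by (intro add_mono) (simp_all only: cintr)
  finally have le: "(LINT x:Q|lebesgue. norm (h x - k)) \<le> V * (2 * X)" by simp
  have "(\<integral>\<^sup>+y\<in>Q. ennreal (norm (h y - k)) \<partial>lebesgue) = (\<integral>\<^sup>+y. ennreal (indicator Q y *\<^sub>R norm (h y - k)) \<partial>lebesgue)"
    by (intro nn_integral_cong) (auto simp: indicator_def)
  also have "\<dots> = ennreal (LINT x:Q|lebesgue. norm (h x - k))"
    unfolding set_lebesgue_integral_def using set_integrable_norm[OF ik]
    by (intro nn_integral_eq_integral) (auto simp: set_integrable_def)
  also have "\<dots> \<le> ennreal (V * (2 * X))" by (intro ennreal_leI le)
  finally have "(\<integral>\<^sup>+y\<in>Q. ennreal (norm (h y - k)) \<partial>lebesgue) / emeasure lebesgue Q \<le> ennreal (V * (2 * X)) / ennreal V"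
    unfolding V(3) by (rule divide_right_mono_ennreal)
  also have "\<dots> = ennreal (2 * X)"
  \<comment> \<open>For X < 0 both sides are 0, because \<open>ennreal\<close> sends negative
    numbers to 0.\<close>
  proof (cases "X \<ge> 0")
    case True
    then show ?thesis using V by (simp add: divide_ennreal)
  next
    case False
    then have "V * (2 * X) \<le> 0" using V by (simp add: mult_nonneg_nonpos)
    then show ?thesis using False by (simp add: ennreal_neg)
  qed
  finally show ?thesis by (simp add: Q_def k_def)
qed

text \<open>Lets each extension take over the constant of the other. The first premise provides the
  constant, the second the integrability of \<open>U' f g\<close>.\<close>

lemma cube_bound_cong:
  assumes U: "cube_bound U Q B" "cube_bound U' Q B'" and Q: "Q \<in> sets lebesgue"
    and ae: "\<And>f g. f \<in> Lp 2 \<Longrightarrow> g \<in> Lp 2 \<Longrightarrow> AE x in lebesgue. U f g x = U' f g x"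
  shows "cube_bound U' Q B"
proof -
  have "(LINT x:Q|lebesgue. norm (U f g x)) = (LINT x:Q|lebesgue. norm (U' f g x))"
    if "f \<in> Lp 2" "g \<in> Lp 2" for f g
    unfolding set_lebesgue_integral_def
  proof (rule integral_cong_AE)
    have "set_integrable lebesgue Q (U f g)" "set_integrable lebesgue Q (U' f g)"
      using U that by (auto simp: cube_bound_def)
    from this[THEN set_integrable_norm]
    show "(\<lambda>x. indicator Q x *\<^sub>R norm (U f g x)) \<in> borel_measurable lebesgue"
      "(\<lambda>x. indicator Q x *\<^sub>R norm (U' f g x)) \<in> borel_measurable lebesgue"
      by (auto simp: set_integrable_def)
    show "AE x in lebesgue. indicator Q x *\<^sub>R norm (U f g x) = indicator Q x *\<^sub>R norm (U' f g x)"
      using ae[OF that] by eventually_elim simp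
  qed
  then show ?thesis using U unfolding cube_bound_def by metis
qed

text \<open>Removes the margin d by which the values of M_2 are enlarged. They may be 0 at x,
  whereas the approximation by test functions needs positive bounds for the averages.\<close>

lemma ennreal_le_of_forall_pos:
  assumes "\<And>d. 0 < d \<Longrightarrow> y \<le> ennreal (D * (p + d) * (q + d))" and "0 \<le> D" "0 \<le> p" "0 \<le> q"
  shows "y \<le> ennreal D * ennreal p * ennreal q"
proof -
  have "((\<lambda>d. ennreal (D * (p + d) * (q + d))) \<longlongrightarrow> ennreal (D * (p + 0) * (q + 0))) (at_right 0)"
    by (intro tendsto_intros)
  then have "y \<le> ennreal (D * (p + 0) * (q + 0))"
    by (rule tendsto_lowerbound) (use assms(1) in \<open>auto simp: eventually_at_right_field intro!: exI[of _ 1]\<close>)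
  then show ?thesis using assms by (simp add: ennreal_mult)
qed

section \<open>The estimate on a single cube\<close>

lemma sharp_bound_on_cube:
  fixes T :: "(real ^ 'n::finite \<Rightarrow> complex) \<Rightarrow> (real ^ 'n \<Rightarrow> complex) \<Rightarrow> 'n distribution"
    and K :: "real ^ 'n \<Rightarrow> real ^ 'n \<Rightarrow> real ^ 'n \<Rightarrow> complex"
  assumes T: "associated_kernel T K"
    and TU: "\<And>f g \<phi>. f \<in> schwartz \<Longrightarrow> g \<in> schwartz \<Longrightarrow> \<phi> \<in> schwartz \<Longrightarrow> T f g \<phi> = (\<integral>x. U f g x * \<phi> x \<partial>lebesgue)"
    and U: "biadditive U"
      "\<And>a l. 0 < l \<Longrightarrow> cube_bound U (cube a l) A"
      "\<And>a l. 0 < l \<Longrightarrow> cube_bound U (cube a l) (A * (l ^ CARD('n)) powr (1 - \<epsilon>))"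
    and pos: "0 < C" "0 < \<epsilon>" "\<epsilon> < 1" "0 < s" "0 < c"
    and K: "\<And>x x' y z. (x, y, z) \<notin> diag3 \<Longrightarrow> (x', y, z) \<notin> diag3 \<Longrightarrow>
           norm (x - x') powr \<epsilon> \<le> c * (norm (x - y) + norm (x - z)) \<Longrightarrow>
           norm (K x y z - K x' y z) \<le>
             C * (norm (x - x') powr s / (norm (x - y) + norm (x - z)) powr (2 * real CARD('n) + s / \<epsilon>))"
    and l: "0 < l"
    and f: "f \<in> Lp 2" and g: "g \<in> Lp 2"
    and \<alpha>: "0 < \<alpha>" "\<And>b m. cube a l \<subseteq> cube b m \<Longrightarrow> 0 < m \<Longrightarrow>
        (LINT x:cube b m|lebesgue. (norm (f x))\<^sup>2) \<le> \<alpha>\<^sup>2 * m ^ CARD('n)"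
    and \<gamma>: "0 < \<gamma>" "\<And>b m. cube a l \<subseteq> cube b m \<Longrightarrow> 0 < m \<Longrightarrow>
        (LINT x:cube b m|lebesgue. (norm (g x))\<^sup>2) \<le> \<gamma>\<^sup>2 * m ^ CARD('n)"
  shows "(\<integral>\<^sup>+y\<in>cube a l. ennreal (norm (U f g y - average (cube a l) (U f g))) \<partial>lebesgue) / emeasure lebesgue (cube a l)
    \<le> ennreal (2 * (A * (3 * (1 + real CARD('n) / c)) ^ CARD('n) + 2 * (osc_const C s (s / \<epsilon>) CARD('n) + 1)) * \<alpha> * \<gamma>)"
proof -
  define n where "n = CARD('n)"
  have n: "n \<ge> 1" by (simp add: n_def Suc_leI)
  \<comment> \<open>The summand 1 gives l \<le> R and l powr \<epsilon> \<le> R. The summand n / c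
    gives (n * l) powr \<epsilon> \<le> n * l powr \<epsilon> \<le> c * R, where n powr \<epsilon>
    \<le> n because n \<ge> 1 and \<epsilon> < 1.\<close>
  define \<kappa> where "\<kappa> = 1 + real n / c"
  define R where "R = \<kappa> * max l (l powr \<epsilon>)"
  define Q where "Q = cube a l"
  define Q' where "Q' = cube (a - (\<chi> i. R)) (l + 2 * R)"
  define V where "V = l ^ n"
  define O' where "O' = osc_const C s (s / \<epsilon>) CARD('n) + 1"
  have \<kappa>: "\<kappa> \<ge> 1" "c * \<kappa> \<ge> real n" using pos by (auto simp: \<kappa>_def field_simps)
  have mx: "max l (l powr \<epsilon>) > 0" using l by simp
  have "max l (l powr \<epsilon>) \<le> R"
    unfolding R_def using mult_right_mono[OF \<kappa>(1), of "max l (l powr \<epsilon>)"] mx by linarith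
  then have lR: "l \<le> R" and R1: "l powr \<epsilon> \<le> R" by auto
  have R2: "(real CARD('n) * l) powr \<epsilon> \<le> c * R"
  proof -
    have "(real n * l) powr \<epsilon> = real n powr \<epsilon> * l powr \<epsilon>" using l by (simp add: powr_mult)
    also have "\<dots> \<le> real n * l powr \<epsilon>"
    proof -
      have "real n powr \<epsilon> \<le> real n powr 1" using n pos by (intro powr_mono) auto
      then show ?thesis by (intro mult_right_mono) auto
    qed
    also have "\<dots> \<le> (c * \<kappa>) * max l (l powr \<epsilon>)" using \<kappa> n by (intro mult_mono) auto
    finally show ?thesis by (simp add: R_def n_def mult.assoc)
  qed
  have side: "l + 2 * R > 0" "l + 2 * R \<le> 3 * R" using l lR by auto
  have QQ': "Q \<subseteq> Q'" unfolding Q_def Q'_def using l lR by (intro cube_subset_enlarged) simp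
  have Qm: "Q \<in> sets lebesgue" "Q' \<in> sets lebesgue" "- Q' \<in> sets lebesgue"
    by (auto simp: Q_def Q'_def intro: sets.compl_sets[of _ lebesgue, simplified])
  have oQ: "open (- Q')" unfolding Q'_def using compact_cube by (intro open_Compl compact_imp_closed)
  define f0 where "f0 x = indicator Q' x * f x" for x
  define f1 where "f1 x = indicator (- Q') x * f x" for x
  define g0 where "g0 x = indicator Q' x * g x" for x
  define g1 where "g1 x = indicator (- Q') x * g x" for x
  have L: "f0 \<in> Lp 2" "f1 \<in> Lp 2" "g0 \<in> Lp 2" "g1 \<in> Lp 2"
    unfolding f0_def f1_def g0_def g1_def using f g Qm by (auto intro: Lp_2_restrict)
  have feq: "(\<lambda>x. f0 x + f1 x) = f" and geq: "(\<lambda>x. g0 x + g1 x) = g"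
    by (auto simp: f0_def f1_def g0_def g1_def indicator_def fun_eq_iff)
  have UL: "set_integrable lebesgue Q (U p q)" if "p \<in> Lp 2" "q \<in> Lp 2" for p q
    using U(2)[OF l, of a] that by (auto simp: cube_bound_def Q_def)
  have \<alpha>r: "(LINT x:cube b m|lebesgue. (norm (indicator S x * f x))\<^sup>2) \<le> \<alpha>\<^sup>2 * m ^ CARD('n)"
    if "cube a l \<subseteq> cube b m" "0 < m" "S \<in> sets lebesgue" for b m S
    using set_integral_restrict_le[OF f that(3) cube_sets[of b m]] \<alpha>(2)[OF that(1,2)] by linarith
  have \<gamma>r: "(LINT x:cube b m|lebesgue. (norm (indicator S x * g x))\<^sup>2) \<le> \<gamma>\<^sup>2 * m ^ CARD('n)"
    if "cube a l \<subseteq> cube b m" "0 < m" "S \<in> sets lebesgue" for b m S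
    using set_integral_restrict_le[OF g that(3) cube_sets[of b m]] \<gamma>(2)[OF that(1,2)] by linarith
  have osc: "\<exists>b. (LINT x:Q|lebesgue. norm (U p q x - b)) \<le> V * (O' * \<alpha> * \<gamma>)"
    if pq: "open S" "open S'" "S \<inter> Q' = {} \<or> S' \<inter> Q' = {}" "p \<in> Lp 2" "\<And>x. x \<notin> S \<Longrightarrow> p x = 0"
      "q \<in> Lp 2" "\<And>x. x \<notin> S' \<Longrightarrow> q x = 0"
      "\<And>b m. cube a l \<subseteq> cube b m \<Longrightarrow> 0 < m \<Longrightarrow> (LINT x:cube b m|lebesgue. (norm (p x))\<^sup>2) \<le> \<alpha>\<^sup>2 * m ^ CARD('n)"
      "\<And>b m. cube a l \<subseteq> cube b m \<Longrightarrow> 0 < m \<Longrightarrow> (LINT x:cube b m|lebesgue. (norm (q x))\<^sup>2) \<le> \<gamma>\<^sup>2 * m ^ CARD('n)"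
    for S S' p q
  proof -
    obtain b where "(LINT x:cube a l|lebesgue. norm (U p q x - b)) \<le>
      l ^ CARD('n) * ((osc_const C s (s / \<epsilon>) CARD('n) + 1) * \<alpha> * \<gamma>)"
      by (rule disjoint_pair_oscillation[OF T TU U(1) U(2)[OF l] pos(1,2,4,5) K l lR R1 R2
          pq(1,2) pq(3)[unfolded Q'_def] pq(4-7) \<alpha>(1) pq(8) \<gamma>(1) pq(9)])
    then show ?thesis unfolding Q_def V_def O'_def n_def by blast
  qed
  \<comment> \<open>The separation of one argument suffices. Here it comes from g1 alone, and f0,
    which lives on the closed cube Q', gets the open set UNIV. For the same reason f1 can be paired
    with all of g, so that three terms are enough instead of four.\<close>
  have "\<exists>b. (LINT x:Q|lebesgue. norm (U f0 g1 x - b)) \<le> V * (O' * \<alpha> * \<gamma>)"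
  proof (rule osc[of UNIV "- Q'"])
    show "f0 \<in> Lp 2" "g1 \<in> Lp 2" by (fact L)+
    show "\<And>x. x \<notin> - Q' \<Longrightarrow> g1 x = 0" by (simp add: g1_def)
  qed (use oQ Qm in \<open>simp_all add: f0_def g1_def \<alpha>r \<gamma>r\<close>)
  then obtain b1 where b1: "(LINT x:Q|lebesgue. norm (U f0 g1 x - b1)) \<le> V * (O' * \<alpha> * \<gamma>)" ..
  have "\<exists>b. (LINT x:Q|lebesgue. norm (U f1 g x - b)) \<le> V * (O' * \<alpha> * \<gamma>)"
  proof (rule osc[of "- Q'" UNIV])
    show "f1 \<in> Lp 2" "g \<in> Lp 2" by (fact L g)+
    show "\<And>x. x \<notin> - Q' \<Longrightarrow> f1 x = 0" by (simp add: f1_def)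
  qed (use oQ Qm \<gamma>(2) in \<open>simp_all add: f1_def \<alpha>r\<close>)
  then obtain b2 where b2: "(LINT x:Q|lebesgue. norm (U f1 g x - b2)) \<le> V * (O' * \<alpha> * \<gamma>)" ..
  have V: "V > 0" using l by (simp add: V_def)
  have A: "A \<ge> 0" using U(2)[OF l, of a] by (simp add: cube_bound_def)
  have loc: "(LINT x:Q|lebesgue. norm (U f0 g0 x)) \<le> V * (A * (3 * \<kappa>) ^ n * \<alpha> * \<gamma>)"
  proof -
    \<comment> \<open>W dominates the volume of Q'. Each argument contributes its constant times
      sqrt W, so a bound B for U on Q gives B * W * \<alpha> * \<gamma>, and B * W has to be
      compared with V.\<close>
    define W where "W = (3 * R) ^ n"
    have W0: "W \<ge> 0" using l lR by (simp add: W_def)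
    have Wle: "(l + 2 * R) ^ n \<le> W" unfolding W_def using side by (intro power_mono) auto
    have restr: "L2sq (\<lambda>x. indicator Q' x * h x) = (LINT x:Q'|lebesgue. (norm (h x))\<^sup>2)" for h :: "real ^ 'n \<Rightarrow> complex"
      unfolding L2sq_def set_lebesgue_integral_def
      by (intro Bochner_Integration.integral_cong) (auto simp: indicator_def)
    have sub: "cube a l \<subseteq> cube (a - (\<chi> i. R)) (l + 2 * R)" using QQ' by (simp add: Q_def Q'_def)
    have "L2sq f0 \<le> \<alpha>\<^sup>2 * (l + 2 * R) ^ n"
      using \<alpha>(2)[OF sub side(1)] unfolding f0_def restr by (simp add: Q'_def n_def)
    also have "\<dots> \<le> \<alpha>\<^sup>2 * W" using Wle by (intro mult_left_mono) auto
    finally have "sqrt (L2sq f0) \<le> sqrt (\<alpha>\<^sup>2 * W)" by simp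
    then have sf: "sqrt (L2sq f0) \<le> \<alpha> * sqrt W" using \<alpha>(1) by (simp add: real_sqrt_mult)
    have "L2sq g0 \<le> \<gamma>\<^sup>2 * (l + 2 * R) ^ n"
      using \<gamma>(2)[OF sub side(1)] unfolding g0_def restr by (simp add: Q'_def n_def)
    also have "\<dots> \<le> \<gamma>\<^sup>2 * W" using Wle by (intro mult_left_mono) auto
    finally have "sqrt (L2sq g0) \<le> sqrt (\<gamma>\<^sup>2 * W)" by simp
    then have sg: "sqrt (L2sq g0) \<le> \<gamma> * sqrt W" using \<gamma>(1) by (simp add: real_sqrt_mult)
    have "sqrt (L2sq f0) * sqrt (L2sq g0) \<le> (\<alpha> * sqrt W) * (\<gamma> * sqrt W)"
      using sf sg \<alpha>(1) W0 by (intro mult_mono) (auto simp: L2sq_nonneg)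
    also have "\<dots> = \<alpha> * \<gamma> * W" using W0 by simp
    finally have fg: "sqrt (L2sq f0) * sqrt (L2sq g0) \<le> \<alpha> * \<gamma> * W" .
    have bound: "(LINT x:Q|lebesgue. norm (U f0 g0 x)) \<le> B * (\<alpha> * \<gamma> * W)" if "cube_bound U Q B" for B
    proof -
      have B: "0 \<le> B" "(LINT x:Q|lebesgue. norm (U f0 g0 x)) \<le> B * (sqrt (L2sq f0) * sqrt (L2sq g0))"
        using that L by (auto simp: cube_bound_def mult.assoc)
      then show ?thesis using mult_left_mono[OF fg B(1)] by linarith
    qed
    show ?thesis
    proof (cases "1 \<le> l")
      case True
      then have "l powr \<epsilon> \<le> l powr 1" using pos by (intro powr_mono) auto
      then have "W = (3 * \<kappa>) ^ n * V" using l by (simp add: W_def R_def V_def max_def power_mult_distrib)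
      then show ?thesis using bound[of A] U(2)[OF l, of a] by (simp add: Q_def mult_ac)
    next
      case False
      then have "l powr 1 \<le> l powr \<epsilon>" using pos l by (intro powr_mono') auto
      then have "R = \<kappa> * l powr \<epsilon>" using l by (auto simp: R_def max_def)
      then have "W = (3 * \<kappa>) ^ n * (l powr \<epsilon>) ^ n" by (simp add: W_def power_mult_distrib)
      also have "(l powr \<epsilon>) ^ n = V powr \<epsilon>"
        using l by (simp add: V_def powr_powr mult.commute flip: powr_realpow)
      finally have W: "W = (3 * \<kappa>) ^ n * V powr \<epsilon>" .
      \<comment> \<open>At small scales W is a multiple of V powr \<epsilon>, and the
        L^(1/\<epsilon>) bound supplies precisely the complementary power of V.\<close>
      have "V powr (1 - \<epsilon>) * V powr \<epsilon> = V" using V by (simp flip: powr_add)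
      then have eqn: "A * V powr (1 - \<epsilon>) * (\<alpha> * \<gamma> * W) = V * (A * (3 * \<kappa>) ^ n * \<alpha> * \<gamma>)"
        unfolding W by (metis (no_types, lifting) mult.assoc mult.commute)
      have "cube_bound U Q (A * V powr (1 - \<epsilon>))" using U(3)[OF l, of a] by (simp add: Q_def V_def n_def)
      from bound[OF this] show ?thesis unfolding eqn .
    qed
  qed
  have const: "set_integrable lebesgue Q (\<lambda>x. z)" for z :: complex
    unfolding set_integrable_def using Qm(1) emeasure_cube_finite[of a l] by (simp add: Q_def)
  have ae: "AE x in lebesgue. U f g x = U f0 g0 x + U f0 g1 x + U f1 g x"
  proof -
    have "AE x in lebesgue. U f g x = U f0 g x + U f1 g x"
      using biadditiveD(1)[OF U(1) L(1,2) g] unfolding feq .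
    moreover have "AE x in lebesgue. U f0 g x = U f0 g0 x + U f0 g1 x"
      using biadditiveD(2)[OF U(1) L(1,3,4)] unfolding geq .
    ultimately show ?thesis by eventually_elim simp
  qed
  have I1: "set_integrable lebesgue Q (\<lambda>x. (U f0 g1 x - b1) + (U f1 g x - b2))"
    by (intro set_integral_add(1) set_integral_diff(1) const UL L g)
  \<comment> \<open>The local term is estimated in absolute value, so only the two separated terms
    contribute to the comparison constant.\<close>
  have "(LINT x:Q|lebesgue. norm (U f g x - (b1 + b2))) \<le> (LINT x:Q|lebesgue. norm (U f0 g0 x)) +
      (LINT x:Q|lebesgue. norm ((U f0 g1 x - b1) + (U f1 g x - b2)))"
  proof (rule set_integral_norm_triangle[OF Qm(1) UL[OF L(1,3)] I1])
    show "set_integrable lebesgue Q (\<lambda>x. U f g x - (b1 + b2))"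
      by (intro set_integral_diff(1) const UL f g)
    show "AE x in lebesgue. norm (U f g x - (b1 + b2)) \<le> norm (U f0 g0 x) + norm ((U f0 g1 x - b1) + (U f1 g x - b2))"
      using ae
    proof eventually_elim
      case (elim x)
      then have "U f g x - (b1 + b2) = U f0 g0 x + ((U f0 g1 x - b1) + (U f1 g x - b2))" by simp
      then show ?case by (simp only: norm_triangle_ineq)
    qed
  qed
  also have "(LINT x:Q|lebesgue. norm ((U f0 g1 x - b1) + (U f1 g x - b2))) \<le>
      (LINT x:Q|lebesgue. norm (U f0 g1 x - b1)) + (LINT x:Q|lebesgue. norm (U f1 g x - b2))"
    by (intro set_integral_norm_triangle[OF Qm(1) _ _ I1] set_integral_diff(1) const UL L g AE_I2 norm_triangle_ineq)
  finally have "(LINT x:Q|lebesgue. norm (U f g x - (b1 + b2))) \<le>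
      V * (A * (3 * \<kappa>) ^ n * \<alpha> * \<gamma>) + (V * (O' * \<alpha> * \<gamma>) + V * (O' * \<alpha> * \<gamma>))"
    using loc b1 b2 by linarith
  also have "\<dots> = V * ((A * (3 * \<kappa>) ^ n + 2 * O') * \<alpha> * \<gamma>)" by (simp add: algebra_simps)
  finally have "(LINT x:cube a l|lebesgue. norm (U f g x - (b1 + b2))) \<le>
      l ^ CARD('n) * ((A * (3 * \<kappa>) ^ n + 2 * O') * \<alpha> * \<gamma>)" by (simp add: Q_def V_def n_def)
  from mean_oscillation_le[OF UL[OF f g, unfolded Q_def] l this]
  show ?thesis by (simp add: \<kappa>_def n_def O'_def mult_ac)
qed

theorem theorem3p1:
  fixes T :: "(real ^ 'n \<Rightarrow> complex) \<Rightarrow> (real ^ 'n \<Rightarrow> complex) \<Rightarrow> 'n::finite distribution"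
    and K :: "real ^ 'n \<Rightarrow> real ^ 'n \<Rightarrow> real ^ 'n \<Rightarrow> complex"
    and T1 T2 :: "(real ^ 'n \<Rightarrow> complex) \<Rightarrow> (real ^ 'n \<Rightarrow> complex) \<Rightarrow> real ^ 'n \<Rightarrow> complex"
    and \<epsilon> s c C :: real
  assumes "continuous_bilinear_operator T"
    and "associated_kernel T K"
    and "0 < \<epsilon>" "\<epsilon> < 1" "0 < s" "s \<le> 1" "0 < c" "0 < C"
    and "\<And>x x' y z. (x, y, z) \<notin> diag3 \<Longrightarrow> (x', y, z) \<notin> diag3 \<Longrightarrow>
           norm (x - x') powr \<epsilon> \<le> c * (norm (x - y) + norm (x - z)) \<Longrightarrow>
           norm (K x y z - K x' y z) \<le>
             C * (norm (x - x') powr s /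
                  (norm (x - y) + norm (x - z)) powr (2 * real CARD('n) + s / \<epsilon>))"
    and "bounded_extension 2 2 1 T T1"
    and "bounded_extension 2 2 (1 / \<epsilon>) T T2"
  shows "\<exists>C'>0. \<forall>U\<in>{T1, T2}. \<forall>f\<in>Linf_c. \<forall>g\<in>Linf_c. \<forall>x.
           sharp_maximal (U f g) x \<le> ennreal C' * maximal2 f x * maximal2 g x"
proof -
  note ext1 = assms(10) and ext2 = assms(11)
  have r: "1 \<le> 1 / \<epsilon>" using assms(3,4) by simp
  have bb: "bounded_bilinear_Lp 2 2 1 T1" "bounded_bilinear_Lp 2 2 (1 / \<epsilon>) T2"
    using ext1 ext2 by (auto simp: bounded_extension_def)
  obtain A1 where A1: "0 \<le> A1" "\<And>a l. 0 < l \<Longrightarrow> cube_bound T1 (cube a l) (A1 * (l ^ CARD('n)) powr (1 - 1 / 1))"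
    using bounded_bilinear_Lp_cube_bound[OF bb(1) order_refl] by blast
  obtain A2 where A2: "0 \<le> A2" "\<And>a l. 0 < l \<Longrightarrow> cube_bound T2 (cube a l) (A2 * (l ^ CARD('n)) powr (1 - 1 / (1 / \<epsilon>)))"
    using bounded_bilinear_Lp_cube_bound[OF bb(2) r] by blast
  have c1: "cube_bound T1 (cube a l) A1" if "0 < l" for a l using A1(2)[OF that, of a] that by simp
  have c2: "cube_bound T2 (cube a l) (A2 * (l ^ CARD('n)) powr (1 - \<epsilon>))" if "0 < l" for a l
    using A2(2)[OF that, of a] by simp
  have eq: "AE x in lebesgue. T1 f g x = T2 f g x" if "f \<in> Lp 2" "g \<in> Lp 2" for f g
    using bounded_extension_unique[OF ext1 order_refl ext2 r that] .
  have eq': "AE x in lebesgue. T2 f g x = T1 f g x" if "f \<in> Lp 2" "g \<in> Lp 2" for f g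
    using eq[OF that] by eventually_elim simp
  have mono: "cube_bound U Q B'" if "cube_bound U Q B" "B \<le> B'"
    for U :: "(real ^ 'n \<Rightarrow> complex) \<Rightarrow> (real ^ 'n \<Rightarrow> complex) \<Rightarrow> real ^ 'n \<Rightarrow> complex" and Q B B'
  proof -
    have "B * sqrt (L2sq f) * sqrt (L2sq g) \<le> B' * sqrt (L2sq f) * sqrt (L2sq g)" for f g :: "real ^ 'n \<Rightarrow> complex"
      using that(2) by (intro mult_right_mono) (auto simp: L2sq_nonneg)
    then show ?thesis using that unfolding cube_bound_def by (meson order_trans)
  qed
  define A where "A = max A1 A2"
  have cb: "cube_bound U (cube a l) A" "cube_bound U (cube a l) (A * (l ^ CARD('n)) powr (1 - \<epsilon>))"
    if "U \<in> {T1, T2}" "0 < l" for U a l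
  proof -
    have "cube_bound U (cube a l) A1"
      using that c1[OF that(2)] cube_bound_cong[OF c1[OF that(2)] c2[OF that(2)] cube_sets eq] by auto
    then show "cube_bound U (cube a l) A" by (rule mono) (simp add: A_def)
    have "cube_bound U (cube a l) (A2 * (l ^ CARD('n)) powr (1 - \<epsilon>))"
      using that c2[OF that(2)] cube_bound_cong[OF c2[OF that(2)] c1[OF that(2)] cube_sets eq'] by auto
    then show "cube_bound U (cube a l) (A * (l ^ CARD('n)) powr (1 - \<epsilon>))"
      by (rule mono) (auto simp: A_def intro: mult_right_mono)
  qed
  have bi: "biadditive U" if "U \<in> {T1, T2}" for U
    using that bb[THEN bounded_bilinear_Lp_biadditive] by auto
  have TU: "T f g \<phi> = (\<integral>x. U f g x * \<phi> x \<partial>lebesgue)"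
    if "U \<in> {T1, T2}" "f \<in> schwartz" "g \<in> schwartz" "\<phi> \<in> schwartz" for U f g \<phi>
    using that ext1 ext2 unfolding bounded_extension_def by auto
  define D where "D = 2 * (A * (3 * (1 + real CARD('n) / c)) ^ CARD('n) + 2 * (osc_const C s (s / \<epsilon>) CARD('n) + 1))"
  have "osc_const C s (s / \<epsilon>) CARD('n) \<ge> 0" using assms(8) by (simp add: osc_const_def)
  moreover have "A * (3 * (1 + real CARD('n) / c)) ^ CARD('n) \<ge> 0"
    using A1(1) assms(7) by (intro mult_nonneg_nonneg zero_le_power) (auto simp: A_def)
  ultimately have D: "D > 0" by (simp add: D_def add_nonneg_pos)
  have "sharp_maximal (U f g) x \<le> ennreal D * maximal2 f x * maximal2 g x"
    if U: "U \<in> {T1, T2}" and f: "f \<in> Linf_c" and g: "g \<in> Linf_c" for U f g x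
  proof -
    obtain p where p: "0 \<le> p" "maximal2 f x = ennreal p"
      "\<And>b m. x \<in> cube b m \<Longrightarrow> 0 < m \<Longrightarrow> (LINT y:cube b m|lebesgue. (norm (f y))\<^sup>2) \<le> p\<^sup>2 * m ^ CARD('n)"
      using maximal2_real[OF f] by blast
    obtain q where q: "0 \<le> q" "maximal2 g x = ennreal q"
      "\<And>b m. x \<in> cube b m \<Longrightarrow> 0 < m \<Longrightarrow> (LINT y:cube b m|lebesgue. (norm (g y))\<^sup>2) \<le> q\<^sup>2 * m ^ CARD('n)"
      using maximal2_real[OF g] by blast
    have fL: "f \<in> Lp 2" and gL: "g \<in> Lp 2" using Linf_c_Lp_2 f g by blast+
    have "sharp_maximal (U f g) x \<le> ennreal (D * (p + d) * (q + d))" if d: "0 < d" for d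
      unfolding sharp_maximal_def
    proof (rule SUP_least)
      fix Q assume "Q \<in> {Q \<in> cubes. x \<in> Q}"
      then obtain a l where Q: "Q = cube a l" "0 < l" "x \<in> cube a l" by (auto simp: cubes_eq)
      have le: "t\<^sup>2 * m ^ CARD('n) \<le> (t + d)\<^sup>2 * m ^ CARD('n)" if "0 \<le> t" "0 < m" for t m :: real
        using that d by (intro mult_right_mono power_mono) auto
      show "(\<integral>\<^sup>+y\<in>Q. ennreal (norm (U f g y - average Q (U f g))) \<partial>lebesgue) / emeasure lebesgue Q
          \<le> ennreal (D * (p + d) * (q + d))"
        unfolding Q(1) D_def
      proof (rule sharp_bound_on_cube[OF assms(2) TU[OF U] bi[OF U] cb[OF U] assms(8,3,4,5,7,9) Q(2) fL gL])
        show "(LINT y:cube b m|lebesgue. (norm (f y))\<^sup>2) \<le> (p + d)\<^sup>2 * m ^ CARD('n)"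
          if "cube a l \<subseteq> cube b m" "0 < m" for b m
          using p(3)[OF subsetD[OF that(1) Q(3)] that(2)] le[OF p(1) that(2)] by (rule order_trans)
        show "(LINT y:cube b m|lebesgue. (norm (g y))\<^sup>2) \<le> (q + d)\<^sup>2 * m ^ CARD('n)"
          if "cube a l \<subseteq> cube b m" "0 < m" for b m
          using q(3)[OF subsetD[OF that(1) Q(3)] that(2)] le[OF q(1) that(2)] by (rule order_trans)
      qed (use p(1) q(1) d in auto)
    qed
    then show ?thesis unfolding p(2) q(2) using D p(1) q(1) by (intro ennreal_le_of_forall_pos) auto
  qed
  with D show ?thesis by blast
qed

end
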